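(* For all partitions $\lambda,\mu\in\mathbb{N}^n$, the coefficient $a_{\lambda,\mu}(\alpha)$ defined by the expansion $J_\lambda^{r\delta}=\sum_{\mu}\alpha^{|\mu|-|\lambda|}\,a_{\lambda,\mu}(\alpha)\,m_\mu$ is a polynomial in $\mathbb{N}[\alpha]$.
   Context: Fix $n\ge 1$. Let $r$ be an indeterminate, $\alpha=1/r$, and work in $\mathbb{Q}(r)[x_1,\dots,x_n]$. A partition is $\lambda\in\mathbb{N}^n$ ($\mathbb{N}$ includes $0$) with $\lambda_1\ge\cdots\ge\lambda_n\ge 0$; $|\lambda|=\sum_i\lambda_i$; $m_\mu$ is the monomial symmetric polynomial. Let $\delta=(n-1,n-2,\dots,1,0)$. It is known that there is a unique symmetric polynomial $P_\lambda^{r\delta}(x)$ of total degree $|\lambda|$ such that $P_\lambda^{r\delta}(\mu+r\delta)=0$ for all partitions $\mu\neq\lambda$ with $|\mu|\le|\lambda|$, and the coefficient of $m_\lambda$ in $P_\lambda^{r\delta}$ is $1$ (the symmetric interpolation polynomial). For a box $(i,j)$ of the Ferrers diagram of $\lambda$ (i.e. $1\le j\le\lambda_i$) let $a_\lambda(i,j)=\lambda_i-j$ and $l_\lambda(i,j)=\#\{k>i:\lambda_k\ge j\}$, and set $c_\lambda(\alpha)=\prod_{s}(\alpha a_\lambda(s)+l_\lambda(s)+1)$, the product over all boxes $s$ of $\lambda$. Define $J_\lambda^{r\delta}(x)=(-1)^{|\lambda|}c_\lambda(\alpha)P_\lambda^{r\delta}(-x)$, and define $a_{\lambda,\mu}(\alpha)\in\mathbb{Q}(\alpha)$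 by $J_\lambda^{r\delta}=\sum_\mu\alpha^{|\mu|-|\lambda|}a_{\lambda,\mu}(\alpha)m_\mu$. *)

theory Defs
  imports
    "HOL-Library.Poly_Mapping"
    "HOL-Combinatorics.Permutations"
    "HOL-Computational_Algebra.Polynomial_Factorial"
begin

text \<open>
  Variables are indexed from 0: the variable \<open>x\<^sub>i\<close> of the usual notation is number \<open>i - 1\<close>, and
  likewise the parts of a partition are numbers \<open>0, \<dots>, n - 1\<close>.
  Exponent vectors, and hence partitions, are finitely supported functions on \<open>nat\<close>; a
  polynomial is a finitely supported function on exponent vectors, multiplied by convolution.
\<close>

type_synonym ratfun = "rat poly fract"
type_synonym expo = "nat \<Rightarrow>\<^sub>0 nat"
type_synonym 'a mpol = "expo \<Rightarrow>\<^sub>0 'a"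

definition indet :: ratfun where
  "indet = to_fract [:0, 1:]"

definition alpha :: ratfun where
  "alpha = 1 / indet"

definition nat_polys_in_alpha :: "ratfun set" where
  "nat_polys_in_alpha = range (\<lambda>q :: nat poly. poly (map_poly of_nat q) alpha)"


definition is_partition :: "nat \<Rightarrow> expo \<Rightarrow> bool" where
  "is_partition n lam \<longleftrightarrow> Poly_Mapping.keys lam \<subseteq> {..<n} \<and>
     (\<forall>i j. i \<le> j \<longrightarrow> j < n \<longrightarrow> Poly_Mapping.lookup lam j \<le> Poly_Mapping.lookup lam i)"

definition weight :: "expo \<Rightarrow> nat" where
  "weight \<eta> = (\<Sum>i\<in>Poly_Mapping.keys \<eta>. Poly_Mapping.lookup \<eta> i)"


definition const_mpol :: "'a::zero \<Rightarrow> 'a mpol" where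
  "const_mpol c = Poly_Mapping.single 0 c"

definition var :: "nat \<Rightarrow> ('a::zero_neq_one) mpol" where
  "var i = Poly_Mapping.single (Poly_Mapping.single i 1) 1"

definition total_degree :: "'a::zero mpol \<Rightarrow> nat" where
  "total_degree p = Max (insert 0 (weight ` Poly_Mapping.keys p))"

text \<open>
  Substitution of \<open>x\<close> for the variables, with coefficients mapped by \<open>h\<close>: evaluation at a point
  for \<open>h = id\<close>, composition with polynomials for \<open>h = const_mpol\<close>.
\<close>
definition subst_mpol :: "('a::zero \<Rightarrow> 'b) \<Rightarrow> (nat \<Rightarrow> 'b) \<Rightarrow> 'a mpol \<Rightarrow> 'b::comm_semiring_1" where
  "subst_mpol h x p = (\<Sum>\<eta>\<in>Poly_Mapping.keys p.
     h (Poly_Mapping.lookup p \<eta>) *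
     (\<Prod>i\<in>Poly_Mapping.keys \<eta>. x i ^ Poly_Mapping.lookup \<eta> i))"

definition in_vars :: "nat \<Rightarrow> 'a::zero mpol \<Rightarrow> bool" where
  "in_vars n p \<longleftrightarrow> (\<forall>\<eta>\<in>Poly_Mapping.keys p. Poly_Mapping.keys \<eta> \<subseteq> {..<n})"

definition symmetric_mpol :: "nat \<Rightarrow> 'a::zero mpol \<Rightarrow> bool" where
  "symmetric_mpol n p \<longleftrightarrow> in_vars n p \<and>
     (\<forall>\<pi> \<eta>. \<pi> permutes {..<n} \<longrightarrow>
        Poly_Mapping.lookup p (Poly_Mapping.map_key \<pi> \<eta>) = Poly_Mapping.lookup p \<eta>)"

text \<open>Each rearrangement of \<open>\<mu>\<close> contributes once, as the rearrangements are collected in a set.\<close>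
definition monomial_sym :: "nat \<Rightarrow> expo \<Rightarrow> ('a::comm_semiring_1) mpol" where
  "monomial_sym n \<mu> = (\<Sum>\<eta>\<in>{Poly_Mapping.map_key \<pi> \<mu> | \<pi>. \<pi> permutes {..<n}}.
     Poly_Mapping.single \<eta> 1)"

text \<open>
  The coefficients of the \<open>m\<^sub>\<mu>\<close>, for symmetric \<open>p\<close>; the lemma \<open>monomial_expansion_unique\<close> shows
  that the description is then proper.
\<close>
definition monomial_coeffs :: "nat \<Rightarrow> ('a::comm_semiring_1) mpol \<Rightarrow> (expo \<Rightarrow>\<^sub>0 'a)" where
  "monomial_coeffs n p = (THE c. (\<forall>\<mu>\<in>Poly_Mapping.keys c. is_partition n \<mu>) \<and>
     p = (\<Sum>\<mu>\<in>Poly_Mapping.keys c.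
            const_mpol (Poly_Mapping.lookup c \<mu>) * monomial_sym n \<mu>))"


lemma lookup_map_key_permutes:
  assumes "\<pi> permutes {..<n}"
  shows "Poly_Mapping.lookup (Poly_Mapping.map_key \<pi> \<eta>) i = Poly_Mapping.lookup \<eta> (\<pi> i)"
  using assms by (simp add: map_key.rep_eq permutes_inj)

lemma keys_map_key_permutes:
  assumes "\<pi> permutes {..<n}" "Poly_Mapping.keys \<eta> \<subseteq> {..<n}"
  shows "Poly_Mapping.keys (Poly_Mapping.map_key \<pi> \<eta>) \<subseteq> {..<n}"
proof
  fix i assume "i \<in> Poly_Mapping.keys (Poly_Mapping.map_key \<pi> \<eta>)"
  then have "\<pi> i \<in> {..<n}"
    using assms by (auto simp: keys_map_key[OF permutes_inj[OF assms(1)]])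
  then show "i \<in> {..<n}" using permutes_in_image[OF assms(1)] by blast
qed

lemma expo_eqI:
  assumes "Poly_Mapping.keys \<eta> \<subseteq> {..<n}" "Poly_Mapping.keys \<theta> \<subseteq> {..<n}"
    and "\<And>i. i < n \<Longrightarrow> Poly_Mapping.lookup \<eta> i = Poly_Mapping.lookup \<theta> (i::nat)"
  shows "\<eta> = (\<theta> :: expo)"
proof (rule poly_mapping_eqI)
  fix i
  show "Poly_Mapping.lookup \<eta> i = Poly_Mapping.lookup \<theta> i"
  proof (cases "i < n")
    case False
    then have "i \<notin> Poly_Mapping.keys \<eta>" "i \<notin> Poly_Mapping.keys \<theta>" using assms by auto
    then show ?thesis unfolding in_keys_iff by presburger
  qed (use assms in simp)
qed

lemma rearrange_to_partition:
  assumes "Poly_Mapping.keys \<eta> \<subseteq> {..<n}"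
  obtains \<pi> where "\<pi> permutes {..<n}" "is_partition n (Poly_Mapping.map_key \<pi> \<eta>)"
proof -
  define xs where "xs = map (Poly_Mapping.lookup \<eta>) [0..<n]"
  have "mset (rev (sort xs)) = mset xs" by simp
  then obtain \<pi> where \<pi>: "\<pi> permutes {..<length xs}" "permute_list \<pi> xs = rev (sort xs)"
    using mset_eq_permutation by metis
  have len: "length xs = n" by (simp add: xs_def)
  have p: "\<pi> permutes {..<n}" using \<pi>(1) len by simp
  have nth: "Poly_Mapping.lookup (Poly_Mapping.map_key \<pi> \<eta>) i = rev (sort xs) ! i" if "i < n" for i
  proof -
    have "\<pi> i < n" using p that permutes_in_image by fastforce
    moreover have "rev (sort xs) ! i = xs ! \<pi> i"
      using permute_list_nth[OF \<pi>(1), of i] \<pi>(2) that len by simp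
    ultimately show ?thesis
      by (simp add: lookup_map_key_permutes[OF p] xs_def)
  qed
  have "rev (sort xs) ! j \<le> rev (sort xs) ! i" if "i \<le> j" "j < n" for i j
    using that len by (auto simp: rev_nth intro!: sorted_nth_mono)
  with nth have "is_partition n (Poly_Mapping.map_key \<pi> \<eta>)"
    unfolding is_partition_def using keys_map_key_permutes[OF p assms] by auto
  with p show thesis by (rule that)
qed

lemma partition_rearrangement_unique:
  assumes \<mu>: "is_partition n \<mu>" and \<nu>: "is_partition n (Poly_Mapping.map_key \<pi> \<mu>)"
    and p: "\<pi> permutes {..<n}"
  shows "Poly_Mapping.map_key \<pi> \<mu> = \<mu>"
proof -
  define xs where "xs = map (Poly_Mapping.lookup \<mu>) [0..<n]"
  define ys where "ys = map (Poly_Mapping.lookup (Poly_Mapping.map_key \<pi> \<mu>)) [0..<n]"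
  have len: "length xs = n" "length ys = n" by (simp_all add: xs_def ys_def)
  have "ys = permute_list \<pi> xs"
  proof (rule nth_equalityI)
    fix i assume "i < length ys"
    then have i: "i < n" by (simp add: len)
    then have "\<pi> i < n" using p permutes_in_image by fastforce
    with i show "ys ! i = permute_list \<pi> xs ! i"
      using permute_list_nth[of \<pi> xs i] p
      by (simp add: len) (simp add: xs_def ys_def lookup_map_key_permutes[OF p])
  qed (simp add: len)
  then have "mset (rev ys) = mset (rev xs)" using p len by simp
  moreover have "sorted (rev xs)" using \<mu> len
    by (auto simp: sorted_iff_nth_mono rev_nth xs_def is_partition_def)
  moreover have "sorted (rev ys)" using \<nu> len
    by (auto simp: sorted_iff_nth_mono rev_nth ys_def is_partition_def)
  ultimately have "rev ys = rev xs" by (metis properties_for_sort)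
  then have "ys = xs" by simp
  then have "Poly_Mapping.lookup (Poly_Mapping.map_key \<pi> \<mu>) i = Poly_Mapping.lookup \<mu> i" if "i < n" for i
    using that by (auto simp: xs_def ys_def)
  then show ?thesis
    using \<mu> \<nu> by (intro expo_eqI) (auto simp: is_partition_def)
qed

lemma lookup_monomial_sym:
  "Poly_Mapping.lookup (monomial_sym n \<mu>) \<eta> =
     (if \<exists>\<pi>. \<pi> permutes {..<n} \<and> \<eta> = Poly_Mapping.map_key \<pi> \<mu> then 1 else 0)"
proof -
  have "finite {Poly_Mapping.map_key \<pi> \<mu> | \<pi>. \<pi> permutes {..<n}}"
    using finite_permutations[of "{..<n}"] by simp
  then show ?thesis
    by (simp add: monomial_sym_def Poly_Mapping.lookup_sum lookup_single when_def) blast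
qed

lemma lookup_const_mpol_mult:
  "Poly_Mapping.lookup (const_mpol c * p) \<eta> = c * Poly_Mapping.lookup p \<eta>"
  for p :: "'a::comm_semiring_1 mpol"
  by (simp add: const_mpol_def mult_map_scale_conv_mult[symmetric] map.rep_eq when_def)

lemma lookup_monomial_sum:
  fixes c :: "expo \<Rightarrow>\<^sub>0 'a::comm_semiring_1"
  assumes c: "\<forall>\<mu>\<in>Poly_Mapping.keys c. is_partition n \<mu>" and "is_partition n \<nu>" "\<pi> permutes {..<n}"
  shows "Poly_Mapping.lookup (\<Sum>\<mu>\<in>Poly_Mapping.keys c.
           const_mpol (Poly_Mapping.lookup c \<mu>) * monomial_sym n \<mu>) (Poly_Mapping.map_key \<pi> \<nu>)
         = Poly_Mapping.lookup c \<nu>"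
proof -
  have orbit: "Poly_Mapping.lookup (monomial_sym n \<mu>) (Poly_Mapping.map_key \<pi> \<nu>) = (if \<mu> = \<nu> then 1 else (0::'a))"
    if "is_partition n \<mu>" for \<mu>
  proof (cases "\<mu> = \<nu>")
    case True then show ?thesis using assms by (auto simp: lookup_monomial_sym)
  next
    case False
    have False if s: "\<sigma> permutes {..<n}" and eq: "Poly_Mapping.map_key \<pi> \<nu> = Poly_Mapping.map_key \<sigma> \<mu>" for \<sigma>
    proof -
      have ip: "inv \<pi> permutes {..<n}" using assms(3) by (rule permutes_inv)
      have sp: "(\<sigma> \<circ> inv \<pi>) permutes {..<n}" using ip s by (rule permutes_compose)
      have "\<nu> = Poly_Mapping.map_key (\<sigma> \<circ> inv \<pi>) \<mu>"
      proof (rule poly_mapping_eqI)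
        fix i
        have "Poly_Mapping.lookup \<nu> i = Poly_Mapping.lookup (Poly_Mapping.map_key \<pi> \<nu>) (inv \<pi> i)"
          using assms(3) by (simp add: lookup_map_key_permutes permutes_inverses)
        also have "\<dots> = Poly_Mapping.lookup (Poly_Mapping.map_key (\<sigma> \<circ> inv \<pi>) \<mu>) i"
          by (simp add: eq lookup_map_key_permutes[OF s] lookup_map_key_permutes[OF sp])
        finally show "Poly_Mapping.lookup \<nu> i = Poly_Mapping.lookup (Poly_Mapping.map_key (\<sigma> \<circ> inv \<pi>) \<mu>) i" .
      qed
      then show False
        using partition_rearrangement_unique[OF \<open>is_partition n \<mu>\<close> _ sp] assms(2)
          \<open>\<mu> \<noteq> \<nu>\<close> by metis
    qed
    then show ?thesis using False by (auto simp: lookup_monomial_sym)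
  qed
  have "Poly_Mapping.lookup (\<Sum>\<mu>\<in>Poly_Mapping.keys c.
           const_mpol (Poly_Mapping.lookup c \<mu>) * monomial_sym n \<mu>) (Poly_Mapping.map_key \<pi> \<nu>)
         = (\<Sum>\<mu>\<in>Poly_Mapping.keys c. if \<mu> = \<nu> then Poly_Mapping.lookup c \<mu> else 0)"
    unfolding Poly_Mapping.lookup_sum lookup_const_mpol_mult using c
    by (intro sum.cong) (simp_all add: orbit)
  then show ?thesis by (simp add: in_keys_iff)
qed

lemma monomial_expansion_unique:
  fixes p :: "'a::comm_semiring_1 mpol"
  assumes "symmetric_mpol n p"
  shows "\<exists>!c. (\<forall>\<mu>\<in>Poly_Mapping.keys c. is_partition n \<mu>) \<and>
     p = (\<Sum>\<mu>\<in>Poly_Mapping.keys c. const_mpol (Poly_Mapping.lookup c \<mu>) * monomial_sym n \<mu>)"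
proof -
  define expand :: "(expo \<Rightarrow>\<^sub>0 'a) \<Rightarrow> 'a mpol" where
    "expand = (\<lambda>c. \<Sum>\<mu>\<in>Poly_Mapping.keys c. const_mpol (Poly_Mapping.lookup c \<mu>) * monomial_sym n \<mu>)"
  define P where "P = (\<lambda>c :: expo \<Rightarrow>\<^sub>0 'a. \<forall>\<mu>\<in>Poly_Mapping.keys c. is_partition n \<mu>)"
  have coeff: "Poly_Mapping.lookup (expand c) (Poly_Mapping.map_key \<pi> \<nu>) = Poly_Mapping.lookup c \<nu>"
    if "P c" "is_partition n \<nu>" "\<pi> permutes {..<n}" for c \<pi> \<nu>
    using that unfolding P_def expand_def by (rule lookup_monomial_sum)
  have rearr: "\<exists>\<pi> \<nu>. \<pi> permutes {..<n} \<and> is_partition n \<nu> \<and> \<eta> = Poly_Mapping.map_key \<pi> \<nu>"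
    if \<eta>: "Poly_Mapping.keys \<eta> \<subseteq> {..<n}" for \<eta>
  proof -
    obtain \<pi> where \<pi>: "\<pi> permutes {..<n}" "is_partition n (Poly_Mapping.map_key \<pi> \<eta>)"
      using rearrange_to_partition[OF \<eta>] .
    have ip: "inv \<pi> permutes {..<n}" using \<pi>(1) by (rule permutes_inv)
    have "\<eta> = Poly_Mapping.map_key (inv \<pi>) (Poly_Mapping.map_key \<pi> \<eta>)"
      by (rule poly_mapping_eqI)
        (simp add: lookup_map_key_permutes[OF \<pi>(1)] lookup_map_key_permutes[OF ip]
          permutes_inverses[OF \<pi>(1)])
    with \<pi> ip show ?thesis by blast
  qed
  have outside: "Poly_Mapping.lookup (expand c) \<eta> = 0"
    if "P c" "\<not> Poly_Mapping.keys \<eta> \<subseteq> {..<n}" for c \<eta>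
  proof -
    have "Poly_Mapping.lookup (monomial_sym n \<mu>) \<eta> = (0::'a)" if "is_partition n \<mu>" for \<mu>
      using that \<open>\<not> Poly_Mapping.keys \<eta> \<subseteq> {..<n}\<close> keys_map_key_permutes
      by (auto simp: lookup_monomial_sym is_partition_def)
    with \<open>P c\<close> show ?thesis
      by (simp add: expand_def P_def Poly_Mapping.lookup_sum lookup_const_mpol_mult)
  qed
  have "finite {\<mu>. (if is_partition n \<mu> then Poly_Mapping.lookup p \<mu> else 0) \<noteq> 0}"
    by (rule finite_subset[OF _ finite_keys[of p]]) (auto simp: in_keys_iff)
  then obtain c where c: "\<And>\<mu>. Poly_Mapping.lookup c \<mu> = (if is_partition n \<mu> then Poly_Mapping.lookup p \<mu> else 0)"
    by (rule_tac that[of "Abs_poly_mapping (\<lambda>\<mu>. if is_partition n \<mu> then Poly_Mapping.lookup p \<mu> else 0)"])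
      (simp add: Abs_poly_mapping_inverse)
  have "P c" unfolding P_def by (auto simp: in_keys_iff c split: if_splits)
  moreover have "p = expand c"
  proof (rule poly_mapping_eqI)
    fix \<eta>
    show "Poly_Mapping.lookup p \<eta> = Poly_Mapping.lookup (expand c) \<eta>"
    proof (cases "Poly_Mapping.keys \<eta> \<subseteq> {..<n}")
      case True
      then obtain \<pi> \<nu> where "\<pi> permutes {..<n}" "is_partition n \<nu>" "\<eta> = Poly_Mapping.map_key \<pi> \<nu>"
        using rearr by blast
      with assms show ?thesis by (simp add: coeff[OF \<open>P c\<close>] c symmetric_mpol_def)
    next
      case False
      with assms have "\<eta> \<notin> Poly_Mapping.keys p" by (auto simp: symmetric_mpol_def in_vars_def)
      with False show ?thesis by (simp add: outside[OF \<open>P c\<close>] in_keys_iff)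
    qed
  qed
  moreover have "c' = c" if "P c'" "p = expand c'" for c'
  proof (rule poly_mapping_eqI)
    fix \<nu>
    show "Poly_Mapping.lookup c' \<nu> = Poly_Mapping.lookup c \<nu>"
    proof (cases "is_partition n \<nu>")
      case True
      then show ?thesis
        using coeff[OF that(1) True permutes_id] coeff[OF \<open>P c\<close> True permutes_id] that(2) \<open>p = expand c\<close>
        by simp
    next
      case False
      with that(1) \<open>P c\<close> show ?thesis by (metis P_def in_keys_iff)
    qed
  qed
  ultimately have "\<exists>!c. P c \<and> p = expand c" by blast
  then show ?thesis by (simp add: P_def expand_def)
qed


text \<open>The point \<open>\<mu> + r\<delta>\<close> with \<open>\<delta> = (n - 1, \<dots>, 1, 0)\<close>.\<close>
definition shifted_point :: "nat \<Rightarrow> expo \<Rightarrow> nat \<Rightarrow> ratfun" where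
  "shifted_point n \<mu> i = of_nat (Poly_Mapping.lookup \<mu> i) + indet * of_nat (n - 1 - i)"

definition is_interpolation_poly :: "nat \<Rightarrow> expo \<Rightarrow> ratfun mpol \<Rightarrow> bool" where
  "is_interpolation_poly n lam p \<longleftrightarrow>
     symmetric_mpol n p \<and>
     total_degree p = weight lam \<and>
     (\<forall>\<mu>. is_partition n \<mu> \<longrightarrow> \<mu> \<noteq> lam \<longrightarrow> weight \<mu> \<le> weight lam \<longrightarrow>
        subst_mpol id (shifted_point n \<mu>) p = 0) \<and>
     Poly_Mapping.lookup (monomial_coeffs n p) lam = 1"

text \<open>That there is exactly one such polynomial for every partition is due to Knop and Sahi.\<close>
definition interpolation_poly :: "nat \<Rightarrow> expo \<Rightarrow> ratfun mpol" where
  "interpolation_poly n lam = (THE p. is_interpolation_poly n lam p)"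


text \<open>Rows of the diagram are numbered from 0, columns from 1.\<close>
definition boxes :: "nat \<Rightarrow> expo \<Rightarrow> (nat \<times> nat) set" where
  "boxes n lam = (SIGMA i:{..<n}. {1..Poly_Mapping.lookup lam i})"

definition arm :: "expo \<Rightarrow> nat \<times> nat \<Rightarrow> nat" where
  "arm lam = (\<lambda>(i, j). Poly_Mapping.lookup lam i - j)"

definition leg :: "nat \<Rightarrow> expo \<Rightarrow> nat \<times> nat \<Rightarrow> nat" where
  "leg n lam = (\<lambda>(i, j). card {k. i < k \<and> k < n \<and> j \<le> Poly_Mapping.lookup lam k})"

definition hook_factor :: "nat \<Rightarrow> expo \<Rightarrow> ratfun" where
  "hook_factor n lam =
     (\<Prod>s\<in>boxes n lam. alpha * of_nat (arm lam s) + of_nat (leg n lam s) + 1)"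

definition integral_interpolation_poly :: "nat \<Rightarrow> expo \<Rightarrow> ratfun mpol" where
  "integral_interpolation_poly n lam =
     const_mpol ((-1) ^ weight lam * hook_factor n lam) *
     subst_mpol const_mpol (\<lambda>i. - var i) (interpolation_poly n lam)"

text \<open>The \<open>a\<close> for which the coefficient of \<open>m\<^sub>\<mu>\<close> is \<open>\<alpha>\<close> to the power \<open>|\<mu>| - |\<lambda>|\<close>, times \<open>a\<close>.\<close>
definition normalized_coeff :: "nat \<Rightarrow> expo \<Rightarrow> expo \<Rightarrow> ratfun" where
  "normalized_coeff n lam \<mu> =
     Poly_Mapping.lookup (monomial_coeffs n (integral_interpolation_poly n lam)) \<mu>
       / alpha powi (int (weight \<mu>) - int (weight lam))"

end

theory Submission
  imports Defs "HOL-Combinatorics.Multiset_Permutations"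
begin

text \<open>
  Up to a factor, \<open>J\<^sub>\<lambda>(r x)\<close> is the symmetric polynomial in \<open>x\<close> that has the \<open>a\<^sub>\<lambda>\<^sub>\<mu>\<close> as coefficients,
  and it vanishes at the points with coordinates \<open>- (\<alpha> \<nu>\<^sub>i + rank\<^sub>i)\<close> for the compositions \<open>\<nu>\<close> with
  \<open>|\<nu>| \<le> |\<lambda>|\<close> that are no rearrangement of \<open>\<lambda>\<close>. Operators \<open>sig\<close> (of order two, satisfying the braid relations) and \<open>Phi\<close> (multiply by
  the last variable and rotate) yield commuting operators \<open>xhat\<close>, and the polynomials \<open>bar \<eta>\<close>
  obtained from \<open>1\<close> by applying \<open>xhat\<^sup>\<eta>\<close> are merely permuted by \<open>sig\<close> and shifted by \<open>Phi\<close>.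

  The product of \<open>x\<^sub>i\<close> and \<open>bar \<eta>\<close> is given by an explicit formula, and this shows that \<open>bar \<eta>\<close> is
  \<open>x\<^sup>\<eta>\<close> plus terms of lower degree, all with coefficients in \<open>\<nat>[\<alpha>]\<close>. On the other hand a version of the
  Knop-Sahi recursion, which removes one box at a time and acts on \<open>bar\<close> by inserting parts, writes
  \<open>J\<^sub>\<lambda>\<close> as a combination of the \<open>bar \<eta>\<close> with coefficients in \<open>\<nat>[\<alpha>]\<close>: the vanishing conditions persist
  because the values at the unwanted insertions cancel, and the recursion makes the leading coefficient the hook
  product \<open>c\<^sub>\<lambda>\<close>.
\<close>

section \<open>Operators on functions of generic points\<close>

text \<open>The operators act on functions of generic points, so that dividing by a coordinate
  difference is division in a field; polynomials enter only once \<open>coord_times_bar\<close>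
  expresses each \<open>bar\<close> through smaller ones. The vanishing points are themselves
  generic. Where two neighbouring parts tie, their coordinates differ by exactly -1, which kills the
  coefficient of the swapped value in \<open>sig\<close>; this is why vanishing conditions survive.

  The delicate point of the recursion is the normalization. Single coefficients are not followed,
  only their totals over classes of rearrangements. As \<open>bar \<eta>\<close> has one monomial of
  top degree, and the final function is symmetric, the total divided by the number of rearrangements
  is the leading coefficient.

  The first column of the diagram is added last and differently: plain sums over insertion positions
  give up the support at a single label in exchange for full symmetry. Existence and uniqueness of
  the interpolation polynomial come out on the way, from the construction and from
  \<open>vanishing_zero\<close>.\<close>

lemma indet_times_alpha: "indet * alpha = 1" "alpha * indet = 1" "indet \<noteq> 0" "alpha \<noteq> 0"
proof -
  show "indet \<noteq> 0"
    unfolding indet_def by (simp add: to_fract_def Zero_fract_def eq_fract)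
  then show "indet * alpha = 1" "alpha * indet = 1" "alpha \<noteq> 0"
    by (simp_all add: alpha_def)
qed

lemma of_int_to_fract: "(of_int k :: ratfun) = to_fract [:of_int k:]"
proof -
  have nat: "(of_nat m :: ratfun) = to_fract [:of_nat m:]" for m
    by (induction m) (simp_all add: to_fract_def One_fract_def Zero_fract_def eq_fract one_pCons)
  show ?thesis
  proof (cases k)
    case (nonneg m)
    then show ?thesis using nat[of m] by simp
  next
    case (neg m)
    then show ?thesis using nat[of "Suc m"] by (simp add: to_fract_def del: of_nat_Suc)
  qed
qed

text \<open>After multiplication by r both sides are rational polynomials in the indeterminate, one
  of degree 0 and one without constant term. This keeps the vanishing points apart and the hook
  factors nonzero.\<close>

lemma alpha_generic:
  assumes "of_int k * alpha = of_int l"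
  shows "k = 0" "l = 0"
proof -
  have "of_int k = of_int l * indet"
    using assms indet_times_alpha by (metis mult.assoc mult.right_neutral)
  then have "to_fract [:of_int k:] = to_fract ([:of_int l:] * [:0, 1:] :: rat poly)"
    unfolding of_int_to_fract indet_def by (simp add: to_fract_def)
  then have "[:of_int k:] = ([:of_int l:] * [:0, 1:] :: rat poly)"
    by (simp add: to_fract_def eq_fract)
  then show "k = 0" "l = 0" by (auto split: if_splits)
qed

lemma alpha_generic_nat:
  assumes "alpha * of_nat k + of_nat l = 0"
  shows "k = 0" "l = 0"
  using alpha_generic[of "int k" "- int l"] assms by (auto simp: algebra_simps eq_neg_iff_add_eq_0)

text \<open>
  On these points the denominators in \<open>sig\<close> below do not vanish, and the points are closed under
  permuting the coordinates and shifting them by \<open>\<alpha>\<close>.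
\<close>
typedef point = "{x :: nat \<Rightarrow> ratfun. \<forall>i j k. i \<noteq> j \<longrightarrow> x i - x j \<noteq> of_int k * alpha}"
proof -
  have "of_nat i - of_nat j \<noteq> of_int k * alpha" if "i \<noteq> j" for i j :: nat and k
    using alpha_generic(2)[of k "int i - int j"] that by auto
  then show ?thesis by (intro exI[of _ of_nat]) auto
qed

abbreviation coord :: "point \<Rightarrow> nat \<Rightarrow> ratfun" where "coord \<equiv> Rep_point"

lemma coord_diff: "i \<noteq> j \<Longrightarrow> coord p i - coord p j \<noteq> of_int k * alpha"
  using Rep_point[of p] by auto

lemma coord_eq_iff: "coord p i = coord p j \<longleftrightarrow> i = j"
  using coord_diff[of i j p 0] by auto

lemma point_eqI: "(\<And>i. coord p i = coord q i) \<Longrightarrow> p = q"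
  by (simp add: Rep_point_inject[symmetric] ext)

definition swap_point :: "nat \<Rightarrow> point \<Rightarrow> point" where
  "swap_point i p = Abs_point (\<lambda>j. coord p (transpose i (Suc i) j))"

definition rotate_point :: "nat \<Rightarrow> point \<Rightarrow> point" where
  "rotate_point n p = Abs_point (\<lambda>j. if j = 0 then coord p (n - 1) + alpha
     else if j < n then coord p (j - 1) else coord p j)"

lemma coord_swap: "coord (swap_point i p) j = coord p (transpose i (Suc i) j)"
proof -
  have "transpose i (Suc i) k \<noteq> transpose i (Suc i) l" if "k \<noteq> l" for k l
    using that by (metis transpose_involutory)
  then show ?thesis unfolding swap_point_def
    by (subst Abs_point_inverse) (auto simp: coord_diff)
qed

lemma coord_rotate:
  assumes "n > 0"
  shows "coord (rotate_point n p) j = (if j = 0 then coord p (n - 1) + alpha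
     else if j < n then coord p (j - 1) else coord p j)"
proof -
  define s where "s j = (if j = 0 then n - 1 else if j < n then j - 1 else j)" for j
  define e :: "nat \<Rightarrow> int" where "e j = (if j = 0 then 1 else 0)" for j
  have eq: "(\<lambda>j. if j = 0 then coord p (n - 1) + alpha else if j < n then coord p (j - 1) else coord p j)
    = (\<lambda>j. coord p (s j) + of_int (e j) * alpha)"
    by (auto simp: s_def e_def)
  have "(coord p (s i) + of_int (e i) * alpha) - (coord p (s j) + of_int (e j) * alpha) \<noteq> of_int k * alpha"
    if "i \<noteq> j" for i j k
  proof -
    have "s i \<noteq> s j" using that assms by (auto simp: s_def split: if_splits)
    from coord_diff[OF this, of p "k + e j - e i"] show ?thesis
      by (simp add: algebra_simps)
  qed
  then show ?thesis unfolding rotate_point_def eq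
    by (subst Abs_point_inverse) (auto simp: s_def e_def)
qed

text \<open>The transposition minus the divided difference: a generator of the degenerate Hecke
  action.\<close>

definition sig :: "nat \<Rightarrow> (point \<Rightarrow> ratfun) \<Rightarrow> point \<Rightarrow> ratfun" where
  "sig i f = (\<lambda>p. (1 + 1 / (coord p i - coord p (Suc i))) * f (swap_point i p)
      - f p / (coord p i - coord p (Suc i)))"

text \<open>The affine generator; the factor in front makes it raise degrees by one and supplies
  extra zeros at labels with last part 0.\<close>

definition Phi :: "nat \<Rightarrow> (point \<Rightarrow> ratfun) \<Rightarrow> point \<Rightarrow> ratfun" where
  "Phi n f = (\<lambda>p. coord p (n - 1) * f (rotate_point n p))"

lemma swap_swap [simp]: "swap_point i (swap_point i p) = p"
  by (rule point_eqI) (simp add: coord_swap)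

lemma sig_sig [simp]: "sig i (sig i f) = f"
proof
  fix p
  define d where "d = coord p i - coord p (Suc i)"
  have d: "d \<noteq> 0" using coord_eq_iff[of p i "Suc i"] by (simp add: d_def)
  have "coord (swap_point i p) i - coord (swap_point i p) (Suc i) = - d"
    by (simp add: coord_swap d_def)
  then show "sig i (sig i f) p = f p"
    using d by (simp add: sig_def flip: d_def) (simp add: field_simps)
qed

lemma sig_commute_aux:
  assumes "Suc i < j"
  shows "sig i (sig j f) = sig j (sig i f)"
proof
  fix p
  have c: "coord (swap_point i p) j = coord p j" "coord (swap_point i p) (Suc j) = coord p (Suc j)"
    "coord (swap_point j p) i = coord p i" "coord (swap_point j p) (Suc i) = coord p (Suc i)"
    using assms by (simp_all add: coord_swap transpose_def)
  have s: "swap_point i (swap_point j p) = swap_point j (swap_point i p)"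
    using assms by (intro point_eqI) (auto simp: coord_swap transpose_def)
  show "sig i (sig j f) p = sig j (sig i f) p"
    by (simp add: sig_def c s algebra_simps diff_divide_distrib add_divide_distrib)
qed

lemma sig_commute: "Suc i < j \<or> Suc j < i \<Longrightarrow> sig i (sig j f) = sig j (sig i f)"
  using sig_commute_aux by metis

text \<open>The values of the function at the six permuted points are free variables here. The two
  braid words differ by a multiple of \<open>u * v - (u * w + w * v)\<close>, which is 0 for the
  reciprocals of \<open>a - b\<close>, \<open>b - c\<close> and \<open>a - c\<close>.\<close>

lemma braid_identity:
  fixes u v w :: "'a::comm_ring_1"
  shows "(1 + u) * ((1 + w) * ((1 + v) * z - y2 * v) - ((1 + - u) * x - y1 * - u) * w)
      - ((1 + v) * ((1 + w) * y4 - y3 * w) - ((1 + u) * y1 - x * u) * v) * u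
    - ((1 + v) * ((1 + w) * ((1 + u) * z - y4 * u) - ((1 + - v) * x - y3 * - v) * w)
      - ((1 + u) * ((1 + w) * y2 - y1 * w) - ((1 + v) * y3 - x * v) * u) * v)
    = (u * v - (u * w + w * v)) * ((1 + u) * y1 - (1 + v) * y3 - (u - v) * x)"
  by (simp add: algebra_simps)

lemma sig_braid: "sig i (sig (Suc i) (sig i f)) = sig (Suc i) (sig i (sig (Suc i) f))"
proof
  fix p
  let ?s = "swap_point i" and ?t = "swap_point (Suc i)"
  define a b c where "a = coord p i" and "b = coord p (Suc i)" and "c = coord p (Suc (Suc i))"
  have co: "coord (?s p) i = b" "coord (?s p) (Suc i) = a" "coord (?s p) (Suc (Suc i)) = c"
    "coord (?t p) i = a" "coord (?t p) (Suc i) = c" "coord (?t p) (Suc (Suc i)) = b"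
    "coord (?t (?s p)) i = b" "coord (?t (?s p)) (Suc i) = c" "coord (?t (?s p)) (Suc (Suc i)) = a"
    "coord (?s (?t p)) i = c" "coord (?s (?t p)) (Suc i) = a" "coord (?s (?t p)) (Suc (Suc i)) = b"
    by (simp_all add: coord_swap transpose_def a_def b_def c_def)
  have st: "?s (?t (?s p)) = ?t (?s (?t p))"
    by (intro point_eqI) (auto simp: coord_swap transpose_def)
  have nz: "a - b \<noteq> 0" "a - c \<noteq> 0" "b - c \<noteq> 0" "b - a \<noteq> 0" "c - a \<noteq> 0" "c - b \<noteq> 0"
    using coord_eq_iff[of p] by (simp_all add: a_def b_def c_def)
  define u v w where "u = 1 / (a - b)" and "v = 1 / (b - c)" and "w = 1 / (a - c)"
  have uv: "1 / (b - a) = - u" "1 / (c - a) = - w" "1 / (c - b) = - v"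
    using nz by (simp_all add: u_def v_def w_def field_simps)
  \<comment> \<open>Partial fractions, used with \<open>x + y = a - c\<close>.\<close>
  have "1 / x * (1 / y) = 1 / x * (1 / (x + y)) + 1 / (x + y) * (1 / y)"
    if "x \<noteq> 0" "y \<noteq> 0" "x + y \<noteq> 0" for x y :: ratfun
    using that by (simp add: divide_simps)
  from this[of "a - b" "b - c"] have key: "u * v = u * w + w * v"
    using nz by (simp add: u_def v_def w_def)
  have sg: "sig j g q = (1 + 1 / (coord q j - coord q (Suc j))) * g (swap_point j q)
     - g q * (1 / (coord q j - coord q (Suc j)))" for j g q
    by (simp add: sig_def)
  have LHS: "sig i (sig (Suc i) (sig i f)) p =
    (1 + u) * ((1 + w) * ((1 + v) * f (?t (?s (?t p))) - f (?t (?s p)) * v)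
      - ((1 + - u) * f p - f (?s p) * - u) * w)
    - ((1 + v) * ((1 + w) * f (?s (?t p)) - f (?t p) * w) - ((1 + u) * f (?s p) - f p * u) * v) * u"
    unfolding sg co st swap_swap a_def[symmetric] b_def[symmetric] c_def[symmetric]
      uv u_def[symmetric] v_def[symmetric] w_def[symmetric] ..
  have RHS: "sig (Suc i) (sig i (sig (Suc i) f)) p =
    (1 + v) * ((1 + w) * ((1 + u) * f (?t (?s (?t p))) - f (?s (?t p)) * u)
      - ((1 + - v) * f p - f (?t p) * - v) * w)
    - ((1 + u) * ((1 + w) * f (?t (?s p)) - f (?s p) * w) - ((1 + v) * f (?t p) - f p * v) * u) * v"
    unfolding sg co st swap_swap a_def[symmetric] b_def[symmetric] c_def[symmetric]
      uv u_def[symmetric] v_def[symmetric] w_def[symmetric] ..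
  have "sig i (sig (Suc i) (sig i f)) p - sig (Suc i) (sig i (sig (Suc i) f)) p
    = (u * v - (u * w + w * v)) * ((1 + u) * f (?s p) - (1 + v) * f (?t p) - (u - v) * f p)"
    unfolding LHS RHS by (rule braid_identity)
  with key show "sig i (sig (Suc i) (sig i f)) p = sig (Suc i) (sig i (sig (Suc i) f)) p"
    by simp
qed

lemma Phi_sig:
  assumes "Suc (Suc i) < n"
  shows "Phi n (sig (Suc i) f) = sig i (Phi n f)"
proof
  fix p
  have n: "n > 0" using assms by simp
  have c: "coord (rotate_point n p) (Suc i) = coord p i"
    "coord (rotate_point n p) (Suc (Suc i)) = coord p (Suc i)"
    "coord (swap_point i p) (n - 1) = coord p (n - 1)"
    using assms by (auto simp: coord_rotate[OF n] coord_swap transpose_def)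
  have s: "swap_point (Suc i) (rotate_point n p) = rotate_point n (swap_point i p)"
    using assms by (intro point_eqI) (auto simp: coord_rotate[OF n] coord_swap transpose_def)
  show "Phi n (sig (Suc i) f) p = sig i (Phi n f) p"
    using c(3) by (simp add: Phi_def sig_def c s algebra_simps)
qed

text \<open>Two rotations bring the last two coordinates to the front, both raised by
  \<open>alpha\<close>, so their difference is unchanged; the two prefactors multiply to a product
  symmetric in these coordinates.\<close>

lemma Phi_Phi_sig:
  assumes "n \<ge> 2"
  shows "Phi n (Phi n (sig 0 f)) = sig (n - 2) (Phi n (Phi n f))"
proof
  fix p
  obtain m where m: "n = Suc (Suc m)"
    using assms by (metis add_2_eq_Suc le_Suc_ex)
  define q where "q = rotate_point n (rotate_point n p)"
  have c: "coord q 0 = coord p m + alpha" "coord q (Suc 0) = coord p (Suc m) + alpha"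
    "coord (rotate_point n p) (Suc m) = coord p m"
    "coord (rotate_point n (swap_point m p)) (Suc m) = coord p (Suc m)"
    "coord (swap_point m p) (Suc m) = coord p m"
    by (simp_all add: q_def m coord_rotate coord_swap)
  have s: "swap_point 0 q = rotate_point n (rotate_point n (swap_point m p))"
  proof (rule point_eqI)
    fix i
    consider "i = 0" | "i = Suc 0" | k where "i = Suc (Suc k)" by (metis not0_implies_Suc)
    then show "coord (swap_point 0 q) i = coord (rotate_point n (rotate_point n (swap_point m p))) i"
      by cases (auto simp: q_def m coord_rotate coord_swap transpose_def)
  qed
  have "coord p (Suc m) * (coord p m * ((1 + 1 / d) * y - x / d))
    = (1 + 1 / d) * (coord p m * (coord p (Suc m) * y)) - coord p (Suc m) * (coord p m * x) / d" for d y x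
    by (simp add: algebra_simps diff_divide_distrib)
  then show "Phi n (Phi n (sig 0 f)) p = sig (n - 2) (Phi n (Phi n f)) p"
    by (simp add: Phi_def sig_def c[unfolded m] s[unfolded m] m flip: q_def[unfolded m])
qed

section \<open>Products of consecutive \<open>sig\<close> and the commuting operators
  \<open>xhat\<close>\<close>

definition chain :: "nat \<Rightarrow> nat \<Rightarrow> (point \<Rightarrow> ratfun) \<Rightarrow> point \<Rightarrow> ratfun" where
  "chain i j f = foldr sig [i..<j] f"

lemma chain_empty [simp]: "j \<le> i \<Longrightarrow> chain i j f = f"
  by (simp add: chain_def)

lemma chain_Cons: "i < j \<Longrightarrow> chain i j f = sig i (chain (Suc i) j f)"
  by (simp add: chain_def upt_conv_Cons)

lemma chain_snoc: "i \<le> j \<Longrightarrow> chain i (Suc j) f = chain i j (sig j f)"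
  by (simp add: chain_def)

lemma sig_chain_far:
  assumes "Suc l < i \<or> j < l"
  shows "sig l (chain i j f) = chain i j (sig l f)"
proof (cases "i \<le> j")
  case True
  then show ?thesis using assms
  proof (induction rule: inc_induct)
    case (step k)
    then have "sig l (chain k j f) = sig k (sig l (chain (Suc k) j f))"
      by (subst chain_Cons) (auto intro: sig_commute)
    moreover have "sig l (chain (Suc k) j f) = chain (Suc k) j (sig l f)"
      using step by auto
    ultimately show ?case using step by (simp add: chain_Cons[of k])
  qed simp
qed simp

text \<open>One braid relation in the middle of the chain lowers the index; all other factors
  commute with the operator passing through.\<close>

lemma sig_chain:
  assumes "i \<le> l" "Suc l < j"
  shows "sig (Suc l) (chain i j f) = chain i j (sig l f)"
  using assms
proof (induction rule: inc_induct)
  case base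
  then have "sig (Suc l) (chain l j f) = sig (Suc l) (sig l (sig (Suc l) (chain (Suc (Suc l)) j f)))"
    by (simp add: chain_Cons)
  also have "\<dots> = sig l (sig (Suc l) (sig l (chain (Suc (Suc l)) j f)))"
    by (simp add: sig_braid)
  also have "\<dots> = chain l j (sig l f)"
    using base by (simp add: chain_Cons sig_chain_far)
  finally show ?case .
next
  case (step k)
  have "sig (Suc l) (sig k g) = sig k (sig (Suc l) g)" for g
    using step by (intro sig_commute) auto
  with step have "sig (Suc l) (chain k j f) = sig k (sig (Suc l) (chain (Suc k) j f))"
    by (simp add: chain_Cons[of k j])
  with step show ?case by (simp add: chain_Cons[of k j])
qed

lemma Phi_chain:
  assumes "Suc j < n"
  shows "Phi n (chain (Suc i) (Suc j) f) = chain i j (Phi n f)"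
proof (cases "i \<le> j")
  case True
  then show ?thesis
  proof (induction rule: inc_induct)
    case (step k)
    then show ?case using assms by (simp add: chain_Cons Phi_sig)
  qed simp
qed simp

text \<open>The left factor of \<open>xhat\<close>. On \<open>bar \<eta>\<close> it takes away the
  first part, raises it and puts it back at position \<open>i\<close>, see
  \<open>insert_bar\<close>.\<close>

definition insert_op :: "nat \<Rightarrow> nat \<Rightarrow> (point \<Rightarrow> ratfun) \<Rightarrow> point \<Rightarrow> ratfun" where
  "insert_op n i f = chain i (n - 1) (Phi n f)"

text \<open>Built like Cherednik's operators. As \<open>sig i\<close> is its own inverse,
  conjugation with it takes \<open>xhat n i\<close> to \<open>xhat n (Suc i)\<close> without
  correction terms.\<close>

definition xhat :: "nat \<Rightarrow> nat \<Rightarrow> (point \<Rightarrow> ratfun) \<Rightarrow> point \<Rightarrow> ratfun" where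
  "xhat n i f = chain i (n - 1) (Phi n (chain 0 i f))"

lemma sig_xhat:
  assumes "Suc i < n"
  shows "sig i (xhat n i f) = xhat n (Suc i) (sig i f)"
  using assms by (simp add: xhat_def chain_Cons[of i] chain_snoc)

lemma sig_xhat_Suc:
  assumes "Suc i < n"
  shows "sig i (xhat n (Suc i) f) = xhat n i (sig i f)"
  using sig_xhat[OF assms, of "sig i f"] by (metis sig_sig)

lemma sig_xhat_other:
  assumes "i < n" "Suc j < n" "j \<noteq> i" "Suc j \<noteq> i"
  shows "sig j (xhat n i f) = xhat n i (sig j f)"
proof (cases "i < j")
  case True
  then obtain l where l: "j = Suc l" "i \<le> l" by (metis Suc_le_eq less_eq_Suc_le less_imp_Suc_add le_add1 add_Suc)
  then show ?thesis using assms
    by (simp add: xhat_def sig_chain sig_chain_far flip: Phi_sig)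
next
  case False
  then have "Suc j < i" using assms by simp
  then show ?thesis using assms
    by (simp add: xhat_def sig_chain sig_chain_far flip: Phi_sig)
qed

text \<open>The leading \<open>sig 0\<close> of \<open>chain 0 (Suc i)\<close> passes two factors
  \<open>Phi\<close> and comes out as \<open>sig (n - 2)\<close>, the factor missing at the end of
  the other chain.\<close>

lemma Phi_xhat_Suc:
  assumes "Suc i < n"
  shows "Phi n (xhat n (Suc i) f) = xhat n i (Phi n f)"
proof -
  obtain k where k: "n = Suc (Suc k)" using assms by (metis less_imp_Suc_add add_Suc)
  have i: "i \<le> k" using assms k by simp
  have "Phi n (xhat n (Suc i) f) = chain i k (Phi n (Phi n (chain 0 (Suc i) f)))"
    using k by (simp add: xhat_def Phi_chain)
  also have "chain 0 (Suc i) f = sig 0 (chain (Suc 0) (Suc i) f)" by (simp add: chain_Cons)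
  also have "Phi n (Phi n \<dots>) = sig k (Phi n (Phi n (chain (Suc 0) (Suc i) f)))"
    using Phi_Phi_sig[of n] k by simp
  also have "Phi n (chain (Suc 0) (Suc i) f) = chain 0 i (Phi n f)"
    using assms by (simp add: Phi_chain)
  also have "chain i k (sig k (Phi n (chain 0 i (Phi n f)))) = xhat n i (Phi n f)"
    using i k by (simp add: xhat_def flip: chain_snoc)
  finally show ?thesis .
qed

lemma Phi_xhat_0: "Phi n (xhat n 0 f) = xhat n (n - 1) (Phi n f)"
  by (simp add: xhat_def)

lemma chain_xhat_other:
  assumes "i < n" "k < n" "i < j \<or> k < i"
  shows "chain j k (xhat n i f) = xhat n i (chain j k f)"
proof (cases "j \<le> k")
  case True
  then show ?thesis using assms(3)
  proof (induction rule: inc_induct)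
    case (step l)
    then have "chain l k (xhat n i f) = sig l (xhat n i (chain (Suc l) k f))"
      by (auto simp: chain_Cons)
    also have "\<dots> = xhat n i (sig l (chain (Suc l) k f))"
      using step assms by (intro sig_xhat_other) auto
    finally show ?case using step by (simp add: chain_Cons)
  qed simp
qed simp

lemma chain_split: "i \<le> k \<Longrightarrow> k \<le> j \<Longrightarrow> chain i j f = chain i k (chain k j f)"
proof -
  assume "i \<le> k" "k \<le> j"
  then have "[i..<j] = [i..<k] @ [k..<j]" by (metis le_Suc_ex upt_add_eq_append)
  then show ?thesis by (simp add: chain_def)
qed

text \<open>On the way through \<open>Phi\<close> and \<open>sig 0, ..., sig (n - 2)\<close>, the
  operator \<open>xhat n i\<close> becomes \<open>xhat n (Suc i)\<close> at \<open>sig i\<close>,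
  commutes with the other \<open>sig\<close> that it meets, and is turned back by
  \<open>Phi\<close>.\<close>

lemma xhat_commute_last:
  assumes "Suc i < n"
  shows "xhat n (n - 1) (xhat n i f) = xhat n i (xhat n (n - 1) f)"
proof -
  have "chain 0 (n - 1) (xhat n i f) = chain 0 i (sig i (chain (Suc i) (n - 1) (xhat n i f)))"
    using assms by (simp add: chain_split[of 0 i "n - 1"] chain_Cons[of i "n - 1"] del: One_nat_def)
  also have "chain (Suc i) (n - 1) (xhat n i f) = xhat n i (chain (Suc i) (n - 1) f)"
    using assms by (intro chain_xhat_other) auto
  also have "sig i \<dots> = xhat n (Suc i) (chain i (n - 1) f)"
    using assms by (simp add: sig_xhat chain_Cons[of i])
  also have "chain 0 i \<dots> = xhat n (Suc i) (chain 0 i (chain i (n - 1) f))"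
    using assms by (intro chain_xhat_other) auto
  also have "chain 0 i (chain i (n - 1) f) = chain 0 (n - 1) f"
    using assms by (intro chain_split[symmetric]) auto
  finally have "xhat n (n - 1) (xhat n i f) = Phi n (xhat n (Suc i) (chain 0 (n - 1) f))"
    by (simp add: xhat_def)
  also have "\<dots> = xhat n i (Phi n (chain 0 (n - 1) f))"
    using assms by (rule Phi_xhat_Suc)
  finally show ?thesis by (simp add: xhat_def)
qed

text \<open>Descending induction on the larger index from \<open>n - 1\<close>:
  \<open>xhat n l\<close> is the conjugate of \<open>xhat n (Suc l)\<close> by \<open>sig l\<close>,
  and \<open>sig l\<close> commutes with \<open>xhat n i\<close> for \<open>i < l\<close>.\<close>

lemma xhat_commute:
  assumes "i < n" "j < n"
  shows "xhat n i (xhat n j f) = xhat n j (xhat n i f)"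
proof -
  have less: "xhat n j (xhat n i f) = xhat n i (xhat n j f)" if "i < j" "j < n" for i j f
  proof -
    have "j \<le> n - 1" using that by simp
    then show ?thesis using that(1)
    proof (induction arbitrary: f rule: inc_induct)
      case base
      then show ?case using that by (intro xhat_commute_last) auto
    next
      case (step l)
      have eq: "xhat n l g = sig l (xhat n (Suc l) (sig l g))" for g
        using step by (simp add: sig_xhat_Suc)
      have "xhat n l (xhat n i f) = sig l (xhat n (Suc l) (xhat n i (sig l f)))"
        unfolding eq using step by (simp add: sig_xhat_other)
      also have "\<dots> = sig l (xhat n i (xhat n (Suc l) (sig l f)))"
        using step by simp
      also have "\<dots> = xhat n i (sig l (xhat n (Suc l) (sig l f)))"
        using step by (intro sig_xhat_other) auto
      finally show ?case by (simp flip: eq)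
    qed
  qed
  show ?thesis
    using less[of i j f] less[of j i f] assms by (cases i j rule: linorder_cases) auto
qed

section \<open>A basis with prescribed leading monomials\<close>

lemma sig_one [simp]: "sig i (\<lambda>_. 1) = (\<lambda>_. 1)"
  by (simp add: sig_def)

lemma chain_one [simp]: "chain i j (\<lambda>_. 1) = (\<lambda>_. 1)"
proof -
  have "foldr sig xs (\<lambda>_. 1) = (\<lambda>_. 1)" for xs by (induction xs) auto
  then show ?thesis by (simp add: chain_def)
qed

section \<open>Compositions as labels, and their generation by rotations and adjacent swaps\<close>

definition comps :: "nat \<Rightarrow> (nat \<Rightarrow> nat) set" where
  "comps n = {\<eta>. \<forall>i\<ge>n. \<eta> i = 0}"

definition csize :: "nat \<Rightarrow> (nat \<Rightarrow> nat) \<Rightarrow> nat" where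
  "csize n \<eta> = (\<Sum>i<n. \<eta> i)"

definition swapE :: "nat \<Rightarrow> (nat \<Rightarrow> nat) \<Rightarrow> nat \<Rightarrow> nat" where
  "swapE i \<eta> = \<eta> \<circ> transpose i (Suc i)"

definition insE :: "nat \<Rightarrow> (nat \<Rightarrow> nat) \<Rightarrow> nat \<Rightarrow> nat" where
  "insE i \<eta> = (\<lambda>j. if j < i then \<eta> (Suc j) else if j = i then Suc (\<eta> 0) else \<eta> j)"

lemma zero_comps [simp]: "(\<lambda>_. 0) \<in> comps n"
  by (simp add: comps_def)

lemma comps_pos: "\<eta> \<in> comps n \<Longrightarrow> \<eta> i > 0 \<Longrightarrow> i < n"
  by (rule ccontr) (simp add: comps_def)

lemma upd_comps [simp]: "\<eta> \<in> comps n \<Longrightarrow> i < n \<Longrightarrow> \<eta>(i := k) \<in> comps n"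
  by (auto simp: comps_def)

lemma swapE_comps [simp]: "\<eta> \<in> comps n \<Longrightarrow> Suc i < n \<Longrightarrow> swapE i \<eta> \<in> comps n"
  by (auto simp: comps_def swapE_def transpose_def)

lemma insE_comps [simp]: "\<eta> \<in> comps n \<Longrightarrow> i < n \<Longrightarrow> insE i \<eta> \<in> comps n"
  by (auto simp: comps_def insE_def)

lemma swapE_swapE [simp]: "swapE i (swapE i \<eta>) = \<eta>"
  by (simp add: swapE_def comp_assoc)

lemma csize_zero [simp]: "csize n (\<lambda>_. 0) = 0"
  by (simp add: csize_def)

lemma csize_upd:
  assumes "i < n"
  shows "csize n (\<eta>(i := k)) + \<eta> i = csize n \<eta> + k"
proof -
  have "csize n \<eta> = \<eta> i + (\<Sum>j\<in>{..<n} - {i}. \<eta> j)"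
    using assms by (simp add: csize_def sum.remove)
  moreover have "csize n (\<eta>(i := k)) = k + (\<Sum>j\<in>{..<n} - {i}. (\<eta>(i := k)) j)"
    using assms by (simp add: csize_def sum.remove)
  moreover have "(\<Sum>j\<in>{..<n} - {i}. (\<eta>(i := k)) j) = (\<Sum>j\<in>{..<n} - {i}. \<eta> j)"
    by (intro sum.cong) auto
  ultimately show ?thesis by simp
qed

lemma csize_swapE [simp]:
  assumes "Suc i < n"
  shows "csize n (swapE i \<eta>) = csize n \<eta>"
proof -
  have "transpose i (Suc i) permutes {..<n}" using assms by (intro permutes_swap_id) auto
  then show ?thesis unfolding csize_def swapE_def
    by (simp add: sum.permute[of "transpose i (Suc i)" "{..<n}" \<eta>])
qed

lemma insE_0: "insE 0 \<eta> = \<eta>(0 := Suc (\<eta> 0))"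
  by (auto simp: insE_def)

lemma insE_Suc: "insE (Suc i) \<eta> = swapE i (insE i \<eta>)"
  by (auto simp: insE_def swapE_def transpose_def fun_eq_iff)

lemma csize_insE [simp]: "i < n \<Longrightarrow> csize n (insE i \<eta>) = Suc (csize n \<eta>)"
proof (induction i)
  case 0
  then show ?case using csize_upd[of 0 n \<eta> "Suc (\<eta> 0)"] by (simp add: insE_0 del: fun_upd_apply)
next
  case (Suc i)
  then show ?case by (simp add: insE_Suc)
qed

lemma csize_eq_0: "\<eta> \<in> comps n \<Longrightarrow> csize n \<eta> = 0 \<longleftrightarrow> \<eta> = (\<lambda>_. 0)"
  by (force simp: csize_def comps_def fun_eq_iff not_le)

lemma comp_induct [consumes 1, case_names zero add]:
  assumes "\<eta> \<in> comps n" and "P (\<lambda>_. 0)"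
    and "\<And>\<eta> i. \<eta> \<in> comps n \<Longrightarrow> i < n \<Longrightarrow> P \<eta> \<Longrightarrow> P (\<eta>(i := Suc (\<eta> i)))"
  shows "P \<eta>"
  using assms(1)
proof (induction "csize n \<eta>" arbitrary: \<eta>)
  case 0
  then show ?case using assms(2) csize_eq_0 by metis
next
  case (Suc s)
  then have "\<eta> \<noteq> (\<lambda>_. 0)" by auto
  then obtain i where i: "\<eta> i > 0" by (auto simp: fun_eq_iff)
  have "i < n" by (rule comps_pos[OF Suc.prems i])
  define \<zeta> where "\<zeta> = \<eta>(i := \<eta> i - 1)"
  have "\<zeta> \<in> comps n" using Suc.prems \<open>i < n\<close> by (simp add: \<zeta>_def)
  moreover have "s = csize n \<zeta>"
    using Suc.hyps(2) csize_upd[OF \<open>i < n\<close>, of \<eta> "\<eta> i - 1"] i by (simp add: \<zeta>_def)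
  moreover have eq: "\<eta> = \<zeta>(i := Suc (\<zeta> i))" using i by (simp add: \<zeta>_def)
  ultimately show ?case
    by (subst eq) (intro assms(3) Suc.hyps(1) \<open>i < n\<close>)
qed

lemma insE_surj:
  assumes "\<eta> \<in> comps n" "n > 0" "\<eta> (n - 1) > 0"
  obtains \<zeta> where "\<zeta> \<in> comps n" "\<eta> = insE (n - 1) \<zeta>"
proof
  define \<zeta> where "\<zeta> = (\<lambda>j. if j = 0 then \<eta> (n - 1) - 1 else if j < n then \<eta> (j - 1) else 0)"
  show "\<zeta> \<in> comps n" using assms(2) by (auto simp: comps_def \<zeta>_def)
  show "\<eta> = insE (n - 1) \<zeta>"
    using assms by (auto simp: insE_def \<zeta>_def comps_def fun_eq_iff)
qed

text \<open>Mirrors the two generators \<open>Phi\<close> and \<open>sig\<close>: some positive part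
  is swapped to the last position, and a label with positive last part is the rotation of a smaller
  one.\<close>

lemma gen_induct [consumes 2, case_names zero ins swap]:
  assumes "\<eta> \<in> comps n" "n > 0" and "P (\<lambda>_. 0)"
    and "\<And>\<eta>. \<eta> \<in> comps n \<Longrightarrow> P \<eta> \<Longrightarrow> P (insE (n - 1) \<eta>)"
    and "\<And>\<eta> i. \<eta> \<in> comps n \<Longrightarrow> Suc i < n \<Longrightarrow> P \<eta> \<Longrightarrow> P (swapE i \<eta>)"
  shows "P \<eta>"
  using assms(1)
proof (induction "csize n \<eta>" arbitrary: \<eta>)
  case 0
  then show ?case using assms(3) csize_eq_0 by metis
next
  case (Suc s)
  have "P \<eta>" if "k \<le> n - 1" "\<eta> k > 0" "\<eta> \<in> comps n" "csize n \<eta> = Suc s" for k \<eta>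
    using that
  proof (induction arbitrary: \<eta> rule: inc_induct)
    case base
    then obtain \<zeta> where \<zeta>: "\<zeta> \<in> comps n" "\<eta> = insE (n - 1) \<zeta>" using insE_surj assms(2) by metis
    with base assms(2) have "s = csize n \<zeta>" by simp
    with \<zeta> Suc.hyps(1) assms(4) show ?case by simp
  next
    case (step k)
    have "P (swapE k \<eta>)"
    proof (rule step.IH)
      show "swapE k \<eta> (Suc k) > 0" using step by (simp add: swapE_def)
    qed (use step in auto)
    moreover have "swapE k \<eta> \<in> comps n" "Suc k < n" using step by auto
    ultimately have "P (swapE k (swapE k \<eta>))" by (metis assms(5))
    then show ?case by simp
  qed
  moreover from Suc have "\<eta> \<noteq> (\<lambda>_. 0)" by auto
  then obtain i where i: "\<eta> i > 0" by (auto simp: fun_eq_iff)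
  moreover have "i < n" by (rule comps_pos[OF Suc.prems i])
  ultimately show ?case using Suc by (metis Suc_pred' assms(2) less_Suc_eq_le)
qed

definition bar :: "nat \<Rightarrow> (nat \<Rightarrow> nat) \<Rightarrow> point \<Rightarrow> ratfun" where
  "bar n \<eta> = foldr (\<lambda>i. xhat n i ^^ \<eta> i) [0..<n] (\<lambda>_. 1)"

lemma bar_zero [simp]: "bar n (\<lambda>_. 0) = (\<lambda>_. 1)"
proof -
  have "foldr (\<lambda>i. xhat n i ^^ 0) xs (\<lambda>_. 1) = (\<lambda>_. 1)" for xs by (induction xs) auto
  then show ?thesis by (simp add: bar_def)
qed

lemma bar_add:
  assumes "i < n"
  shows "bar n (\<eta>(i := Suc (\<eta> i))) = xhat n i (bar n \<eta>)"
proof -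
  have pow: "(xhat n j ^^ k) (xhat n i f) = xhat n i ((xhat n j ^^ k) f)" if "j < n" for j k f
    using that assms by (induction k) (auto simp: xhat_commute)
  have "foldr (\<lambda>j. xhat n j ^^ (\<eta>(i := Suc (\<eta> i))) j) xs f =
      (if i \<in> set xs then xhat n i (foldr (\<lambda>j. xhat n j ^^ \<eta> j) xs f) else foldr (\<lambda>j. xhat n j ^^ \<eta> j) xs f)"
    if "distinct xs" "set xs \<subseteq> {..<n}" for xs f
    using that by (induction xs) (auto simp: pow)
  from this[of "[0..<n]" "\<lambda>_. 1"] show ?thesis
    using assms by (simp add: bar_def atLeast0LessThan del: fun_upd_apply)
qed

text \<open>\<open>sig i\<close> fixes the constant 1 and permutes the \<open>xhat\<close> by
  conjugation, so it acts on the exponents alone.\<close>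

lemma sig_bar:
  assumes "\<eta> \<in> comps n" "Suc i < n"
  shows "sig i (bar n \<eta>) = bar n (swapE i \<eta>)"
  using assms(1)
proof (induction rule: comp_induct)
  case zero
  then show ?case by (simp add: swapE_def comp_def)
next
  case (add \<eta> j)
  have eq: "swapE i (\<eta>(j := Suc (\<eta> j))) =
    (let k = transpose i (Suc i) j in (swapE i \<eta>)(k := Suc (swapE i \<eta> k)))"
    by (auto simp: swapE_def transpose_def Let_def fun_eq_iff)
  consider "j = i" | "j = Suc i" | "j \<noteq> i" "j \<noteq> Suc i" by blast
  then show ?case
  proof cases
    case 1
    then show ?thesis using add assms unfolding eq Let_def
      by (simp add: bar_add sig_xhat del: fun_upd_apply)
  next
    case 2
    then show ?thesis using add assms unfolding eq Let_def
      by (simp add: bar_add sig_xhat_Suc del: fun_upd_apply)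
  next
    case 3
    then show ?thesis using add assms unfolding eq Let_def
      by (simp add: bar_add sig_xhat_other del: fun_upd_apply)
  qed
qed

text \<open>\<open>Phi\<close> lowers the index of each \<open>xhat\<close> cyclically when moved
  past it, and on the constant 1 it agrees with \<open>xhat n (n - 1)\<close>.\<close>

lemma Phi_bar:
  assumes "\<eta> \<in> comps n" "n > 0"
  shows "Phi n (bar n \<eta>) = bar n (insE (n - 1) \<eta>)"
  using assms(1)
proof (induction rule: comp_induct)
  case zero
  have "insE (n - 1) (\<lambda>_. 0) = (\<lambda>_. 0)(n - 1 := Suc ((\<lambda>_. 0) (n - 1)))"
    by (auto simp: insE_def)
  then have "bar n (insE (n - 1) (\<lambda>_. 0)) = xhat n (n - 1) (bar n (\<lambda>_. 0))"
    using assms(2) bar_add[of "n - 1" n "\<lambda>_. 0"] by simp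
  then show ?case by (simp add: xhat_def)
next
  case (add \<eta> j)
  show ?case
  proof (cases j)
    case 0
    have "insE (n - 1) (\<eta>(0 := Suc (\<eta> 0))) = (insE (n - 1) \<eta>)(n - 1 := Suc (insE (n - 1) \<eta> (n - 1)))"
      by (auto simp: insE_def fun_eq_iff)
    with 0 add assms(2) show ?thesis by (simp add: bar_add Phi_xhat_0 del: fun_upd_apply)
  next
    case (Suc k)
    have "insE (n - 1) (\<eta>(j := Suc (\<eta> j))) = (insE (n - 1) \<eta>)(k := Suc (insE (n - 1) \<eta> k))"
      using Suc add(2) by (auto simp: insE_def fun_eq_iff)
    with Suc add assms(2) show ?thesis by (simp add: bar_add Phi_xhat_Suc del: fun_upd_apply)
  qed
qed

lemma insert_bar:
  assumes "\<eta> \<in> comps n" "i < n"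
  shows "insert_op n i (bar n \<eta>) = bar n (insE i \<eta>)"
proof -
  have "i \<le> n - 1" using assms by simp
  then show ?thesis
  proof (induction rule: inc_induct)
    case base
    then show ?case using assms by (simp add: insert_op_def Phi_bar)
  next
    case (step k)
    then have "insert_op n k (bar n \<eta>) = sig k (bar n (insE (Suc k) \<eta>))"
      by (simp add: insert_op_def chain_Cons)
    then show ?case using step assms by (simp add: sig_bar insE_Suc)
  qed
qed

section \<open>Multiplication of the basis by a coordinate\<close>

definition move :: "(nat \<Rightarrow> nat) \<Rightarrow> nat \<Rightarrow> nat \<Rightarrow> nat \<Rightarrow> nat \<Rightarrow> nat" where
  "move \<eta> i j k = \<eta>(i := k, j := \<eta> i + \<eta> j - k)"

text \<open>The common range of the two sums cancels and leaves an interval of \<open>k\<close> with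
  a single sign. The extra term for \<open>j < i\<close> records the order of the positions; it is
  what keeps the product formula stable under rotations and swaps.\<close>

definition exch :: "nat \<Rightarrow> nat \<Rightarrow> nat \<Rightarrow> (nat \<Rightarrow> nat) \<Rightarrow> point \<Rightarrow> ratfun" where
  "exch n i j \<eta> p = (\<Sum>k\<le>\<eta> i. bar n (move \<eta> i j k) p)
     - (\<Sum>k<(if j < i then Suc (\<eta> j) else \<eta> j). bar n (move \<eta> i j k) p)"

lemma move_comps [simp]: "\<eta> \<in> comps n \<Longrightarrow> i < n \<Longrightarrow> j < n \<Longrightarrow> move \<eta> i j k \<in> comps n"
  by (simp add: move_def)

text \<open>\<open>sig k\<close> takes \<open>x_(k+1) + c\<close> to \<open>x_k + (c + 1)\<close>,
  so the constant counts the factors of the chain.\<close>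

lemma xhat_one:
  assumes "i < n"
  shows "xhat n i (\<lambda>_. 1) p = coord p i + of_nat (n - 1 - i)"
proof -
  have "i \<le> n - 1" using assms by simp
  then have "chain i (n - 1) (\<lambda>p. coord p (n - 1)) = (\<lambda>p. coord p i + of_nat (n - 1 - i))"
  proof (induction rule: inc_induct)
    case base then show ?case by simp
  next
    case (step k)
    have n: "of_nat (n - 1 - k) = (of_nat (n - 1 - Suc k) + 1 :: ratfun)"
      using step by (metis Suc_diff_Suc of_nat_Suc add.commute)
    have d: "coord p k - coord p (Suc k) \<noteq> 0" for p
      using coord_eq_iff[of p k "Suc k"] by simp
    have tel: "(1 + 1 / (coord p k - coord p (Suc k))) * (coord p k + c) - (coord p (Suc k) + c) / (coord p k - coord p (Suc k))
       = coord p k + (c + 1)" for p c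
    proof -
      have "(1 + 1 / d) * (x + c) - (y + c) / d = x + c + (x - y) / d" for x y d
        by (simp add: distrib_right diff_divide_distrib add_divide_distrib)
      then show ?thesis using d by simp
    qed
    from step.hyps have "chain k (n - 1) (\<lambda>p. coord p (n - 1)) =
        sig k (\<lambda>p. coord p (Suc k) + of_nat (n - 1 - Suc k))"
      by (simp only: chain_Cons step.IH)
    also have "\<dots> = (\<lambda>p. coord p k + (of_nat (n - 1 - Suc k) + 1))"
      by (simp only: sig_def coord_swap transpose_apply_second tel)
    finally show ?case by (simp only: n)
  qed
  then show ?thesis by (simp add: xhat_def Phi_def)
qed

lemma Phi_bar_point:
  assumes "\<eta> \<in> comps n" "n > 0"
  shows "coord p (n - 1) * bar n \<eta> (rotate_point n p) = bar n (insE (n - 1) \<eta>) p"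
  using Phi_bar[OF assms] by (auto simp: Phi_def fun_eq_iff)

text \<open>Applying \<open>Phi\<close> or \<open>sig l\<close> to the formula for \<eta> yields the
  formula for the new label. Moving \<open>Phi\<close> past the first coordinate produces the new
  \<open>alpha\<close> term; moving \<open>sig l\<close> past coordinate l or l + 1 produces plus or
  minus \<open>bar n \<eta>\<close>, which is the one exchange term gained or lost when two
  positions change their order.\<close>

lemma coord_times_bar:
  assumes "\<eta> \<in> comps n" "n > 0" "i < n"
  shows "coord p i * bar n \<eta> p = bar n (\<eta>(i := Suc (\<eta> i))) p - alpha * of_nat (\<eta> i) * bar n \<eta> p
     - (\<Sum>j\<in>{..<n} - {i}. exch n i j \<eta> p)"
  using assms
proof (induction arbitrary: i p rule: gen_induct)
  case zero
  have m: "move (\<lambda>_. 0) i j 0 = (\<lambda>_. 0)" for j by (auto simp: move_def)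
  have "(\<Sum>j\<in>{..<n} - {i}. exch n i j (\<lambda>_. 0) p) = (\<Sum>j\<in>{..<n} - {i}. if i < j then 1 else 0)"
    by (intro sum.cong) (auto simp: exch_def m)
  also have "\<dots> = of_nat (card {i<..<n})"
  proof -
    have "({..<n} - {i}) \<inter> {j. i < j} = {i<..<n}" by auto
    then show ?thesis by (simp add: sum.If_cases)
  qed
  finally show ?case
    using zero bar_add[of i n "\<lambda>_. 0"] xhat_one[of i n p] by (simp del: fun_upd_apply)
next
  case (ins \<eta>)
  define q where "q = rotate_point n p"
  define c where "c = coord p (n - 1)"
  define \<eta>' where "\<eta>' = insE (n - 1) \<eta>"
  have cb: "c * bar n \<zeta> q = bar n (insE (n - 1) \<zeta>) p" if "\<zeta> \<in> comps n" for \<zeta>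
    using Phi_bar_point[OF that \<open>n > 0\<close>] by (simp add: c_def q_def)
  show ?case
  proof (cases "i = n - 1")
    case False
    with ins have i: "Suc i < n" by simp
    have "coord q (Suc i) = coord p i" using i by (simp add: q_def coord_rotate)
    then have "coord p i * bar n \<eta>' p = c * (coord q (Suc i) * bar n \<eta> q)"
      using cb[OF ins.hyps] by (simp add: \<eta>'_def algebra_simps)
    also have "\<dots> = c * bar n (\<eta>(Suc i := Suc (\<eta> (Suc i)))) q - alpha * of_nat (\<eta> (Suc i)) * (c * bar n \<eta> q)
       - (\<Sum>j\<in>{..<n} - {Suc i}. c * exch n (Suc i) j \<eta> q)"
      unfolding ins.IH[OF i] by (simp add: algebra_simps sum_distrib_left del: fun_upd_apply)
    also have "c * bar n (\<eta>(Suc i := Suc (\<eta> (Suc i)))) q = bar n (\<eta>'(i := Suc (\<eta>' i))) p"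
      using ins i by (subst cb) (auto simp: \<eta>'_def insE_def fun_eq_iff intro!: arg_cong[where f = "\<lambda>\<eta>. bar n \<eta> p"])
    also have "c * bar n \<eta> q = bar n \<eta>' p" using ins by (simp add: cb \<eta>'_def)
    also have "\<eta> (Suc i) = \<eta>' i" using i by (auto simp: \<eta>'_def insE_def)
    also have "(\<Sum>j\<in>{..<n} - {Suc i}. c * exch n (Suc i) j \<eta> q) = (\<Sum>j\<in>{..<n} - {i}. exch n i j \<eta>' p)"
    proof (rule sum.reindex_bij_witness[where i = "\<lambda>j. if j = n - 1 then 0 else Suc j"
          and j = "\<lambda>j. if j = 0 then n - 1 else j - 1"])
      fix j assume j: "j \<in> {..<n} - {Suc i}"
      show "exch n i (if j = 0 then n - 1 else j - 1) \<eta>' p = c * exch n (Suc i) j \<eta> q"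
      proof (cases j)
        case 0
        have A: "c * bar n (move \<eta> (Suc i) 0 k) q = bar n (move \<eta>' i (n - 1) k) p"
          if "k \<le> \<eta> (Suc i) \<or> k \<le> \<eta> 0" for k
        proof -
          have "insE (n - 1) (move \<eta> (Suc i) 0 k) = move \<eta>' i (n - 1) k"
            using that i by (auto simp: move_def insE_def \<eta>'_def fun_eq_iff)
          moreover have "move \<eta> (Suc i) 0 k \<in> comps n" using ins i by simp
          ultimately show ?thesis by (simp add: cb)
        qed
        \<comment> \<open>Position 0 lay before \<open>Suc i\<close> and had the extra term;
          position \<open>n - 1\<close> lies behind \<open>i\<close>, but its part is one larger, so
          the range is the same.\<close>
        have v: "\<eta>' (n - 1) = Suc (\<eta> 0)" by (simp add: \<eta>'_def insE_def)
        have "c * exch n (Suc i) 0 \<eta> q = (\<Sum>k\<le>\<eta> (Suc i). c * bar n (move \<eta> (Suc i) 0 k) q)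
          - (\<Sum>k<Suc (\<eta> 0). c * bar n (move \<eta> (Suc i) 0 k) q)"
          by (simp add: exch_def right_diff_distrib sum_distrib_left del: sum.lessThan_Suc)
        also have "\<dots> = (\<Sum>k\<le>\<eta> (Suc i). bar n (move \<eta>' i (n - 1) k) p)
          - (\<Sum>k<Suc (\<eta> 0). bar n (move \<eta>' i (n - 1) k) p)"
          by (intro arg_cong2[where f = "(-)"] sum.cong) (auto simp: A)
        finally show ?thesis using 0 i by (simp add: exch_def v[unfolded One_nat_def] \<open>\<eta> (Suc i) = \<eta>' i\<close> del: sum.lessThan_Suc)
      next
        case (Suc l)
        have "insE (n - 1) (move \<eta> (Suc i) (Suc l) k) = move \<eta>' i l k" for k
          using i j Suc by (auto simp: move_def insE_def \<eta>'_def fun_eq_iff)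
        moreover have "\<eta>' l = \<eta> (Suc l)" using j Suc by (auto simp: \<eta>'_def insE_def)
        ultimately show ?thesis using Suc i ins j
          by (simp add: exch_def right_diff_distrib sum_distrib_left cb \<open>\<eta> (Suc i) = \<eta>' i\<close>)
      qed
    qed (use i in \<open>auto split: if_splits\<close>)
    finally show ?thesis by (simp add: \<eta>'_def)
  next
    case True
    \<comment> \<open>The shift by \<open>alpha\<close> raises the coefficient of
      \<open>- alpha\<close> from \<open>\<eta> 0\<close> to the new part
      \<open>Suc (\<eta> 0)\<close>.\<close>
    have q0: "coord q 0 = coord p i + alpha" using ins True by (simp add: q_def coord_rotate)
    have "coord p i * bar n \<eta>' p = c * ((coord q 0 - alpha) * bar n \<eta> q)"
      using cb[OF ins.hyps] q0 by (simp add: \<eta>'_def algebra_simps)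
    also have "\<dots> = c * bar n (\<eta>(0 := Suc (\<eta> 0))) q - alpha * (1 + of_nat (\<eta> 0)) * (c * bar n \<eta> q)
       - (\<Sum>j\<in>{..<n} - {0}. c * exch n 0 j \<eta> q)"
      unfolding left_diff_distrib ins.IH[OF \<open>n > 0\<close>]
      by (simp add: algebra_simps sum_distrib_left del: fun_upd_apply)
    also have "c * bar n (\<eta>(0 := Suc (\<eta> 0))) q = bar n (\<eta>'(i := Suc (\<eta>' i))) p"
      using ins True by (subst cb) (auto simp: \<eta>'_def insE_def fun_eq_iff intro!: arg_cong[where f = "\<lambda>\<eta>. bar n \<eta> p"])
    also have "c * bar n \<eta> q = bar n \<eta>' p" using ins by (simp add: cb \<eta>'_def)
    also have "1 + of_nat (\<eta> 0) = (of_nat (\<eta>' i) :: ratfun)" using True by (auto simp: \<eta>'_def insE_def)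
    also have "(\<Sum>j\<in>{..<n} - {0}. c * exch n 0 j \<eta> q) = (\<Sum>j\<in>{..<n} - {i}. exch n i j \<eta>' p)"
    proof (rule sum.reindex_bij_witness[where i = Suc and j = "\<lambda>j. j - 1"])
      fix j assume j: "j \<in> {..<n} - {0}"
      then obtain l where l: "j = Suc l" by (cases j) auto
      \<comment> \<open>The index is shifted by one: for the new label both sums of
        \<open>exch\<close> begin with the same term \<open>k = 0\<close>, and these cancel.\<close>
      have mv: "insE (n - 1) (move \<eta> 0 (Suc l) k) = move \<eta>' i l (Suc k)" for k
        using True l j by (auto simp: move_def insE_def \<eta>'_def fun_eq_iff)
      have v: "\<eta>' i = Suc (\<eta> 0)" "\<eta>' l = \<eta> (Suc l)" "l < i"
        using True j l by (auto simp: \<eta>'_def insE_def)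
      show "exch n i (j - 1) \<eta>' p = c * exch n 0 j \<eta> q"
        using v l j ins
        by (simp add: exch_def right_diff_distrib sum_distrib_left cb mv[unfolded One_nat_def] sum.atMost_Suc_shift sum.lessThan_Suc_shift
             del: sum.atMost_Suc sum.lessThan_Suc)
    qed (use True \<open>n > 0\<close> in \<open>auto\<close>)
    finally show ?thesis by (simp add: \<eta>'_def)
  qed
next
  case (swap \<eta> l)
  define \<eta>' where "\<eta>' = swapE l \<eta>"
  define s where "s = transpose l (Suc l)"
  define u where "u = 1 / (coord p l - coord p (Suc l))"
  define q where "q = swap_point l p"
  have u: "u * (coord p l - coord p (Suc l)) = 1"
    using coord_eq_iff[of p l "Suc l"] by (simp add: u_def)
  have ss [simp]: "s (s j) = j" for j by (simp add: s_def)
  have sn [simp]: "s j < n \<longleftrightarrow> j < n" for j using swap(2) by (auto simp: s_def transpose_def)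
  have sb: "(1 + u) * bar n \<zeta> q - u * bar n \<zeta> p = bar n (swapE l \<zeta>) p" if "\<zeta> \<in> comps n" for \<zeta>
    using sig_bar[OF that swap(2)] by (auto simp: sig_def fun_eq_iff u_def q_def)
  have val: "\<eta>' j = \<eta> (s j)" for j by (simp add: \<eta>'_def swapE_def s_def)
  have mv: "swapE l (move \<eta> i j k) = move \<eta>' (s i) (s j) k" if "i \<noteq> j" for i j k
    using that by (auto simp: move_def \<eta>'_def swapE_def s_def transpose_def fun_eq_iff)
  have ex: "(1 + u) * exch n i j \<eta> q - u * exch n i j \<eta> p =
      (\<Sum>k\<le>\<eta>' (s i). bar n (move \<eta>' (s i) (s j) k) p)
       - (\<Sum>k<(if j < i then Suc (\<eta>' (s j)) else \<eta>' (s j)). bar n (move \<eta>' (s i) (s j) k) p)"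
    if "i < n" "j < n" "i \<noteq> j" for i j
  proof -
    have "(1 + u) * exch n i j \<eta> q - u * exch n i j \<eta> p =
      (\<Sum>k\<le>\<eta> i. (1 + u) * bar n (move \<eta> i j k) q - u * bar n (move \<eta> i j k) p)
       - (\<Sum>k<(if j < i then Suc (\<eta> j) else \<eta> j). (1 + u) * bar n (move \<eta> i j k) q - u * bar n (move \<eta> i j k) p)"
      by (simp only: exch_def sum_subtractf sum_distrib_left[symmetric]) (simp only: algebra_simps)
    then show ?thesis using that swap by (simp add: sb mv val)
  qed
  \<comment> \<open>\<open>X\<close> and \<open>E\<close> are \<open>sig l\<close> applied to the
    product and to the exchange terms of the induction hypothesis.\<close>
  define X where "X i = (1 + u) * (coord q i * bar n \<eta> q) - u * (coord p i * bar n \<eta> p)" for i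
  define E where "E i j = (1 + u) * exch n i j \<eta> q - u * exch n i j \<eta> p" for i j
  have X: "X i = bar n (\<eta>'(s i := Suc (\<eta>' (s i)))) p - alpha * of_nat (\<eta>' (s i)) * bar n \<eta>' p
      - (\<Sum>j\<in>{..<n} - {i}. E i j)" if "i < n" for i
  proof -
    have "X i = ((1 + u) * bar n (\<eta>(i := Suc (\<eta> i))) q - u * bar n (\<eta>(i := Suc (\<eta> i))) p)
        - alpha * of_nat (\<eta> i) * ((1 + u) * bar n \<eta> q - u * bar n \<eta> p)
        - (\<Sum>j\<in>{..<n} - {i}. E i j)"
      unfolding X_def E_def swap.IH[OF that] sum_subtractf sum_distrib_left[symmetric]
      by (simp only: algebra_simps)
    also have "(1 + u) * bar n \<eta> q - u * bar n \<eta> p = bar n \<eta>' p"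
      using swap by (simp add: sb \<eta>'_def)
    also have "(1 + u) * bar n (\<eta>(i := Suc (\<eta> i))) q - u * bar n (\<eta>(i := Suc (\<eta> i))) p = bar n (\<eta>'(s i := Suc (\<eta>' (s i)))) p"
      using swap that by (subst sb) (auto simp: \<eta>'_def swapE_def s_def transpose_def fun_eq_iff intro!: arg_cong[where f = "\<lambda>\<eta>. bar n \<eta> p"])
    finally show ?thesis by (simp only: val[of "s i"] ss)
  qed
  have reidx: "(\<Sum>j\<in>{..<n} - {s i}. E (s i) j) = (\<Sum>j\<in>{..<n} - {i}. E (s i) (s j))"
    by (rule sum.reindex_bij_witness[where i = s and j = s]) (auto dest: arg_cong[where f = s])
  have bs: "bar n \<eta>' p = (1 + u) * bar n \<eta> q - u * bar n \<eta> p"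
    using swap by (simp add: sb \<eta>'_def)
  have Eok: "E (s i) (s j) = exch n i j \<eta>' p"
    if "i < n" "j < n" "i \<noteq> j" "\<not> (i = l \<and> j = Suc l)" "\<not> (i = Suc l \<and> j = l)" for i j
  proof -
    have "s j < s i \<longleftrightarrow> j < i" "s i \<noteq> s j" using that by (auto simp: s_def transpose_def split: if_splits)
    with that show ?thesis unfolding E_def by (subst ex) (simp_all add: exch_def)
  qed
  consider "i = Suc l" | "i = l" | "i \<noteq> l" "i \<noteq> Suc l" by blast
  then have "coord p i * bar n \<eta>' p = bar n (\<eta>'(i := Suc (\<eta>' i))) p
      - alpha * of_nat (\<eta>' i) * bar n \<eta>' p - (\<Sum>j\<in>{..<n} - {i}. exch n i j \<eta>' p)"
  proof cases
    case 1
    have s: "s i = l" "s l = Suc l" using 1 by (simp_all add: s_def)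
    have "X l = (1 + u) * (coord p (Suc l) * bar n \<eta> q) - u * (coord p l * bar n \<eta> p)"
      by (simp add: X_def q_def coord_swap)
    also have "\<dots> = coord p i * bar n \<eta>' p - bar n \<eta> p * (u * (coord p l - coord p (Suc l)))"
      unfolding bs 1 by (simp only: algebra_simps)
    finally have eq: "coord p i * bar n \<eta>' p = X (s i) + bar n \<eta> p" by (simp add: u s)
    \<comment> \<open>Only for this pair does the swap reverse the order of the positions. The
      second sum of \<open>E\<close> then lacks the term \<open>k = \<eta>' l\<close>, whose label
      is \<eta> again, and this offsets the commutator in \<open>eq\<close>.\<close>
    have El: "E (s i) (s l) = exch n i l \<eta>' p + bar n \<eta> p"
    proof -
      have "move \<eta>' (Suc l) l (\<eta>' l) = \<eta>"
        by (auto simp: move_def \<eta>'_def swapE_def fun_eq_iff transpose_def)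
      moreover have "E l (Suc l) = (\<Sum>k\<le>\<eta>' (Suc l). bar n (move \<eta>' (Suc l) l k) p)
          - (\<Sum>k<\<eta>' l. bar n (move \<eta>' (Suc l) l k) p)"
        using 1 swap(2) s unfolding E_def by (subst ex) simp_all
      ultimately show ?thesis using 1 s by (simp add: exch_def)
    qed
    have "(\<Sum>j\<in>{..<n} - {i}. E (s i) (s j)) = (\<Sum>j\<in>{..<n} - {i}. exch n i j \<eta>' p) + bar n \<eta> p"
    proof -
      have "(\<Sum>j\<in>{..<n} - {i} - {l}. E (s i) (s j)) = (\<Sum>j\<in>{..<n} - {i} - {l}. exch n i j \<eta>' p)"
        using 1 swap(2) by (intro sum.cong) (auto intro!: Eok)
      moreover have "l \<in> {..<n} - {i}" using 1 swap(2) by auto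
      ultimately show ?thesis using El
        by (simp only: sum.remove[of "{..<n} - {i}" l] finite_Diff finite_lessThan ac_simps)
    qed
    then show ?thesis unfolding eq using X[of "s i"] swap.prems reidx by simp
  next
    case 2
    have s: "s i = Suc l" "s (Suc l) = l" using 2 by (simp_all add: s_def)
    have "X (Suc l) = (1 + u) * (coord p l * bar n \<eta> q) - u * (coord p (Suc l) * bar n \<eta> p)"
      by (simp add: X_def q_def coord_swap)
    also have "\<dots> = coord p i * bar n \<eta>' p + bar n \<eta> p * (u * (coord p l - coord p (Suc l)))"
      unfolding bs 2 by (simp only: algebra_simps)
    finally have eq: "coord p i * bar n \<eta>' p = X (s i) - bar n \<eta> p" by (simp add: u s)
    \<comment> \<open>The mirror image of the previous case: here \<open>E\<close> has one term too
      many.\<close>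
    have El: "E (s i) (s (Suc l)) = exch n i (Suc l) \<eta>' p - bar n \<eta> p"
    proof -
      have "move \<eta>' l (Suc l) (\<eta>' (Suc l)) = \<eta>"
        by (auto simp: move_def \<eta>'_def swapE_def fun_eq_iff transpose_def)
      moreover have "E (Suc l) l = (\<Sum>k\<le>\<eta>' l. bar n (move \<eta>' l (Suc l) k) p)
          - (\<Sum>k<Suc (\<eta>' (Suc l)). bar n (move \<eta>' l (Suc l) k) p)"
        using 2 swap(2) s unfolding E_def by (subst ex) simp_all
      ultimately show ?thesis using 2 s by (simp add: exch_def)
    qed
    have "(\<Sum>j\<in>{..<n} - {i}. E (s i) (s j)) = (\<Sum>j\<in>{..<n} - {i}. exch n i j \<eta>' p) - bar n \<eta> p"
    proof -
      have "(\<Sum>j\<in>{..<n} - {i} - {Suc l}. E (s i) (s j)) = (\<Sum>j\<in>{..<n} - {i} - {Suc l}. exch n i j \<eta>' p)"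
        using 2 swap(2) by (intro sum.cong) (auto intro!: Eok)
      moreover have "Suc l \<in> {..<n} - {i}" using 2 swap(2) by auto
      ultimately show ?thesis using El
        by (simp only: sum.remove[of "{..<n} - {i}" "Suc l"] finite_Diff finite_lessThan)
    qed
    then show ?thesis unfolding eq using X[of "s i"] swap.prems reidx by simp
  next
    case 3
    have s: "s i = i" using 3 by (simp add: s_def)
    have eq: "coord p i * bar n \<eta>' p = X (s i)"
      using 3 by (simp add: X_def q_def coord_swap bs s algebra_simps)
    have "(\<Sum>j\<in>{..<n} - {i}. E (s i) (s j)) = (\<Sum>j\<in>{..<n} - {i}. exch n i j \<eta>' p)"
      using 3 swap by (intro sum.cong) (auto intro!: Eok)
    then show ?thesis unfolding eq using X[of "s i"] swap.prems reidx by simp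
  qed
  then show ?case by (simp only: \<eta>'_def)
qed

section \<open>Positivity of the basis\<close>

lemma map_poly_of_nat_add: "map_poly of_nat (p + q) = (map_poly of_nat p + map_poly of_nat q :: 'a::comm_semiring_1 poly)"
  by (rule poly_eqI) (simp add: coeff_map_poly)

lemma map_poly_of_nat_mult: "map_poly of_nat (p * q) = (map_poly of_nat p * map_poly of_nat q :: 'a::comm_semiring_1 poly)"
  by (rule poly_eqI) (simp add: coeff_map_poly coeff_mult)

lemma nat_polys_add: "a \<in> nat_polys_in_alpha \<Longrightarrow> b \<in> nat_polys_in_alpha \<Longrightarrow> a + b \<in> nat_polys_in_alpha"
  unfolding nat_polys_in_alpha_def
  by (force simp flip: poly_add map_poly_of_nat_add)

lemma nat_polys_mult: "a \<in> nat_polys_in_alpha \<Longrightarrow> b \<in> nat_polys_in_alpha \<Longrightarrow> a * b \<in> nat_polys_in_alpha"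
  unfolding nat_polys_in_alpha_def
  by (force simp flip: poly_mult map_poly_of_nat_mult)

lemma nat_polys_of_nat: "of_nat k \<in> nat_polys_in_alpha"
proof -
  have "of_nat k = poly (map_poly of_nat [:k:]) alpha" by (simp add: map_poly_pCons)
  then show ?thesis unfolding nat_polys_in_alpha_def by blast
qed

lemma nat_polys_alpha: "alpha \<in> nat_polys_in_alpha"
proof -
  have "alpha = poly (map_poly of_nat [:0, 1:]) alpha" by (simp add: map_poly_pCons)
  then show ?thesis unfolding nat_polys_in_alpha_def by blast
qed

lemma nat_polys_0: "0 \<in> nat_polys_in_alpha" and nat_polys_1: "1 \<in> nat_polys_in_alpha"
  using nat_polys_of_nat[of 0] nat_polys_of_nat[of 1] by simp_all

lemma nat_polys_sum: "(\<And>i. i \<in> A \<Longrightarrow> f i \<in> nat_polys_in_alpha) \<Longrightarrow> sum f A \<in> nat_polys_in_alpha"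
  by (induction A rule: infinite_finite_induct) (auto intro: nat_polys_0 nat_polys_add)

lemmas nat_polys_intros = nat_polys_add nat_polys_mult nat_polys_of_nat nat_polys_alpha
  nat_polys_0 nat_polys_1 nat_polys_sum

section \<open>Evaluation of polynomials and the representation of \<open>bar\<close> by
  them\<close>

lemma mpol_induct [case_names single add]:
  fixes p :: "'a::comm_ring_1 mpol"
  assumes "\<And>\<eta> c. P (Poly_Mapping.single \<eta> c)"
    and "\<And>p q. P p \<Longrightarrow> P q \<Longrightarrow> Poly_Mapping.keys p \<subseteq> Poly_Mapping.keys (p + q) \<Longrightarrow>
      Poly_Mapping.keys q \<subseteq> Poly_Mapping.keys (p + q) \<Longrightarrow> P (p + q)"
  shows "P p"
proof (induction "card (Poly_Mapping.keys p)" arbitrary: p)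
  case 0
  then show ?case using assms(1)[of 0 0] by simp
next
  case (Suc k)
  then obtain \<eta> where \<eta>: "\<eta> \<in> Poly_Mapping.keys p" by fastforce
  define q where "q = p - Poly_Mapping.single \<eta> (Poly_Mapping.lookup p \<eta>)"
  have lq: "Poly_Mapping.lookup q \<theta> = (if \<theta> = \<eta> then 0 else Poly_Mapping.lookup p \<theta>)" for \<theta>
    by (simp add: q_def lookup_minus lookup_single when_def)
  have kq: "Poly_Mapping.keys q = Poly_Mapping.keys p - {\<eta>}"
    by (auto simp: in_keys_iff lq split: if_splits)
  have p: "p = Poly_Mapping.single \<eta> (Poly_Mapping.lookup p \<eta>) + q" by (simp add: q_def)
  have "k = card (Poly_Mapping.keys q)" using Suc.hyps(2) \<eta> by (simp add: kq)
  then have "P q" by (rule Suc.hyps(1))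
  then show ?case
    by (subst p, intro assms) (use \<eta> in \<open>auto simp: kq simp flip: p\<close>)
qed

lemma weight_superset:
  assumes "finite A" "Poly_Mapping.keys \<eta> \<subseteq> A"
  shows "weight \<eta> = (\<Sum>i\<in>A. Poly_Mapping.lookup \<eta> i)"
  unfolding weight_def using assms by (intro sum.mono_neutral_left) (auto simp: in_keys_iff)

lemma weight_csize: "Poly_Mapping.keys \<eta> \<subseteq> {..<n} \<Longrightarrow> weight \<eta> = csize n (Poly_Mapping.lookup \<eta>)"
  by (simp add: weight_superset[of "{..<n}"] csize_def)

lemma weight_add: "weight (\<eta> + \<theta>) = weight \<eta> + weight \<theta>"
  using keys_add[of \<eta> \<theta>]
  by (simp add: weight_superset[of "Poly_Mapping.keys \<eta> \<union> Poly_Mapping.keys \<theta>"] lookup_add sum.distrib)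

lemma weight_single [simp]: "weight (Poly_Mapping.single i k) = k"
  by (simp add: weight_def)

definition mon :: "(nat \<Rightarrow> 'a::comm_semiring_1) \<Rightarrow> expo \<Rightarrow> 'a" where
  "mon x \<eta> = (\<Prod>i\<in>Poly_Mapping.keys \<eta>. x i ^ Poly_Mapping.lookup \<eta> i)"

lemma mon_superset:
  assumes "finite A" "Poly_Mapping.keys \<eta> \<subseteq> A"
  shows "mon x \<eta> = (\<Prod>i\<in>A. x i ^ Poly_Mapping.lookup \<eta> i)"
  unfolding mon_def using assms by (intro prod.mono_neutral_left) (auto simp: in_keys_iff)

lemma mon_add: "mon x (\<eta> + \<theta>) = mon x \<eta> * mon x \<theta>"
  using keys_add[of \<eta> \<theta>]
  by (simp add: mon_superset[of "Poly_Mapping.keys \<eta> \<union> Poly_Mapping.keys \<theta>"] lookup_add power_add prod.distrib)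

lemma mon_single [simp]: "mon x (Poly_Mapping.single i (Suc 0)) = x i"
  by (simp add: mon_def)

definition ev :: "(nat \<Rightarrow> 'a::comm_ring_1) \<Rightarrow> 'a mpol \<Rightarrow> 'a" where
  "ev x p = subst_mpol id x p"

lemma ev_eq: "ev x p = (\<Sum>\<eta>\<in>Poly_Mapping.keys p. Poly_Mapping.lookup p \<eta> * mon x \<eta>)"
  by (simp add: ev_def subst_mpol_def mon_def)

lemma ev_superset:
  assumes "finite A" "Poly_Mapping.keys p \<subseteq> A"
  shows "ev x p = (\<Sum>\<eta>\<in>A. Poly_Mapping.lookup p \<eta> * mon x \<eta>)"
  unfolding ev_eq using assms by (intro sum.mono_neutral_left) (auto simp: in_keys_iff)

lemma ev_0 [simp]: "ev x 0 = 0"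
  by (simp add: ev_eq)

lemma ev_add: "ev x (p + q) = ev x p + ev x q"
  using keys_add[of p q]
  by (simp add: ev_superset[of "Poly_Mapping.keys p \<union> Poly_Mapping.keys q"] lookup_add sum.distrib algebra_simps)

lemma ev_single: "ev x (Poly_Mapping.single \<eta> c) = c * mon x \<eta>"
  by (simp add: ev_eq)

lemma ev_const_mult: "ev x (const_mpol c * p) = c * ev x p"
proof -
  have "Poly_Mapping.keys (const_mpol c * p) \<subseteq> Poly_Mapping.keys p"
    by (auto simp: in_keys_iff lookup_const_mpol_mult)
  then show ?thesis
    by (simp add: ev_superset[of "Poly_Mapping.keys p"] lookup_const_mpol_mult sum_distrib_left mult.assoc)
qed

lemma ev_var_mult: "ev x (var i * p) = x i * ev x p"
proof (induction p rule: mpol_induct)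
  case (single \<eta> c)
  then show ?case
    by (simp add: var_def mult_single ev_single mon_add mult.left_commute)
qed (simp add: distrib_left ev_add)

lemma lookup_var_mult:
  fixes p :: "'a::comm_ring_1 mpol"
  shows "Poly_Mapping.lookup (var i * p) (Poly_Mapping.single i 1 + \<eta>) = Poly_Mapping.lookup p \<eta>"
  by (induction p rule: mpol_induct)
    (auto simp: var_def mult_single lookup_single when_def distrib_left lookup_add)

lemma keys_var_mult:
  fixes p :: "'a::comm_ring_1 mpol"
  assumes "\<gamma> \<in> Poly_Mapping.keys (var i * p)"
  obtains \<eta> where "\<eta> \<in> Poly_Mapping.keys p" "\<gamma> = Poly_Mapping.single i 1 + \<eta>"
proof -
  have "Poly_Mapping.keys (var i * p) \<subseteq> (+) (Poly_Mapping.single i 1) ` Poly_Mapping.keys p"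
  proof (induction p rule: mpol_induct)
    case (single \<eta> c)
    then show ?case by (auto simp: var_def mult_single split: if_splits)
  next
    case (add p q)
    have "Poly_Mapping.keys (var i * (p + q)) \<subseteq> Poly_Mapping.keys (var i * p) \<union> Poly_Mapping.keys (var i * q)"
      unfolding distrib_left by (rule keys_add)
    also have "\<dots> \<subseteq> (+) (Poly_Mapping.single i 1) ` Poly_Mapping.keys (p + q)"
      by (intro Un_least order_trans[OF add.IH(1) image_mono[OF add.hyps(1)]]
          order_trans[OF add.IH(2) image_mono[OF add.hyps(2)]])
    finally show ?case .
  qed
  with assms that show thesis by blast
qed

text \<open>A property of functions, since \<open>coord_times_bar\<close> is an identity between
  functions; it is closed under sums and under factors from \<nat>[\<alpha>].\<close>

definition low_fun :: "nat \<Rightarrow> nat \<Rightarrow> (point \<Rightarrow> ratfun) \<Rightarrow> bool" where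
  "low_fun n d f \<longleftrightarrow> (\<exists>B. (\<forall>\<gamma>. Poly_Mapping.lookup B \<gamma> \<in> nat_polys_in_alpha) \<and>
     (\<forall>\<gamma>\<in>Poly_Mapping.keys B. Poly_Mapping.keys \<gamma> \<subseteq> {..<n} \<and> weight \<gamma> < d) \<and>
     (\<forall>p. ev (coord p) B = f p))"

lemma low_fun_add:
  assumes "low_fun n d f" "low_fun n d g"
  shows "low_fun n d (\<lambda>p. f p + g p)"
proof -
  from assms obtain B C where
    "\<forall>\<gamma>. Poly_Mapping.lookup B \<gamma> \<in> nat_polys_in_alpha"
    "\<forall>\<gamma>\<in>Poly_Mapping.keys B. Poly_Mapping.keys \<gamma> \<subseteq> {..<n} \<and> weight \<gamma> < d" "\<forall>p. ev (coord p) B = f p"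
    "\<forall>\<gamma>. Poly_Mapping.lookup C \<gamma> \<in> nat_polys_in_alpha"
    "\<forall>\<gamma>\<in>Poly_Mapping.keys C. Poly_Mapping.keys \<gamma> \<subseteq> {..<n} \<and> weight \<gamma> < d" "\<forall>p. ev (coord p) C = g p"
    unfolding low_fun_def by blast
  moreover from this
  have "\<forall>\<gamma>\<in>Poly_Mapping.keys (B + C). Poly_Mapping.keys \<gamma> \<subseteq> {..<n} \<and> weight \<gamma> < d"
    using keys_add[of B C] by blast
  ultimately show ?thesis unfolding low_fun_def
    by (intro exI[of _ "B + C"]) (simp add: lookup_add ev_add nat_polys_add)
qed

lemma low_fun_mult:
  assumes "low_fun n d f" "c \<in> nat_polys_in_alpha"
  shows "low_fun n d (\<lambda>p. c * f p)"
proof -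
  from assms obtain B where
    "\<forall>\<gamma>. Poly_Mapping.lookup B \<gamma> \<in> nat_polys_in_alpha"
    "\<forall>\<gamma>\<in>Poly_Mapping.keys B. Poly_Mapping.keys \<gamma> \<subseteq> {..<n} \<and> weight \<gamma> < d" "\<forall>p. ev (coord p) B = f p"
    unfolding low_fun_def by blast
  then show ?thesis unfolding low_fun_def
    by (intro exI[of _ "const_mpol c * B"])
      (auto simp: lookup_const_mpol_mult ev_const_mult in_keys_iff intro: nat_polys_mult assms)
qed

lemma low_fun_sum:
  assumes "\<And>i. i \<in> A \<Longrightarrow> low_fun n d (f i)"
  shows "low_fun n d (\<lambda>p. \<Sum>i\<in>A. f i p)"
proof -
  have 0: "low_fun n d (\<lambda>p. 0)"
    unfolding low_fun_def by (intro exI[of _ 0]) (simp add: nat_polys_0)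
  show ?thesis using assms
    by (induction A rule: infinite_finite_induct) (auto simp: 0 intro: low_fun_add)
qed

text \<open>With only one monomial of top degree, the top coefficients of a combination of the
  \<open>bar\<close> can be read off its labels, as \<open>combo_poly\<close> does.\<close>

definition bar_poly :: "nat \<Rightarrow> (nat \<Rightarrow> nat) \<Rightarrow> ratfun mpol \<Rightarrow> bool" where
  "bar_poly n \<zeta> B \<longleftrightarrow> (\<forall>\<gamma>. Poly_Mapping.lookup B \<gamma> \<in> nat_polys_in_alpha) \<and>
     (\<forall>\<gamma>\<in>Poly_Mapping.keys B. Poly_Mapping.keys \<gamma> \<subseteq> {..<n} \<and>
        (weight \<gamma> < csize n \<zeta> \<or> Poly_Mapping.lookup \<gamma> = \<zeta>)) \<and>
     (\<forall>\<gamma>. Poly_Mapping.lookup \<gamma> = \<zeta> \<longrightarrow> Poly_Mapping.lookup B \<gamma> = 1) \<and>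
     (\<forall>p. ev (coord p) B = bar n \<zeta> p)"

lemma bar_poly_low:
  assumes "bar_poly n \<zeta> B" "csize n \<zeta> < d"
  shows "low_fun n d (bar n \<zeta>)"
  unfolding low_fun_def
proof (intro exI[of _ B] conjI ballI)
  fix \<gamma> assume "\<gamma> \<in> Poly_Mapping.keys B"
  with assms show "Poly_Mapping.keys \<gamma> \<subseteq> {..<n}" "weight \<gamma> < d"
    by (auto simp: bar_poly_def weight_csize)
qed (use assms in \<open>auto simp: bar_poly_def\<close>)

lemma csize_move:
  assumes "i < n" "j < n" "i \<noteq> j" "k \<le> \<eta> i + \<eta> j"
  shows "csize n (move \<eta> i j k) = csize n \<eta>"
  using csize_upd[OF assms(1), of \<eta> k] csize_upd[OF assms(2), of "\<eta>(i := k)" "\<eta> i + \<eta> j - k"] assms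
  by (simp add: move_def)

text \<open>
  Raising the first of the maximal parts makes every exchange term of \<open>coord_times_bar\<close> a sum
  with nonnegative coefficients; this is the source of positivity.
\<close>
lemma bar_poly_exists:
  assumes "\<zeta> \<in> comps n" "n > 0"
  shows "\<exists>B. bar_poly n \<zeta> B"
  using assms(1)
proof (induction "csize n \<zeta>" arbitrary: \<zeta> rule: less_induct)
  case less
  show ?case
  proof (cases "csize n \<zeta> = 0")
    case True
    then have "\<zeta> = (\<lambda>_. 0)" using less csize_eq_0 by blast
    moreover have "Poly_Mapping.lookup \<gamma> = (\<lambda>_. 0) \<longleftrightarrow> \<gamma> = 0" for \<gamma> :: expo
      by (simp add: poly_mapping_eq_iff fun_eq_iff)
    ultimately show ?thesis
      by (intro exI[of _ "Poly_Mapping.single 0 1"])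
        (auto simp: bar_poly_def lookup_single when_def ev_single mon_def simp del: single_one
          intro: nat_polys_0 nat_polys_1)
  next
    case False
    define M where "M = Max (\<zeta> ` {..<n})"
    have M: "\<zeta> j \<le> M" if "j < n" for j using that by (simp add: M_def)
    have "M \<in> \<zeta> ` {..<n}" unfolding M_def using assms(2) by (intro Max_in) auto
    then have ex: "\<exists>i<n. \<zeta> i = M" by auto
    define i where "i = (LEAST i. i < n \<and> \<zeta> i = M)"
    have i: "i < n" "\<zeta> i = M" using LeastI_ex[OF ex] by (auto simp: i_def)
    have before: "\<zeta> j < M" if "j < i" for j
      using not_less_Least[of j "\<lambda>i. i < n \<and> \<zeta> i = M"] that i M[of j] by (auto simp: i_def[symmetric])
    have "M \<noteq> 0"
    proof
      assume "M = 0"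
      then have "csize n \<zeta> = 0" using M by (simp add: csize_def)
      with False show False by simp
    qed
    define \<eta> where "\<eta> = \<zeta>(i := M - 1)"
    have \<zeta>: "\<zeta> = \<eta>(i := Suc (\<eta> i))" using i \<open>M \<noteq> 0\<close> by (auto simp: \<eta>_def)
    have \<eta>: "\<eta> \<in> comps n" "csize n \<zeta> = Suc (csize n \<eta>)"
      using less.prems i csize_upd[OF i(1), of \<eta> "Suc (\<eta> i)", unfolded \<zeta>[symmetric]]
      by (simp_all add: \<eta>_def)
    have low: "low_fun n (csize n \<zeta>) (bar n \<theta>)" if "\<theta> \<in> comps n" "csize n \<theta> = csize n \<eta>" for \<theta>
      using less.hyps[of \<theta>] that \<eta> bar_poly_low by auto
    define L where "L p = alpha * of_nat (\<eta> i) * bar n \<eta> p + (\<Sum>j\<in>{..<n} - {i}. exch n i j \<eta> p)" for p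
    have "low_fun n (csize n \<zeta>) (exch n i j \<eta>)" if "j \<in> {..<n} - {i}" for j
    proof -
      define c where "c = (if j < i then Suc (\<eta> j) else \<eta> j)"
      \<comment> \<open>A part before \<open>i\<close> is strictly below the maximum, which pays for
        the extra term of \<open>exch\<close>; a later part may equal it, but there no extra term
        occurs. So the second sum is contained in the first.\<close>
      have c: "c \<le> Suc (\<eta> i)"
        using before[of j] M[of j] that \<open>M \<noteq> 0\<close> by (auto simp: c_def \<eta>_def)
      have "exch n i j \<eta> p = (\<Sum>k\<in>{c..<Suc (\<eta> i)}. bar n (move \<eta> i j k) p)" for p
      proof -
        have "(\<Sum>k<Suc (\<eta> i). bar n (move \<eta> i j k) p) =
          (\<Sum>k<c. bar n (move \<eta> i j k) p) + (\<Sum>k\<in>{c..<Suc (\<eta> i)}. bar n (move \<eta> i j k) p)"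
        proof -
          have un: "{..<Suc (\<eta> i)} = {..<c} \<union> {c..<Suc (\<eta> i)}" using c by auto
          show ?thesis unfolding un by (rule sum.union_disjoint) auto
        qed
        then show ?thesis by (simp add: exch_def c_def lessThan_Suc_atMost)
      qed
      then have eq: "exch n i j \<eta> = (\<lambda>p. \<Sum>k\<in>{c..<Suc (\<eta> i)}. bar n (move \<eta> i j k) p)" by blast
      show ?thesis
        unfolding eq using that i \<eta>(1) by (intro low_fun_sum low) (auto intro!: csize_move)
    qed
    then have "low_fun n (csize n \<zeta>) L" unfolding L_def
      using \<eta>(1) by (intro low_fun_add low_fun_mult low_fun_sum low nat_polys_intros) auto
    then obtain C where C: "\<And>\<gamma>. Poly_Mapping.lookup C \<gamma> \<in> nat_polys_in_alpha"
      "\<And>\<gamma>. \<gamma> \<in> Poly_Mapping.keys C \<Longrightarrow> Poly_Mapping.keys \<gamma> \<subseteq> {..<n}"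
      "\<And>\<gamma>. \<gamma> \<in> Poly_Mapping.keys C \<Longrightarrow> weight \<gamma> < csize n \<zeta>"
      "\<And>p. ev (coord p) C = L p" unfolding low_fun_def by blast
    obtain B where B: "bar_poly n \<eta> B" using less.hyps[of \<eta>] \<eta> by auto
    have "bar_poly n \<zeta> (var i * B + C)"
      unfolding bar_poly_def
    proof (intro conjI allI ballI impI)
      fix \<gamma> :: expo
      show "Poly_Mapping.lookup (var i * B + C) \<gamma> \<in> nat_polys_in_alpha"
      proof (cases "\<gamma> \<in> Poly_Mapping.keys (var i * B)")
        case True
        then obtain \<theta> where "\<gamma> = Poly_Mapping.single i 1 + \<theta>" by (rule keys_var_mult)
        then show ?thesis using B C(1)
          by (simp add: lookup_add lookup_var_mult[unfolded One_nat_def] bar_poly_def nat_polys_add)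
      next
        case False
        then show ?thesis using C(1) by (simp add: lookup_add in_keys_iff)
      qed
      show "Poly_Mapping.lookup (var i * B + C) \<gamma> = 1" if "Poly_Mapping.lookup \<gamma> = \<zeta>"
      proof -
        define \<theta> where "\<theta> = \<gamma> - Poly_Mapping.single i 1"
        have g: "\<gamma> = Poly_Mapping.single i 1 + \<theta>"
          by (rule poly_mapping_eqI)
            (use that i \<open>M \<noteq> 0\<close> in \<open>auto simp: \<theta>_def lookup_add lookup_minus lookup_single when_def\<close>)
        have "Poly_Mapping.lookup \<theta> = \<eta>"
          using that i by (auto simp: \<theta>_def lookup_minus lookup_single when_def \<eta>_def)
        then have "Poly_Mapping.lookup B \<theta> = 1" using B by (simp add: bar_poly_def)
        moreover have "weight \<gamma> = csize n \<zeta>"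
        proof -
          have "Poly_Mapping.keys \<gamma> \<subseteq> {..<n}"
            using that less.prems by (auto simp: in_keys_iff intro: comps_pos)
          then show ?thesis using that by (simp add: weight_csize)
        qed
        then have "\<gamma> \<notin> Poly_Mapping.keys C" using C(3) by fastforce
        then have "Poly_Mapping.lookup C \<gamma> = 0" by (simp add: in_keys_iff)
        ultimately show ?thesis
          using lookup_var_mult[of i B \<theta>] by (simp add: lookup_add g)
      qed
    next
      fix \<gamma> assume "\<gamma> \<in> Poly_Mapping.keys (var i * B + C)"
      then consider "\<gamma> \<in> Poly_Mapping.keys (var i * B)" | "\<gamma> \<in> Poly_Mapping.keys C"
        using keys_add[of "var i * B" C] by blast
      then have "Poly_Mapping.keys \<gamma> \<subseteq> {..<n} \<and> (weight \<gamma> < csize n \<zeta> \<or> Poly_Mapping.lookup \<gamma> = \<zeta>)"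
      proof cases
        case 1
        then obtain \<theta> where \<theta>: "\<theta> \<in> Poly_Mapping.keys B" "\<gamma> = Poly_Mapping.single i 1 + \<theta>" by (rule keys_var_mult)
        have "Poly_Mapping.keys \<theta> \<subseteq> {..<n}" "weight \<theta> < csize n \<eta> \<or> Poly_Mapping.lookup \<theta> = \<eta>"
          using B \<theta>(1) by (auto simp: bar_poly_def)
        moreover have "Poly_Mapping.lookup \<gamma> = \<zeta>" if "Poly_Mapping.lookup \<theta> = \<eta>"
          using that \<theta>(2) by (auto simp: \<zeta> lookup_add lookup_single when_def fun_eq_iff)
        moreover have "Poly_Mapping.keys \<gamma> \<subseteq> insert i (Poly_Mapping.keys \<theta>)"
          using keys_add[of "Poly_Mapping.single i 1" \<theta>] \<theta>(2) by (auto split: if_splits)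
        ultimately show ?thesis using \<theta>(2) \<eta>(2) i by (auto simp: weight_add)
      next
        case 2
        then show ?thesis using C by auto
      qed
      then show "Poly_Mapping.keys \<gamma> \<subseteq> {..<n}" "weight \<gamma> < csize n \<zeta> \<or> Poly_Mapping.lookup \<gamma> = \<zeta>" by auto
    next
      fix p
      show "ev (coord p) (var i * B + C) = bar n \<zeta> p"
        using coord_times_bar[OF \<eta>(1) assms(2) i(1), of p] B C(4)[of p]
        by (simp add: ev_add ev_var_mult bar_poly_def L_def \<zeta>[symmetric])
    qed
    then show ?thesis by blast
  qed
qed

section \<open>Vanishing points\<close>

text \<open>Among equal parts the earlier position counts as the higher one, so that for a partition
  the ranks \<open>n - 1 - i\<close> are the entries of \<delta>.\<close>

definition below :: "(nat \<Rightarrow> nat) \<Rightarrow> nat \<Rightarrow> nat \<Rightarrow> bool" where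
  "below \<nu> j i \<longleftrightarrow> \<nu> j < \<nu> i \<or> \<nu> j = \<nu> i \<and> i < j"

definition rank :: "nat \<Rightarrow> (nat \<Rightarrow> nat) \<Rightarrow> nat \<Rightarrow> nat" where
  "rank n \<nu> i = card {j. j < n \<and> below \<nu> j i}"

lemma rank_less:
  assumes "i < n" "below \<nu> i j"
  shows "rank n \<nu> i < rank n \<nu> j"
  unfolding rank_def
proof (rule psubset_card_mono)
  have "{k. k < n \<and> below \<nu> k i} \<subseteq> {k. k < n \<and> below \<nu> k j}"
    using assms(2) by (auto simp: below_def)
  moreover have "i \<in> {k. k < n \<and> below \<nu> k j}" "i \<notin> {k. k < n \<and> below \<nu> k i}"
    using assms by (auto simp: below_def)
  ultimately show "{k. k < n \<and> below \<nu> k i} \<subset> {k. k < n \<and> below \<nu> k j}" by blast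
qed simp

lemma rank_inj:
  assumes "i < n" "j < n" "i \<noteq> j"
  shows "rank n \<nu> i \<noteq> rank n \<nu> j"
proof -
  have "below \<nu> i j \<or> below \<nu> j i" using assms(3) by (auto simp: below_def)
  then show ?thesis using rank_less[of i n \<nu> j] rank_less[of j n \<nu> i] assms by auto
qed

lemma rank_reindex:
  assumes "bij_betw s {..<n} {..<n}" "j < n"
    and "\<And>k. k < n \<Longrightarrow> below \<nu>' k j \<longleftrightarrow> below \<nu> (s k) (s j)"
  shows "rank n \<nu>' j = rank n \<nu> (s j)"
proof -
  have inj: "inj_on s {..<n}" and im: "s ` {..<n} = {..<n}"
    using assms(1) by (auto simp: bij_betw_def)
  have "s ` {k. k < n \<and> below \<nu>' k j} = {k. k < n \<and> below \<nu> k (s j)}"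
  proof (intro equalityI subsetI)
    fix k assume "k \<in> s ` {k. k < n \<and> below \<nu>' k j}"
    then show "k \<in> {k. k < n \<and> below \<nu> k (s j)}" using assms(3) im by auto
  next
    fix k assume k: "k \<in> {k. k < n \<and> below \<nu> k (s j)}"
    then obtain l where "l < n" "k = s l" using im by (metis (mono_tags, lifting) imageE lessThan_iff mem_Collect_eq)
    with k assms(3) show "k \<in> s ` {k. k < n \<and> below \<nu>' k j}" by auto
  qed
  moreover have "card (s ` {k. k < n \<and> below \<nu>' k j}) = card {k. k < n \<and> below \<nu>' k j}"
    by (intro card_image inj_on_subset[OF inj]) auto
  ultimately show ?thesis by (simp add: rank_def)
qed

text \<open>Only the first \<open>n\<close> coordinates matter; the others are chosen such that the point is generic.\<close>
definition pt :: "nat \<Rightarrow> (nat \<Rightarrow> nat) \<Rightarrow> point" where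
  "pt n \<nu> = Abs_point (\<lambda>i. if i < n then - (alpha * of_nat (\<nu> i) + of_nat (rank n \<nu> i)) else of_nat (Suc i))"

lemma coord_pt_eq:
  "coord (pt n \<nu>) i = (if i < n then - (alpha * of_nat (\<nu> i) + of_nat (rank n \<nu> i)) else of_nat (Suc i))"
proof -
  define e where "e i = (if i < n then - int (\<nu> i) else 0)" for i
  define z where "z i = (if i < n then - int (rank n \<nu> i) else int (Suc i))" for i
  define x where "x = (\<lambda>i. if i < n then - (alpha * of_nat (\<nu> i) + of_nat (rank n \<nu> i)) else of_nat (Suc i))"
  have x: "x i = of_int (e i) * alpha + of_int (z i)" for i by (simp add: x_def e_def z_def)
  have "x i - x j \<noteq> of_int k * alpha" if "i \<noteq> j" for i j k
  proof
    assume "x i - x j = of_int k * alpha"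
    then have "of_int (k - e i + e j) * alpha = of_int (z i - z j)"
      by (simp add: x algebra_simps)
    then have "z i = z j" using alpha_generic(2) by fastforce
    moreover have "z i \<noteq> z j"
      using that rank_inj[of i n j \<nu>] by (auto simp: z_def)
    ultimately show False by simp
  qed
  then have "coord (pt n \<nu>) = x" unfolding pt_def x_def[symmetric] by (intro Abs_point_inverse) auto
  then show ?thesis by (simp add: x_def)
qed

lemma coord_pt: "i < n \<Longrightarrow> coord (pt n \<nu>) i = - (alpha * of_nat (\<nu> i) + of_nat (rank n \<nu> i))"
  by (simp add: coord_pt_eq)

text \<open>Swapping neighbouring distinct parts leaves every comparison intact, ties with other
  positions included, so the ranks travel with their parts.\<close>

lemma swap_pt:
  assumes "Suc i < n" "\<nu> i \<noteq> \<nu> (Suc i)"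
  shows "swap_point i (pt n \<nu>) = pt n (swapE i \<nu>)"
proof (rule point_eqI)
  fix j
  define s where "s = transpose i (Suc i)"
  have "s permutes {..<n}" using assms(1) unfolding s_def by (intro permutes_swap_id) auto
  then have bij: "bij_betw s {..<n} {..<n}" by (rule permutes_imp_bij)
  have sn: "s j < n \<longleftrightarrow> j < n" for j using assms(1) by (auto simp: s_def transpose_def)
  have "rank n (swapE i \<nu>) j = rank n \<nu> (s j)" if "j < n"
    by (rule rank_reindex[OF bij that])
      (use assms in \<open>auto simp: below_def swapE_def s_def transpose_def\<close>)
  then show "coord (swap_point i (pt n \<nu>)) j = coord (pt n (swapE i \<nu>)) j"
    using sn[of j] assms(1) by (auto simp: coord_swap coord_pt_eq swapE_def s_def transpose_def)
qed

text \<open>Equal neighbouring parts have consecutive ranks, so the coordinates differ by -1 and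
  \<open>1 + 1 / (- 1) = 0\<close> removes the value at the swapped point, which is no longer of the
  form \<open>pt n \<nu>\<close>.\<close>

lemma sig_pt_tie:
  assumes "Suc i < n" "\<nu> i = \<nu> (Suc i)"
  shows "sig i f (pt n \<nu>) = f (pt n \<nu>)"
proof -
  have "{j. j < n \<and> below \<nu> j i} = insert (Suc i) {j. j < n \<and> below \<nu> j (Suc i)}"
    using assms by (auto simp: below_def)
  then have "rank n \<nu> i = Suc (rank n \<nu> (Suc i))"
    unfolding rank_def by (simp add: below_def)
  then have "coord (pt n \<nu>) i - coord (pt n \<nu>) (Suc i) = - 1"
    using assms by (simp add: coord_pt)
  then show ?thesis by (simp add: sig_def)
qed

lemma sig_pt:
  assumes "Suc i < n" "\<nu> i \<noteq> \<nu> (Suc i)"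
  shows "sig i f (pt n \<nu>) = (1 + 1 / (coord (pt n \<nu>) i - coord (pt n \<nu>) (Suc i))) * f (pt n (swapE i \<nu>))
    - f (pt n \<nu>) / (coord (pt n \<nu>) i - coord (pt n \<nu>) (Suc i))"
  by (simp add: sig_def swap_pt[OF assms])

lemma rank_insE:
  assumes "n > 0" "j < n"
  shows "rank n (insE (n - 1) \<nu>) j = rank n \<nu> (if j = n - 1 then 0 else Suc j)"
proof -
  define s where "s = (\<lambda>k. if k = n - 1 then 0 else Suc k)"
  have "bij_betw s {..<n} {..<n}"
    by (rule bij_betw_byWitness[where f' = "\<lambda>k. if k = 0 then n - 1 else k - 1"])
      (use assms(1) in \<open>auto simp: s_def\<close>)
  then have "rank n (insE (n - 1) \<nu>) j = rank n \<nu> (s j)"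
    by (rule rank_reindex[OF _ assms(2)]) (use assms in \<open>auto simp: below_def insE_def s_def\<close>)
  then show ?thesis by (simp add: s_def)
qed

text \<open>The \<open>alpha\<close> added by the rotation undoes the raising of the first
  part.\<close>

lemma rotate_pt:
  assumes "n > 0"
  shows "rotate_point n (pt n (insE (n - 1) \<nu>)) = pt n \<nu>"
proof (rule point_eqI)
  fix j
  consider "j = 0" | "0 < j" "j < n" | "j \<ge> n" by linarith
  then show "coord (rotate_point n (pt n (insE (n - 1) \<nu>))) j = coord (pt n \<nu>) j"
  proof cases
    case 1
    then show ?thesis using assms
      by (simp add: coord_rotate coord_pt_eq rank_insE[unfolded One_nat_def]) (simp add: insE_def algebra_simps)
  next
    case 2
    then show ?thesis using assms
      by (simp add: coord_rotate coord_pt_eq rank_insE[unfolded One_nat_def]) (auto simp: insE_def)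
  next
    case 3
    then show ?thesis using assms by (simp add: coord_rotate coord_pt_eq)
  qed
qed

text \<open>A last part 0 also has rank 0. Hence \<open>Phi\<close> vanishes at all labels that are
  not rotations, and its vanishing conditions reach one degree further than those of its
  argument.\<close>

lemma coord_pt_last_zero:
  assumes "n > 0" "\<nu> (n - 1) = 0"
  shows "coord (pt n \<nu>) (n - 1) = 0"
proof -
  have "{j. j < n \<and> below \<nu> j (n - 1)} = {}" using assms by (auto simp: below_def)
  then have "rank n \<nu> (n - 1) = 0" by (simp add: rank_def)
  then show ?thesis using assms by (simp add: coord_pt)
qed

section \<open>Propagation of the vanishing conditions\<close>

definition supported :: "nat \<Rightarrow> nat \<Rightarrow> (nat \<Rightarrow> nat) set \<Rightarrow> (point \<Rightarrow> ratfun) \<Rightarrow> bool" where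
  "supported n d S f \<longleftrightarrow> (\<forall>\<nu>\<in>comps n. csize n \<nu> \<le> d \<longrightarrow> \<nu> \<notin> S \<longrightarrow> f (pt n \<nu>) = 0)"

lemma supported_mono: "supported n d S f \<Longrightarrow> S \<subseteq> T \<Longrightarrow> supported n d T f"
  by (auto simp: supported_def)

text \<open>By \<open>sig_pt\<close> and \<open>sig_pt_tie\<close> the value at a label involves
  only this label and its swap.\<close>

lemma supported_sig:
  assumes "supported n d S f" "Suc i < n" "\<And>\<nu>. \<nu> \<in> S \<Longrightarrow> swapE i \<nu> \<in> S"
  shows "supported n d S (sig i f)"
  unfolding supported_def
proof (intro ballI impI)
  fix \<nu> assume \<nu>: "\<nu> \<in> comps n" "csize n \<nu> \<le> d" "\<nu> \<notin> S"
  then have "swapE i \<nu> \<in> comps n" "csize n (swapE i \<nu>) \<le> d" "swapE i \<nu> \<notin> S"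
    using assms(2) assms(3)[of "swapE i \<nu>"] by auto
  with \<nu> assms(1) have "f (pt n \<nu>) = 0" "f (pt n (swapE i \<nu>)) = 0" by (auto simp: supported_def)
  then show "sig i f (pt n \<nu>) = 0"
    using sig_pt[OF assms(2), of \<nu> f] sig_pt_tie[OF assms(2), of \<nu> f] by (cases "\<nu> i = \<nu> (Suc i)") auto
qed

lemma supported_Phi:
  assumes "supported n d S f" "n > 0"
  shows "supported n (Suc d) (insE (n - 1) ` S) (Phi n f)"
  unfolding supported_def
proof (intro ballI impI)
  fix \<nu> assume \<nu>: "\<nu> \<in> comps n" "csize n \<nu> \<le> Suc d" "\<nu> \<notin> insE (n - 1) ` S"
  show "Phi n f (pt n \<nu>) = 0"
  proof (cases "\<nu> (n - 1) = 0")
    case True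
    then show ?thesis using coord_pt_last_zero[OF assms(2)] by (simp add: Phi_def)
  next
    case False
    then obtain \<zeta> where \<zeta>: "\<zeta> \<in> comps n" "\<nu> = insE (n - 1) \<zeta>" using insE_surj[OF \<nu>(1) assms(2)] by auto
    then have "f (pt n \<zeta>) = 0" using assms \<nu> by (auto simp: supported_def)
    then show ?thesis using \<zeta>(2) assms(2) by (simp only: Phi_def rotate_pt mult_zero_right)
  qed
qed

lemma supported_chain:
  assumes "supported n d S f" "j < n" "\<And>l \<nu>. i \<le> l \<Longrightarrow> Suc l < n \<Longrightarrow> \<nu> \<in> S \<Longrightarrow> swapE l \<nu> \<in> S"
  shows "supported n d S (chain i j f)"
proof (cases "i \<le> j")
  case True
  then show ?thesis
  proof (induction rule: inc_induct)
    case base then show ?case using assms by simp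
  next
    case (step k)
    then show ?case using assms by (auto simp: chain_Cons[of k j] intro!: supported_sig)
  qed
qed (use assms in simp)

lemma insert_op_add: "insert_op n i (\<lambda>p. f p + g p) = (\<lambda>p. insert_op n i f p + insert_op n i g p)"
proof -
  have "sig j (\<lambda>p. f p + g p) = (\<lambda>p. sig j f p + sig j g p)" for j f g
    by (simp add: sig_def fun_eq_iff algebra_simps add_divide_distrib)
  then have "foldr sig xs (\<lambda>p. f p + g p) = (\<lambda>p. foldr sig xs f p + foldr sig xs g p)" for xs f g
    by (induction xs) auto
  then show ?thesis by (simp add: insert_op_def chain_def Phi_def algebra_simps)
qed

lemma insert_op_cmult: "insert_op n i (\<lambda>p. c * f p) = (\<lambda>p. c * insert_op n i f p)"
proof -
  have "sig j (\<lambda>p. c * f p) = (\<lambda>p. c * sig j f p)" for j f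
    by (simp add: sig_def fun_eq_iff algebra_simps)
  then have "foldr sig xs (\<lambda>p. c * f p) = (\<lambda>p. c * foldr sig xs f p)" for xs f
    by (induction xs) auto
  then show ?thesis by (simp add: insert_op_def chain_def Phi_def mult.left_commute)
qed

lemma insert_op_zero: "insert_op n i (\<lambda>p. 0) = (\<lambda>p. 0)"
  using insert_op_cmult[of n i 0 "\<lambda>_. 0"] by simp

text \<open>Positions from \<open>m - 1\<close> on hold zeros apart from the inserted part, whose
  coordinate \<open>- \<theta>\<close> is therefore the same at each of them. Descending from
  \<open>i = n - 1\<close>, where a single label carries a value, each \<open>sig\<close> spreads
  that value to one more label.\<close>

lemma insert_op_values:
  fixes \<eta> :: "nat \<Rightarrow> nat"
  assumes \<eta>: "\<eta> \<in> comps n" "\<And>j. j \<ge> m \<Longrightarrow> \<eta> j = 0" and m: "m > 0" "m \<le> n"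
    and f: "supported n (csize n \<eta>) {\<eta>} f"
  defines "u \<equiv> Phi n f (pt n (insE (n - 1) \<eta>))"
    and "\<theta> \<equiv> alpha * of_nat (Suc (\<eta> 0)) + of_nat (n - m + card {j. j < m - 1 \<and> \<eta> (Suc j) \<le> \<eta> 0})"
  assumes i: "m - 1 \<le> i" "i < n" and \<nu>: "\<nu> \<in> comps n" "csize n \<nu> \<le> Suc (csize n \<eta>)"
  shows "insert_op n i f (pt n \<nu>) =
    (if \<nu> = insE i \<eta> then (\<theta> - of_nat (n - 1 - i)) / \<theta> * u
     else if \<exists>p. i < p \<and> p < n \<and> \<nu> = insE p \<eta> then - u / \<theta> else 0)"
proof -
  define \<kappa> where "\<kappa> p = insE p \<eta>" for p
  define t where "t i = \<theta> - of_nat (n - 2 - i)" for i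
  have nz: "\<theta> - of_nat k \<noteq> 0" for k
  proof
    assume "\<theta> - of_nat k = 0"
    then have "of_int (int (Suc (\<eta> 0))) * alpha = of_int (int k - int (n - m + card {j. j < m - 1 \<and> \<eta> (Suc j) \<le> \<eta> 0}))"
      by (simp add: \<theta>_def algebra_simps)
    then show False using alpha_generic(1) by fastforce
  qed
  have nz0: "\<theta> \<noteq> 0" using nz[of 0] by simp
  have kz: "\<kappa> p j = (if j = p then Suc (\<eta> 0) else 0)" if "m - 1 \<le> j" "m - 1 \<le> p" for p j
    using that \<eta>(2) m by (auto simp: \<kappa>_def insE_def)
  have kl: "\<kappa> p j = \<eta> (Suc j)" if "j < m - 1" "m - 1 \<le> p" for p j
    using that by (auto simp: \<kappa>_def insE_def)
  have k_inj: "\<kappa> p = \<kappa> q \<longleftrightarrow> p = q" if "m - 1 \<le> p" "m - 1 \<le> q" for p q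
    using kz[of p p] kz[of p q] that by (auto split: if_splits)
  have k_swap: "swapE p (\<kappa> p) = \<kappa> (Suc p)" "swapE p (\<kappa> (Suc p)) = \<kappa> p" for p
    by (simp_all add: \<kappa>_def insE_Suc)
  have rank_p: "coord (pt n (\<kappa> p)) p = - \<theta>" if p: "m - 1 \<le> p" "p < n" for p
  proof -
    have un: "{j. j < n \<and> below (\<kappa> p) j p} = ({m - 1..<n} - {p}) \<union> {j. j < m - 1 \<and> \<eta> (Suc j) \<le> \<eta> 0}"
    proof (intro set_eqI iffI)
      fix j assume "j \<in> {j. j < n \<and> below (\<kappa> p) j p}"
      then show "j \<in> ({m - 1..<n} - {p}) \<union> {j. j < m - 1 \<and> \<eta> (Suc j) \<le> \<eta> 0}"
        using p kz[of p p] kl[of j p] by (cases "j < m - 1") (auto simp: below_def)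
    next
      fix j assume "j \<in> ({m - 1..<n} - {p}) \<union> {j. j < m - 1 \<and> \<eta> (Suc j) \<le> \<eta> 0}"
      then show "j \<in> {j. j < n \<and> below (\<kappa> p) j p}"
      proof
        assume "j \<in> {m - 1..<n} - {p}"
        then show ?thesis using p kz[of p p] kz[of j p] by (simp add: below_def)
      next
        assume "j \<in> {j. j < m - 1 \<and> \<eta> (Suc j) \<le> \<eta> 0}"
        then show ?thesis using p m kz[of p p] kl[of j p] by (simp add: below_def)
      qed
    qed
    have "card ({m - 1..<n} - {p}) = n - m" using p m by simp
    moreover have "({m - 1..<n} - {p}) \<inter> {j. j < m - 1 \<and> \<eta> (Suc j) \<le> \<eta> 0} = {}" by auto
    ultimately have "rank n (\<kappa> p) p = n - m + card {j. j < m - 1 \<and> \<eta> (Suc j) \<le> \<eta> 0}"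
      unfolding rank_def un by (simp add: card_Un_disjoint)
    then show ?thesis using p kz[of p p] by (simp add: coord_pt \<theta>_def)
  qed
  have rank_q: "coord (pt n (\<kappa> p)) q = - of_nat (if q < p then n - 2 - q else n - 1 - q)"
    if p: "m - 1 \<le> p" "p < n" "m - 1 \<le> q" "q < n" "q \<noteq> p" for p q
  proof -
    have "{j. j < n \<and> below (\<kappa> p) j q} = {q<..<n} - {p}"
      using p kz[of q p] kz[of _ p] by (auto simp: below_def split: if_splits)
    then have "rank n (\<kappa> p) q = (if q < p then n - 2 - q else n - 1 - q)"
      using p by (auto simp: rank_def)
    then show ?thesis using p kz[of q p] by (simp add: coord_pt)
  qed
  define e where "e = Phi n f"
  have e: "e (pt n \<nu>) = (if \<nu> = \<kappa> (n - 1) then u else 0)"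
    if "\<nu> \<in> comps n" "csize n \<nu> \<le> Suc (csize n \<eta>)" for \<nu>
    using supported_Phi[OF f] that m by (auto simp: supported_def e_def u_def \<kappa>_def)
  have "i \<le> n - 1" using i by simp
  then have "chain i (n - 1) e (pt n \<nu>) =
    (if \<nu> = \<kappa> i then (\<theta> - of_nat (n - 1 - i)) / \<theta> * u
     else if \<exists>p. i < p \<and> p < n \<and> \<nu> = \<kappa> p then - u / \<theta> else 0)"
    using \<nu>
  proof (induction arbitrary: \<nu> rule: inc_induct)
    case base
    then show ?case using e nz0 by auto
  next
    case (step l)
    have l: "Suc l < n" "m - 1 \<le> l" using step.hyps i by auto
    define g where "g = chain (Suc l) (n - 1) e"
    have g: "g (pt n \<nu>) = (if \<nu> = \<kappa> (Suc l) then t l / \<theta> * u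
     else if \<exists>p. Suc l < p \<and> p < n \<and> \<nu> = \<kappa> p then - u / \<theta> else 0)"
      if "\<nu> \<in> comps n" "csize n \<nu> \<le> Suc (csize n \<eta>)" for \<nu>
      unfolding g_def t_def using step.IH[OF that] l by (simp add: numeral_2_eq_2)
    have n1: "of_nat (n - 1 - l) = (of_nat (n - 2 - l) + 1 :: ratfun)"
      using l by (metis Suc_1 Suc_diff_Suc diff_Suc_eq_diff_pred diff_commute of_nat_Suc add.commute less_diff_conv plus_1_eq_Suc)
    have t: "t l \<noteq> 0" using nz by (simp add: t_def)
    have ch: "chain l (n - 1) e = sig l g" using l by (simp add: chain_Cons g_def)
    \<comment> \<open>Two zeros stand at \<open>l\<close> and \<open>Suc l\<close>: a tie, so
      \<open>sig l\<close> hands these values on unchanged.\<close>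
    have far: "\<kappa> p l = \<kappa> p (Suc l)" if "Suc l < p" for p
      using that l kz[of l p] kz[of "Suc l" p] by simp
    have near: "\<kappa> l l \<noteq> \<kappa> l (Suc l)" "\<kappa> (Suc l) l \<noteq> \<kappa> (Suc l) (Suc l)"
      using l by (simp_all add: kz)
    show ?case
    proof (cases "\<nu> l = \<nu> (Suc l)")
      case True
      then have "\<nu> \<noteq> \<kappa> l" "\<nu> \<noteq> \<kappa> (Suc l)" using near by auto
      then have "(\<exists>p. l < p \<and> p < n \<and> \<nu> = \<kappa> p) \<longleftrightarrow> (\<exists>p. Suc l < p \<and> p < n \<and> \<nu> = \<kappa> p)"
        by (metis Suc_lessI Suc_lessD)
      then show ?thesis
        unfolding ch sig_pt_tie[OF l(1) True] g[OF step.prems]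
        using \<open>\<nu> \<noteq> \<kappa> l\<close> \<open>\<nu> \<noteq> \<kappa> (Suc l)\<close> by simp
    next
      case False
      define D where "D = coord (pt n \<nu>) l - coord (pt n \<nu>) (Suc l)"
      have S: "sig l g (pt n \<nu>) = (1 + 1 / D) * g (pt n (swapE l \<nu>)) - g (pt n \<nu>) / D"
        unfolding D_def by (rule sig_pt[OF l(1) False])
      have gs: "g (pt n (swapE l \<nu>)) = (if swapE l \<nu> = \<kappa> (Suc l) then t l / \<theta> * u
        else if \<exists>p. Suc l < p \<and> p < n \<and> swapE l \<nu> = \<kappa> p then - u / \<theta> else 0)"
        using step.prems l by (intro g) auto
      have nofar: "\<nu> \<noteq> \<kappa> p" "swapE l \<nu> \<noteq> \<kappa> p" if "Suc l < p" for p
      proof -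
        have "swapE l \<nu> l = \<nu> (Suc l)" "swapE l \<nu> (Suc l) = \<nu> l" by (simp_all add: swapE_def)
        with far[OF that] False show "\<nu> \<noteq> \<kappa> p" "swapE l \<nu> \<noteq> \<kappa> p" by auto
      qed
      consider "\<nu> = \<kappa> l" | "\<nu> = \<kappa> (Suc l)" | "\<nu> \<noteq> \<kappa> l" "\<nu> \<noteq> \<kappa> (Suc l)" by blast
      then show ?thesis
      proof cases
        case 1
        \<comment> \<open>The factor \<open>1 + 1 / D\<close> turns \<open>t l / \<theta>\<close>
          into \<open>(t l - 1) / \<theta>\<close>, and \<open>t l - 1\<close> is the numerator
          claimed for \<open>l\<close>.\<close>
        have "D = - t l" using 1 l rank_p[of l] rank_q[of l "Suc l"] by (simp add: D_def t_def)
        moreover have "g (pt n \<nu>) = 0"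
          using g[OF step.prems] nofar(1) 1 k_inj[of l "Suc l"] l by auto
        moreover have "g (pt n (swapE l \<nu>)) = t l / \<theta> * u"
          using gs 1 k_swap by simp
        ultimately have "sig l g (pt n \<nu>) = (t l - 1) / \<theta> * u"
          using t nz0 unfolding S by (simp add: field_simps)
        then show ?thesis using 1 ch n1 by (simp add: t_def algebra_simps)
      next
        case 2
        have "D = t l" using 2 l rank_p[of "Suc l"] rank_q[of "Suc l" l] by (simp add: D_def t_def)
        moreover have "g (pt n (swapE l \<nu>)) = 0"
          using gs nofar(2) 2 k_inj[of l "Suc l"] k_swap l by auto
        moreover have "g (pt n \<nu>) = t l / \<theta> * u" using g[OF step.prems] 2 by simp
        ultimately have "sig l g (pt n \<nu>) = - u / \<theta>"
          using t nz0 unfolding S by (simp add: field_simps)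
        then show ?thesis using 2 ch k_inj[of "Suc l" l] l by auto
      next
        case 3
        have "swapE l \<nu> \<noteq> \<kappa> (Suc l)" using 3 k_swap swapE_swapE by metis
        then have "g (pt n (swapE l \<nu>)) = 0" using gs nofar(2) by auto
        moreover have "g (pt n \<nu>) = 0" using g[OF step.prems] nofar(1) 3 by auto
        ultimately have "sig l g (pt n \<nu>) = 0" unfolding S by simp
        moreover have nex: "\<not> (\<exists>p. l < p \<and> p < n \<and> \<nu> = \<kappa> p)"
          using 3 nofar(1) by (metis Suc_lessI)
        ultimately show ?thesis by (simp only: ch if_not_P[OF 3(1)] nex if_False)
      qed
    qed
  qed
  then show ?thesis by (simp add: insert_op_def e_def \<kappa>_def)
qed

text \<open>The factor \<open>c\<close> is chosen so that the values at \<open>insE p \<eta>\<close> with \<open>p \<ge> m\<close> cancel.\<close>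
lemma knop_sahi_step:
  fixes \<eta> :: "nat \<Rightarrow> nat"
  assumes \<eta>: "\<eta> \<in> comps n" "\<And>j. j \<ge> m \<Longrightarrow> \<eta> j = 0" and m: "m > 0" "m \<le> n"
    and f: "supported n (csize n \<eta>) {\<eta>} f"
  defines "c \<equiv> alpha * of_nat (Suc (\<eta> 0)) + of_nat (card {j. j < m - 1 \<and> \<eta> (Suc j) \<le> \<eta> 0})"
  shows "supported n (Suc (csize n \<eta>)) {insE (m - 1) \<eta>}
    (\<lambda>p. c * insert_op n (m - 1) f p + (\<Sum>i\<in>{m - 1..<n}. insert_op n i f p))"
  unfolding supported_def
proof (intro ballI impI)
  fix \<nu> assume \<nu>: "\<nu> \<in> comps n" "csize n \<nu> \<le> Suc (csize n \<eta>)" "\<nu> \<notin> {insE (m - 1) \<eta>}"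
  define u where "u = Phi n f (pt n (insE (n - 1) \<eta>))"
  define \<theta> where "\<theta> = alpha * of_nat (Suc (\<eta> 0)) + of_nat (n - m + card {j. j < m - 1 \<and> \<eta> (Suc j) \<le> \<eta> 0})"
  have val: "insert_op n i f (pt n \<nu>) =
    (if \<nu> = insE i \<eta> then (\<theta> - of_nat (n - 1 - i)) / \<theta> * u
     else if \<exists>p. i < p \<and> p < n \<and> \<nu> = insE p \<eta> then - u / \<theta> else 0)"
    if "m - 1 \<le> i" "i < n" for i
    unfolding \<theta>_def u_def by (rule insert_op_values[OF \<eta> m f that \<nu>(1,2)])
  have "\<theta> \<noteq> 0"
    using alpha_generic_nat(1)[of "Suc (\<eta> 0)"] unfolding \<theta>_def by blast
  have inj: "p = q" if "insE p \<eta> = insE q \<eta>" "m - 1 \<le> p" "m - 1 \<le> q" for p q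
  proof (rule ccontr)
    assume "p \<noteq> q"
    have "insE p \<eta> p = Suc (\<eta> 0)" by (simp add: insE_def)
    moreover have "insE q \<eta> p = 0" using \<open>p \<noteq> q\<close> that(2,3) \<eta>(2) m by (auto simp: insE_def)
    ultimately show False using that(1) by simp
  qed
  show "c * insert_op n (m - 1) f (pt n \<nu>) + (\<Sum>i\<in>{m - 1..<n}. insert_op n i f (pt n \<nu>)) = 0"
  proof (cases "\<exists>p. m - 1 \<le> p \<and> p < n \<and> \<nu> = insE p \<eta>")
    case False
    then have "insert_op n i f (pt n \<nu>) = 0" if "m - 1 \<le> i" "i < n" for i
      using val[OF that] that by auto
    then show ?thesis using m by simp
  next
    case True
    then obtain p where p: "m - 1 \<le> p" "p < n" "\<nu> = insE p \<eta>" by blast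
    with \<nu>(3) have p': "m \<le> p" using m by (cases "p = m - 1") auto
    have v: "insert_op n i f (pt n \<nu>) = (if i = p then (\<theta> - of_nat (n - 1 - p)) / \<theta> * u
        else if i < p then - u / \<theta> else 0)" if "m - 1 \<le> i" "i < n" for i
    proof -
      have "\<nu> = insE i \<eta> \<longleftrightarrow> i = p"
        unfolding p(3) using inj[of p i] p(1) that(1) by metis
      moreover have "(\<exists>q. i < q \<and> q < n \<and> \<nu> = insE q \<eta>) \<longleftrightarrow> i < p"
      proof
        assume "\<exists>q. i < q \<and> q < n \<and> \<nu> = insE q \<eta>"
        then obtain q where q: "i < q" "insE p \<eta> = insE q \<eta>" using p(3) by auto
        then have "p = q" using p(1) that(1) by (intro inj) auto
        with q show "i < p" by simp
      qed (use p in auto)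
      ultimately show ?thesis using val[OF that] by simp
    qed
    have "(\<Sum>i\<in>{m - 1..<n}. insert_op n i f (pt n \<nu>)) =
      (\<Sum>i\<in>{m - 1..<n}. if i = p then (\<theta> - of_nat (n - 1 - p)) / \<theta> * u else if i < p then - u / \<theta> else 0)"
      by (intro sum.cong) (auto simp: v)
    also have "\<dots> = of_nat (p - (m - 1)) * (- u / \<theta>) + (\<theta> - of_nat (n - 1 - p)) / \<theta> * u"
    proof -
      have un: "{m - 1..<n} = {m - 1..<p} \<union> ({p} \<union> {Suc p..<n})" using p by auto
      show ?thesis unfolding un by (subst sum.union_disjoint, simp, simp, force)+ simp
    qed
    finally have sum: "(\<Sum>i\<in>{m - 1..<n}. insert_op n i f (pt n \<nu>)) =
      of_nat (p - (m - 1)) * (- u / \<theta>) + (\<theta> - of_nat (n - 1 - p)) / \<theta> * u" .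
    \<comment> \<open>There are \<open>n - m\<close> positions from \<open>m - 1\<close> on other
      than \<open>p\<close>, and \<theta> exceeds \<open>c\<close> by this number.\<close>
    have "c + of_nat (p - (m - 1)) + of_nat (n - 1 - p) = \<theta>"
      using p p' m by (simp add: c_def \<theta>_def flip: of_nat_add)
    moreover have "c * (- u / \<theta>) + (a * (- u / \<theta>) + (\<theta> - b) / \<theta> * u) = (\<theta> - (c + a + b)) * (u / \<theta>)" for a b
      by (simp add: algebra_simps diff_divide_distrib add_divide_distrib)
    ultimately have "c * (- u / \<theta>) + (of_nat (p - (m - 1)) * (- u / \<theta>) + (\<theta> - of_nat (n - 1 - p)) / \<theta> * u) = 0"
      by simp
    then show ?thesis using sum v[of "m - 1"] p p' m by simp
  qed
qed

section \<open>Combinations of the basis and column combinatorics\<close>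

text \<open>Formal combinations rather than functions, so that the coefficients stay visible; a
  label may occur repeatedly.\<close>

type_synonym combo = "(ratfun \<times> (nat \<Rightarrow> nat)) list"

definition bar_sum :: "nat \<Rightarrow> combo \<Rightarrow> point \<Rightarrow> ratfun" where
  "bar_sum n G = (\<lambda>p. \<Sum>(c, \<eta>)\<leftarrow>G. c * bar n \<eta> p)"

definition combo_ok :: "nat \<Rightarrow> nat \<Rightarrow> combo \<Rightarrow> bool" where
  "combo_ok n s G \<longleftrightarrow> (\<forall>(c, \<eta>)\<in>set G. c \<in> nat_polys_in_alpha \<and> \<eta> \<in> comps n \<and> csize n \<eta> = s)"

definition ins_combo :: "nat \<Rightarrow> combo \<Rightarrow> combo" where
  "ins_combo i G = map (\<lambda>(c, \<eta>). (c, insE i \<eta>)) G"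

definition scale_combo :: "ratfun \<Rightarrow> combo \<Rightarrow> combo" where
  "scale_combo d G = map (\<lambda>(c, \<eta>). (d * c, \<eta>)) G"

definition sum_combo :: "nat \<Rightarrow> nat \<Rightarrow> combo \<Rightarrow> combo" where
  "sum_combo k n G = concat (map (\<lambda>i. ins_combo i G) [k..<n])"

text \<open>The totals by which leading coefficients are followed through the recursion.\<close>

definition coef_sum :: "((nat \<Rightarrow> nat) \<Rightarrow> bool) \<Rightarrow> combo \<Rightarrow> ratfun" where
  "coef_sum P G = (\<Sum>(c, \<eta>)\<leftarrow>G. if P \<eta> then c else 0)"

lemma bar_sum_simps [simp]:
  "bar_sum n [] = (\<lambda>p. 0)"
  "bar_sum n (x # G) = (\<lambda>p. fst x * bar n (snd x) p + bar_sum n G p)"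
  "bar_sum n (G @ H) = (\<lambda>p. bar_sum n G p + bar_sum n H p)"
  by (auto simp: bar_sum_def split: prod.splits)

lemma bar_sum_scale: "bar_sum n (scale_combo d G) = (\<lambda>p. d * bar_sum n G p)"
  by (induction G) (auto simp: scale_combo_def algebra_simps)

lemma bar_sum_concat: "bar_sum n (concat Gs) p = (\<Sum>G\<leftarrow>Gs. bar_sum n G p)"
  by (induction Gs) auto

lemma combo_ok_simps [simp]:
  "combo_ok n s []"
  "combo_ok n s (x # G) \<longleftrightarrow> fst x \<in> nat_polys_in_alpha \<and> snd x \<in> comps n \<and> csize n (snd x) = s \<and> combo_ok n s G"
  "combo_ok n s (G @ H) \<longleftrightarrow> combo_ok n s G \<and> combo_ok n s H"
  by (auto simp: combo_ok_def)

lemma combo_ok_ins: "combo_ok n s G \<Longrightarrow> i < n \<Longrightarrow> combo_ok n (Suc s) (ins_combo i G)"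
  by (induction G) (auto simp: ins_combo_def)

lemma combo_ok_scale: "combo_ok n s G \<Longrightarrow> d \<in> nat_polys_in_alpha \<Longrightarrow> combo_ok n s (scale_combo d G)"
  by (induction G) (auto simp: scale_combo_def nat_polys_mult)

lemma combo_ok_sum: "combo_ok n s G \<Longrightarrow> combo_ok n (Suc s) (sum_combo k n G)"
  using combo_ok_ins[of n s G] by (force simp: sum_combo_def combo_ok_def)

lemma bar_sum_ins:
  assumes "combo_ok n s G" "i < n"
  shows "bar_sum n (ins_combo i G) = insert_op n i (bar_sum n G)"
  using assms(1)
proof (induction G)
  case Nil
  then show ?case by (simp add: ins_combo_def insert_op_zero)
next
  case (Cons x G)
  then show ?case using assms(2)
    by (simp add: ins_combo_def insert_op_add insert_op_cmult insert_bar split: prod.split)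
qed

lemma bar_sum_sum:
  assumes "combo_ok n s G"
  shows "bar_sum n (sum_combo k n G) = (\<lambda>p. \<Sum>i\<in>{k..<n}. insert_op n i (bar_sum n G) p)"
proof
  fix p
  have "bar_sum n (sum_combo k n G) p = (\<Sum>i\<leftarrow>[k..<n]. bar_sum n (ins_combo i G) p)"
    by (simp add: sum_combo_def bar_sum_concat comp_def)
  also have "\<dots> = (\<Sum>i\<in>{k..<n}. bar_sum n (ins_combo i G) p)"
    by (simp add: interv_sum_list_conv_sum_set_nat)
  also have "\<dots> = (\<Sum>i\<in>{k..<n}. insert_op n i (bar_sum n G) p)"
    by (intro sum.cong) (auto simp: bar_sum_ins[OF assms])
  finally show "bar_sum n (sum_combo k n G) p = (\<Sum>i\<in>{k..<n}. insert_op n i (bar_sum n G) p)" .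
qed

lemma coef_sum_simps [simp]:
  "coef_sum P [] = 0"
  "coef_sum P (x # G) = (if P (snd x) then fst x else 0) + coef_sum P G"
  "coef_sum P (G @ H) = coef_sum P G + coef_sum P H"
  by (auto simp: coef_sum_def split: prod.splits)

lemma coef_sum_scale: "coef_sum P (scale_combo d G) = d * coef_sum P G"
  by (induction G) (auto simp: scale_combo_def algebra_simps)

lemma coef_sum_ins: "coef_sum P (ins_combo i G) = coef_sum (\<lambda>\<eta>. P (insE i \<eta>)) G"
  by (induction G) (auto simp: ins_combo_def)

lemma coef_sum_concat: "coef_sum P (concat Gs) = (\<Sum>G\<leftarrow>Gs. coef_sum P G)"
  by (induction Gs) auto

lemma coef_sum_sum: "coef_sum P (sum_combo k n G) = (\<Sum>i\<in>{k..<n}. coef_sum (\<lambda>\<eta>. P (insE i \<eta>)) G)"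
  by (simp add: sum_combo_def coef_sum_concat comp_def coef_sum_ins interv_sum_list_conv_sum_set_nat)

lemma coef_sum_cong:
  assumes "\<And>c \<eta>. (c, \<eta>) \<in> set G \<Longrightarrow> P \<eta> = Q \<eta>"
  shows "coef_sum P G = coef_sum Q G"
  unfolding coef_sum_def using assms
  by (intro arg_cong[where f = sum_list] map_cong) (auto split: prod.splits)

lemma coef_sum_False: "coef_sum (\<lambda>_. False) G = 0"
  by (induction G) auto

lemma sig_insert_op_less:
  assumes "Suc j < i" "i < n"
  shows "sig j (insert_op n i f) = insert_op n i (sig (Suc j) f)"
  using assms by (simp add: insert_op_def sig_chain_far Phi_sig)

lemma sig_insert_op_greater:
  assumes "i < j" "Suc j < n"
  shows "sig j (insert_op n i f) = insert_op n i (sig j f)"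
proof -
  obtain l where "j = Suc l" "i \<le> l" using assms(1) by (metis Suc_le_eq less_eq_Suc_le less_imp_Suc_add le_add1 add_Suc)
  with assms show ?thesis by (simp add: insert_op_def sig_chain Phi_sig)
qed

lemma sig_insert_op:
  assumes "Suc i < n"
  shows "sig i (insert_op n (Suc i) f) = insert_op n i f" "sig i (insert_op n i f) = insert_op n (Suc i) f"
  using assms by (simp_all add: insert_op_def chain_Cons)

lemma sig_sum: "sig j (\<lambda>p. \<Sum>i\<in>A. g i p) = (\<lambda>p. \<Sum>i\<in>A. sig j (g i) p)"
  by (simp add: sig_def fun_eq_iff sum_distrib_left sum_subtractf sum_divide_distrib)

text \<open>\<open>sig j\<close> exchanges the insertions at \<open>j\<close> and
  \<open>Suc j\<close>. Past any other insertion it reaches \<open>f\<close> as \<open>sig j\<close>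
  or \<open>sig (Suc j)\<close>, in both cases with an index above \<open>k\<close>.\<close>

lemma sig_sum_insert_op:
  assumes f: "\<And>j. k < j \<Longrightarrow> Suc j < n \<Longrightarrow> sig j f = f" and j: "k \<le> j" "Suc j < n"
  shows "sig j (\<lambda>p. \<Sum>i\<in>{k..<n}. insert_op n i f p) = (\<lambda>p. \<Sum>i\<in>{k..<n}. insert_op n i f p)"
proof
  fix p
  have "sig j (insert_op n i f) = insert_op n (transpose j (Suc j) i) f" if "i \<in> {k..<n}" for i
  proof -
    consider "i = j" | "i = Suc j" | "i < j" | "Suc j < i" by linarith
    then show ?thesis
      using that j sig_insert_op[of j n f] sig_insert_op_less[of j i n f] sig_insert_op_greater[of i j n f]
        f[of j] f[of "Suc j"] by cases auto
  qed
  then have "sig j (\<lambda>p. \<Sum>i\<in>{k..<n}. insert_op n i f p) p =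
    (\<Sum>i\<in>{k..<n}. insert_op n (transpose j (Suc j) i) f p)"
    by (simp add: sig_sum)
  also have "\<dots> = (\<Sum>i\<in>{k..<n}. insert_op n i f p)"
    by (rule sum.permute[unfolded comp_def, symmetric]) (use j in \<open>intro permutes_swap_id; auto\<close>)
  finally show "sig j (\<lambda>p. \<Sum>i\<in>{k..<n}. insert_op n i f p) p = (\<Sum>i\<in>{k..<n}. insert_op n i f p)" .
qed

section \<open>Rearrangement classes, hook products and multiplicities when a column is
  added\<close>

definition ms :: "nat \<Rightarrow> (nat \<Rightarrow> nat) \<Rightarrow> nat multiset" where
  "ms n \<theta> = image_mset \<theta> (mset_set {..<n})"

definition add_col :: "nat \<Rightarrow> (nat \<Rightarrow> nat) \<Rightarrow> nat \<Rightarrow> nat" where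
  "add_col k \<theta> = (\<lambda>j. \<theta> j + (if j < k then 1 else 0))"

lemma count_ms: "count (ms n \<theta>) k = card {i. i < n \<and> \<theta> i = k}"
proof -
  have "count (image_mset \<theta> (mset_set A)) k = card {i \<in> A. \<theta> i = k}" if "finite A" for A
    using that
  proof (induction A rule: finite_induct)
    case (insert x A)
    have "{i \<in> insert x A. \<theta> i = k} = (if \<theta> x = k then insert x {i \<in> A. \<theta> i = k} else {i \<in> A. \<theta> i = k})"
      by auto
    with insert show ?case by simp
  qed simp
  from this[of "{..<n}"] show ?thesis by (simp add: ms_def)
qed

lemma ms_bij:
  assumes "bij_betw s {..<n} {..<n}" "\<And>j. j < n \<Longrightarrow> \<theta>' j = \<theta> (s j)"
  shows "ms n \<theta>' = ms n \<theta>"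
proof -
  have "ms n \<theta>' = image_mset (\<theta> \<circ> s) (mset_set {..<n})"
    unfolding ms_def using assms(2) by (intro image_mset_cong) auto
  also have "\<dots> = image_mset \<theta> (image_mset s (mset_set {..<n}))"
    by (simp add: multiset.map_comp)
  also have "image_mset s (mset_set {..<n}) = mset_set {..<n}"
    using assms(1) by (simp add: image_mset_mset_set bij_betw_def)
  finally show ?thesis by (simp add: ms_def)
qed

lemma ms_swapE: "Suc i < n \<Longrightarrow> ms n (swapE i \<nu>) = ms n \<nu>"
  by (rule ms_bij[of "transpose i (Suc i)"])
    (auto simp: swapE_def intro!: permutes_imp_bij permutes_swap_id)

text \<open>The insertion has raised one part itself and put it where it counts as done; the column
  of length \<open>k\<close> then raises the other \<open>k\<close> of the first
  \<open>Suc k\<close> parts, or, if \<open>i = k\<close>, exactly those moved forward.\<close>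

lemma ms_add_col_insE:
  assumes "k \<le> i" "i < n"
  shows "ms n (add_col k (insE i \<nu>)) = ms n (add_col (Suc k) \<nu>)"
  by (rule ms_bij[of "\<lambda>j. if j < i then Suc j else if j = i then 0 else j"],
      rule bij_betw_byWitness[where f' = "\<lambda>j. if j = 0 then i else if j \<le> i then j - 1 else j"])
    (use assms in \<open>auto simp: add_col_def insE_def\<close>)

lemma count_ms_add_col:
  assumes "\<And>i. i \<ge> m \<Longrightarrow> \<theta> i = 0" "m \<le> n"
  shows "count (ms n (add_col m \<theta>)) 0 = n - m"
    and "count (ms n \<theta>) k = count (ms n (add_col m \<theta>)) (Suc k) + (if k = 0 then n - m else 0)"
proof -
  have "{i. i < n \<and> add_col m \<theta> i = 0} = {m..<n}"
    using assms by (auto simp: add_col_def)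
  then show "count (ms n (add_col m \<theta>)) 0 = n - m" by (simp add: count_ms)
  have 1: "{i. i < n \<and> add_col m \<theta> i = Suc k} = {i. i < m \<and> \<theta> i = k}"
  proof (rule Collect_cong)
    show "i < n \<and> add_col m \<theta> i = Suc k \<longleftrightarrow> i < m \<and> \<theta> i = k" for i
      using assms by (cases "i < m") (auto simp: add_col_def)
  qed
  have 2: "{i. i < n \<and> \<theta> i = k} = {i. i < m \<and> \<theta> i = k} \<union> (if k = 0 then {m..<n} else {})"
  proof (rule set_eqI)
    show "i \<in> {i. i < n \<and> \<theta> i = k} \<longleftrightarrow> i \<in> {i. i < m \<and> \<theta> i = k} \<union> (if k = 0 then {m..<n} else {})" for i
      using assms by (cases "i < m") auto
  qed
  show "count (ms n \<theta>) k = count (ms n (add_col m \<theta>)) (Suc k) + (if k = 0 then n - m else 0)"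
    unfolding count_ms 1 2 by (subst card_Un_disjoint) auto
qed

text \<open>The column added to \<pi> leaves exactly \<open>n - m\<close> zeros. On the left, zeros
  can only occur from position \<open>m\<close> on, so they must fill all these positions.\<close>

lemma ms_add_col_eq_iff:
  assumes "\<nu> \<in> comps n" "\<And>i. i \<ge> m \<Longrightarrow> \<pi> i = 0" "m \<le> n"
  shows "ms n (add_col m \<nu>) = ms n (add_col m \<pi>) \<longleftrightarrow> ms n \<nu> = ms n \<pi> \<and> (\<forall>i\<ge>m. \<nu> i = 0)"
proof -
  have zero: "\<forall>i\<ge>m. \<nu> i = 0" if eq: "ms n (add_col m \<nu>) = ms n (add_col m \<pi>)"
  proof -
    have "card {i. i < n \<and> add_col m \<nu> i = 0} = card {m..<n}"
      using eq count_ms_add_col(1)[OF assms(2,3)] by (simp flip: count_ms)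
    moreover have "{i. i < n \<and> add_col m \<nu> i = 0} \<subseteq> {m..<n}"
      by (auto simp: add_col_def split: if_splits)
    ultimately have "{i. i < n \<and> add_col m \<nu> i = 0} = {m..<n}"
      by (intro card_subset_eq) auto
    then have "\<nu> i = 0" if "m \<le> i" "i < n" for i using that by (force simp: add_col_def)
    then show ?thesis using assms(1) by (auto simp: comps_def) (metis not_le)
  qed
  show ?thesis
  proof
    assume eq: "ms n (add_col m \<nu>) = ms n (add_col m \<pi>)"
    have "ms n \<nu> = ms n \<pi>"
      by (rule multiset_eqI)
        (use eq zero[OF eq] assms in \<open>simp add: count_ms_add_col(2)[of m \<nu>] count_ms_add_col(2)[of m \<pi>]\<close>)
    with zero[OF eq] show "ms n \<nu> = ms n \<pi> \<and> (\<forall>i\<ge>m. \<nu> i = 0)" by simp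
  next
    assume r: "ms n \<nu> = ms n \<pi> \<and> (\<forall>i\<ge>m. \<nu> i = 0)"
    show "ms n (add_col m \<nu>) = ms n (add_col m \<pi>)"
    proof (rule multiset_eqI)
      fix k
      show "count (ms n (add_col m \<nu>)) k = count (ms n (add_col m \<pi>)) k"
        using r assms count_ms_add_col(1)[of m \<nu> n] count_ms_add_col(1)[of m \<pi> n]
          count_ms_add_col(2)[of m \<nu> n "k - 1"] count_ms_add_col(2)[of m \<pi> n "k - 1"]
        by (cases k) auto
    qed
  qed
qed

definition parts :: "nat \<Rightarrow> nat \<Rightarrow> (nat \<Rightarrow> nat) \<Rightarrow> bool" where
  "parts n m \<rho> \<longleftrightarrow> m \<le> n \<and> (\<forall>i<m. \<rho> i > 0) \<and> (\<forall>i\<ge>m. \<rho> i = 0) \<and> (\<forall>i j. i \<le> j \<longrightarrow> \<rho> j \<le> \<rho> i)"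

lemma parts_exists:
  assumes "\<rho> \<in> comps n" "\<And>i j. i \<le> j \<Longrightarrow> \<rho> j \<le> \<rho> i"
  shows "\<exists>m. parts n m \<rho>"
proof -
  define m where "m = (LEAST i. \<rho> i = 0)"
  have "\<rho> n = 0" using assms(1) by (simp add: comps_def)
  then have "\<rho> m = 0" "m \<le> n" unfolding m_def by (auto intro: LeastI Least_le)
  moreover have "\<rho> i > 0" if "i < m" for i using not_less_Least[of i "\<lambda>i. \<rho> i = 0"] that by (simp add: m_def)
  moreover have "\<rho> i = 0" if "i \<ge> m" for i using assms(2)[OF that] \<open>\<rho> m = 0\<close> by simp
  ultimately show ?thesis using assms(2) by (auto simp: parts_def)
qed

definition hooks :: "nat \<Rightarrow> (nat \<Rightarrow> nat) \<Rightarrow> ratfun" where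
  "hooks n \<theta> = (\<Prod>i<n. \<Prod>j\<in>{1..\<theta> i}. alpha * of_nat (\<theta> i - j) + of_nat (card {k. i < k \<and> k < n \<and> j \<le> \<theta> k}) + 1)"

text \<open>The box in row \<open>i\<close> of the new first column has arm \<open>\<rho> i\<close>
  and leg \<open>M - i - 1\<close>; every other box is one of \<rho>, moved one column to the right
  with the same arm and leg.\<close>

lemma hooks_add_col:
  assumes "parts n m \<rho>" "m \<le> M" "M \<le> n"
  shows "hooks n (add_col M \<rho>) = (\<Prod>i<M. alpha * of_nat (\<rho> i) + of_nat (M - i)) * hooks n \<rho>"
proof -
  define h where "h \<theta> i j = alpha * of_nat (\<theta> i - j) + of_nat (card {k. i < k \<and> k < n \<and> j \<le> \<theta> k}) + 1" for \<theta> i j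
  have zero: "\<rho> k = 0" if "k \<ge> M" for k using assms that by (auto simp: parts_def)
  have "(\<Prod>j\<in>{1..add_col M \<rho> i}. h (add_col M \<rho>) i j) =
    (if i < M then alpha * of_nat (\<rho> i) + of_nat (M - i) else 1) * (\<Prod>j\<in>{1..\<rho> i}. h \<rho> i j)" if "i < n" for i
  proof (cases "i < M")
    case True
    have "{k. i < k \<and> k < n \<and> Suc 0 \<le> add_col M \<rho> k} = {i<..<M}"
    proof (rule set_eqI)
      show "k \<in> {k. i < k \<and> k < n \<and> Suc 0 \<le> add_col M \<rho> k} \<longleftrightarrow> k \<in> {i<..<M}" for k
        using assms zero[of k] by (cases "k < M") (auto simp: add_col_def)
    qed
    then have "h (add_col M \<rho>) i 1 = alpha * of_nat (\<rho> i) + (of_nat (M - Suc i) + 1)"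
      using True by (simp add: h_def add_col_def)
    also have "of_nat (M - Suc i) + 1 = (of_nat (M - i) :: ratfun)"
      using True by (metis Suc_diff_Suc of_nat_Suc add.commute)
    finally have first: "h (add_col M \<rho>) i 1 = alpha * of_nat (\<rho> i) + of_nat (M - i)" .
    have rest: "h (add_col M \<rho>) i (Suc j) = h \<rho> i j" if "j \<in> {1..\<rho> i}" for j
    proof -
      have "{k. i < k \<and> k < n \<and> Suc j \<le> add_col M \<rho> k} = {k. i < k \<and> k < n \<and> j \<le> \<rho> k}"
      proof (rule Collect_cong)
        show "i < k \<and> k < n \<and> Suc j \<le> add_col M \<rho> k \<longleftrightarrow> i < k \<and> k < n \<and> j \<le> \<rho> k" for k
          using that zero[of k] by (cases "k < M") (auto simp: add_col_def)
      qed
      then show ?thesis using True by (simp add: h_def add_col_def)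
    qed
    have "(\<Prod>j\<in>{1..Suc (\<rho> i)}. h (add_col M \<rho>) i j) = h (add_col M \<rho>) i 1 * (\<Prod>j\<in>{Suc 1..Suc (\<rho> i)}. h (add_col M \<rho>) i j)"
      by (rule prod.atLeast_Suc_atMost) simp
    also have "(\<Prod>j\<in>{Suc 1..Suc (\<rho> i)}. h (add_col M \<rho>) i j) = (\<Prod>j\<in>{1..\<rho> i}. h (add_col M \<rho>) i (Suc j))"
      by (rule prod.shift_bounds_cl_Suc_ivl)
    also have "\<dots> = (\<Prod>j\<in>{1..\<rho> i}. h \<rho> i j)"
      by (intro prod.cong) (auto simp: rest)
    finally show ?thesis using True first by (simp add: add_col_def)
  next
    case False
    then show ?thesis using zero[of i] by (simp add: add_col_def)
  qed
  then have "hooks n (add_col M \<rho>) = (\<Prod>i<n. if i < M then alpha * of_nat (\<rho> i) + of_nat (M - i) else 1) * hooks n \<rho>"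
    unfolding hooks_def h_def[symmetric] prod.distrib[symmetric] by (intro prod.cong) auto
  also have "(\<Prod>i<n. if i < M then alpha * of_nat (\<rho> i) + of_nat (M - i) else 1) = (\<Prod>i<M. alpha * of_nat (\<rho> i) + of_nat (M - i))"
    using assms(3) by (intro prod.mono_neutral_cong_right) auto
  finally show ?thesis .
qed

text \<open>The part 0 is left out; its factorial appears separately in
  \<open>card_rearrangements\<close>.\<close>

definition mults :: "nat \<Rightarrow> (nat \<Rightarrow> nat) \<Rightarrow> nat" where
  "mults n \<theta> = (\<Prod>k\<in>{1..csize n \<theta>}. fact (count (ms n \<theta>) k))"

lemma count_ms_large:
  assumes "csize n \<theta> < k"
  shows "count (ms n \<theta>) k = 0"
proof -
  have "\<theta> i \<le> csize n \<theta>" if "i < n" for i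
    unfolding csize_def using that by (intro member_le_sum) auto
  with assms have "{i. i < n \<and> \<theta> i = k} = {}" by force
  then show ?thesis by (simp only: count_ms card.empty)
qed

lemma mults_eq: "csize n \<theta> \<le> K \<Longrightarrow> mults n \<theta> = (\<Prod>k\<in>{1..K}. fact (count (ms n \<theta>) k))"
  unfolding mults_def by (rule prod.mono_neutral_left) (auto simp: count_ms_large)

lemma csize_add_col: "M \<le> n \<Longrightarrow> csize n (add_col M \<rho>) = csize n \<rho> + M"
proof -
  assume "M \<le> n"
  then have "(\<Sum>i<n. if i < M then 1 else 0) = (\<Sum>i<M. 1 :: nat)"
    by (intro sum.mono_neutral_cong_right) auto
  then show ?thesis by (simp add: csize_def add_col_def sum.distrib)
qed

text \<open>All multiplicities move up by one, and the new part 1 occurs at the \<open>M - m\<close>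
  positions where \<rho> was 0.\<close>

lemma mults_add_col:
  assumes "parts n m \<rho>" "m \<le> M" "M \<le> n"
  shows "mults n (add_col M \<rho>) = fact (M - m) * mults n \<rho>"
proof -
  have zero: "\<rho> k = 0" if "k \<ge> m" for k using assms that by (auto simp: parts_def)
  have pos: "\<rho> k \<noteq> 0" if "k < m" for k using assms that by (auto simp: parts_def)
  have c: "count (ms n (add_col M \<rho>)) (Suc k) = (if k = 0 then M - m else count (ms n \<rho>) k)" for k
  proof (cases "k = 0")
    case True
    have "{i. i < n \<and> add_col M \<rho> i = Suc 0} = {m..<M}"
    proof (rule set_eqI)
      show "i \<in> {i. i < n \<and> add_col M \<rho> i = Suc 0} \<longleftrightarrow> i \<in> {m..<M}" for i
        using assms zero[of i] pos[of i] by (cases "i < m") (auto simp: add_col_def)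
    qed
    then show ?thesis using True by (simp add: count_ms)
  next
    case False
    then show ?thesis
      using count_ms_add_col(2)[of M \<rho> n k] zero assms by simp
  qed
  define K where "K = csize n \<rho> + M"
  have "mults n (add_col M \<rho>) = (\<Prod>k\<in>{1..Suc K}. fact (count (ms n (add_col M \<rho>)) k))"
    using assms by (intro mults_eq) (simp add: csize_add_col K_def)
  also have "\<dots> = fact (count (ms n (add_col M \<rho>)) 1) * (\<Prod>k\<in>{Suc 1..Suc K}. fact (count (ms n (add_col M \<rho>)) k))"
    by (rule prod.atLeast_Suc_atMost) simp
  also have "(\<Prod>k\<in>{Suc 1..Suc K}. fact (count (ms n (add_col M \<rho>)) k)) = (\<Prod>k\<in>{1..K}. fact (count (ms n (add_col M \<rho>)) (Suc k)))"
    by (rule prod.shift_bounds_cl_Suc_ivl)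
  also have "\<dots> = (\<Prod>k\<in>{1..K}. fact (count (ms n \<rho>) k))"
    by (intro prod.cong) (auto simp: c)
  also have "\<dots> = mults n \<rho>" by (rule mults_eq[symmetric]) (simp add: K_def)
  finally show ?thesis using c[of 0] by simp
qed

lemma card_rearrangements:
  assumes "parts n m \<rho>"
  shows "card (permutations_of_multiset (ms n \<rho>)) * (fact (n - m) * mults n \<rho>) = fact n"
proof -
  have z: "count (ms n \<rho>) 0 = n - m"
  proof -
    have "{i. i < n \<and> \<rho> i = 0} = {m..<n}"
    proof (rule set_eqI)
      show "i \<in> {i. i < n \<and> \<rho> i = 0} \<longleftrightarrow> i \<in> {m..<n}" for i
        using assms by (cases "i < m") (auto simp: parts_def)
    qed
    then show ?thesis by (simp add: count_ms)
  qed
  have "(\<Prod>x\<in>set_mset (ms n \<rho>). fact (count (ms n \<rho>) x)) = (\<Prod>x\<in>{0..csize n \<rho>}. fact (count (ms n \<rho>) x) :: nat)"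
  proof (intro prod.mono_neutral_left ballI)
    show "set_mset (ms n \<rho>) \<subseteq> {0..csize n \<rho>}"
      using count_ms_large[of n \<rho>] by (auto simp flip: count_greater_zero_iff) (metis not_le less_irrefl)
  qed (auto simp: not_in_iff)
  also have "\<dots> = fact (n - m) * mults n \<rho>"
    by (subst prod.atLeast_Suc_atMost) (simp_all add: mults_def z)
  finally have "(\<Prod>x\<in>set_mset (ms n \<rho>). fact (count (ms n \<rho>) x)) = fact (n - m) * mults n \<rho>" .
  then show ?thesis
    using card_permutations_of_multiset[of "ms n \<rho>"] by (simp add: ms_def)
qed

section \<open>Adding the columns of a partition\<close>

text \<open>\<open>partial_col m s \<pi>\<close> is \<open>\<pi>\<close> after its first \<open>s\<close> parts have been raised and moved behind the others.\<close>
definition partial_col :: "nat \<Rightarrow> nat \<Rightarrow> (nat \<Rightarrow> nat) \<Rightarrow> nat \<Rightarrow> nat" where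
  "partial_col m s \<pi> = (\<lambda>j. if j < m - s then \<pi> (j + s) else if j < m then Suc (\<pi> (j - (m - s))) else 0)"

lemma partial_col_0: "(\<And>i. i \<ge> m \<Longrightarrow> \<pi> i = 0) \<Longrightarrow> partial_col m 0 \<pi> = \<pi>"
  by (auto simp: partial_col_def fun_eq_iff)

lemma partial_col_m: "(\<And>i. i \<ge> m \<Longrightarrow> \<pi> i = 0) \<Longrightarrow> partial_col m m \<pi> = add_col m \<pi>"
  by (auto simp: partial_col_def add_col_def fun_eq_iff)

lemma insE_partial_col: "s < m \<Longrightarrow> insE (m - 1) (partial_col m s \<pi>) = partial_col m (Suc s) \<pi>"
  by (auto simp: partial_col_def insE_def fun_eq_iff Suc_diff_Suc)

text \<open>\<open>k\<close> counts the raises still to come, and \<open>T\<close> is the class to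
  be reached by them. The bound \<open>M\<close> prepares the next column: by
  \<open>ms_add_col_eq_iff\<close> only labels inside its positions can contribute to the next
  class.\<close>

definition col_cond :: "nat \<Rightarrow> nat \<Rightarrow> nat \<Rightarrow> nat multiset \<Rightarrow> (nat \<Rightarrow> nat) \<Rightarrow> bool" where
  "col_cond n M k T \<nu> \<longleftrightarrow> ms n (add_col k \<nu>) = T \<and> (\<forall>j\<ge>M. \<nu> j = 0)"

lemma col_cond_insE:
  assumes "k \<le> i" "i < n"
  shows "col_cond n M k T (insE i \<nu>) \<longleftrightarrow> i < M \<and> col_cond n M (Suc k) T \<nu>"
proof -
  have "(\<forall>j\<ge>M. insE i \<nu> j = 0) \<longleftrightarrow> i < M \<and> (\<forall>j\<ge>M. \<nu> j = 0)"
  proof (cases "i < M")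
    case True
    then have eq: "insE i \<nu> j = \<nu> j" if "M \<le> j" for j using that by (simp add: insE_def)
    have "(\<forall>j\<ge>M. insE i \<nu> j = 0) \<longleftrightarrow> (\<forall>j\<ge>M. \<nu> j = 0)" using eq by metis
    with True show ?thesis by simp
  next
    case False
    have "insE i \<nu> i \<noteq> 0" by (simp add: insE_def)
    moreover have "M \<le> i" using False by simp
    ultimately have "\<exists>j\<ge>M. insE i \<nu> j \<noteq> 0" by (intro exI[of _ i]) simp
    with False show ?thesis by simp
  qed
  then show ?thesis unfolding col_cond_def ms_add_col_insE[OF assms] by metis
qed

text \<open>Applies \<open>knop_sahi_step\<close> once for each of the first \<open>s\<close> parts.
  The count in its factor is \<open>m - 1 - s\<close> at stage \<open>s\<close>, and the sum
  contributes one for each insertion position from \<open>m - 1\<close> to \<open>M - 1\<close>;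
  together they give \<open>M - s\<close>.\<close>

lemma column_step:
  fixes \<pi> :: "nat \<Rightarrow> nat"
  assumes dec: "\<And>i j. i \<le> j \<Longrightarrow> \<pi> j \<le> \<pi> i" and zero: "\<And>i. i \<ge> m \<Longrightarrow> \<pi> i = 0" and m: "m \<le> n"
    and G: "combo_ok n (csize n \<pi>) G" "supported n (csize n \<pi>) {\<pi>} (bar_sum n G)"
      "\<And>j. m \<le> j \<Longrightarrow> Suc j < n \<Longrightarrow> sig j (bar_sum n G) = bar_sum n G"
    and s: "s \<le> m"
  shows "\<exists>H. combo_ok n (csize n \<pi> + s) H \<and>
      supported n (csize n \<pi> + s) {partial_col m s \<pi>} (bar_sum n H) \<and>
      (\<forall>j. m \<le> j \<longrightarrow> Suc j < n \<longrightarrow> sig j (bar_sum n H) = bar_sum n H) \<and>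
      (\<forall>M T. m \<le> M \<longrightarrow> M \<le> n \<longrightarrow> coef_sum (col_cond n M (m - s) T) H =
        (\<Prod>i<s. alpha * of_nat (Suc (\<pi> i)) + of_nat (M - i)) * coef_sum (col_cond n M m T) G)"
  using s
proof (induction s)
  case 0
  show ?case
    using G by (intro exI[of _ G]) (auto simp: partial_col_0 zero)
next
  case (Suc s)
  define \<eta> where "\<eta> = partial_col m s \<pi>"
  from Suc obtain H where H: "combo_ok n (csize n \<pi> + s) H"
      "supported n (csize n \<pi> + s) {\<eta>} (bar_sum n H)"
      "\<And>j. m \<le> j \<Longrightarrow> Suc j < n \<Longrightarrow> sig j (bar_sum n H) = bar_sum n H"
      "\<And>M T. m \<le> M \<Longrightarrow> M \<le> n \<Longrightarrow> coef_sum (col_cond n M (m - s) T) H =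
        (\<Prod>i<s. alpha * of_nat (Suc (\<pi> i)) + of_nat (M - i)) * coef_sum (col_cond n M m T) G"
    unfolding \<eta>_def by auto
  have sm: "s < m" and mn: "m > 0" using Suc.prems by auto
  have \<eta>: "\<eta> \<in> comps n" "\<And>j. j \<ge> m \<Longrightarrow> \<eta> j = 0"
    using m by (auto simp: \<eta>_def partial_col_def comps_def)
  have "csize n (partial_col m s' \<pi>) = csize n \<pi> + s'" if "s' \<le> m" for s'
    using that
  proof (induction s')
    case 0
    then show ?case by (simp add: partial_col_0 zero)
  next
    case (Suc s')
    then have "s' < m" "m - 1 < n" using m by auto
    then have "csize n (partial_col m (Suc s') \<pi>) = Suc (csize n (partial_col m s' \<pi>))"
      by (metis insE_partial_col csize_insE)
    then show ?case using Suc by simp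
  qed
  then have size: "csize n \<eta> = csize n \<pi> + s" using sm by (simp add: \<eta>_def)
  have \<eta>0: "\<eta> 0 = \<pi> s" using sm by (simp add: \<eta>_def partial_col_def)
  \<comment> \<open>The parts still to be raised are at most \<open>\<pi> s\<close>, whereas the
    \<open>s\<close> parts already raised exceed it.\<close>
  have "{j. j < m - 1 \<and> \<eta> (Suc j) \<le> \<eta> 0} = {..<m - 1 - s}"
  proof (rule set_eqI)
    fix j
    show "j \<in> {j. j < m - 1 \<and> \<eta> (Suc j) \<le> \<eta> 0} \<longleftrightarrow> j \<in> {..<m - 1 - s}"
    proof (cases "j < m - 1 - s")
      case True
      then have "Suc j < m - s" "Suc j < m" by arith+
      then have "\<eta> (Suc j) = \<pi> (Suc j + s)" by (simp add: \<eta>_def partial_col_def)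
      then show ?thesis using True dec[of s "Suc j + s"] by (simp add: \<eta>0)
    next
      case False
      have "\<eta> (Suc j) > \<eta> 0" if "j < m - 1"
      proof -
        have "\<not> Suc j < m - s" "Suc j < m" using that False by arith+
        then have "\<eta> (Suc j) = Suc (\<pi> (Suc j - (m - s)))" by (simp add: \<eta>_def partial_col_def)
        moreover have "Suc j - (m - s) \<le> s" using that by simp
        ultimately show ?thesis using dec[of "Suc j - (m - s)" s] by (simp add: \<eta>0)
      qed
      then show ?thesis using False by force
    qed
  qed
  then have card: "card {j. j < m - 1 \<and> \<eta> (Suc j) \<le> \<eta> 0} = m - 1 - s" by simp
  define c where "c = alpha * of_nat (Suc (\<pi> s)) + of_nat (m - 1 - s)"
  define K where "K = scale_combo c (ins_combo (m - 1) H) @ sum_combo (m - 1) n H"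
  have K: "bar_sum n K = (\<lambda>p. c * insert_op n (m - 1) (bar_sum n H) p + (\<Sum>i\<in>{m - 1..<n}. insert_op n i (bar_sum n H) p))"
    using mn m by (simp add: K_def bar_sum_scale bar_sum_ins[OF H(1)] bar_sum_sum[OF H(1)])
  have "c \<in> nat_polys_in_alpha" unfolding c_def by (intro nat_polys_intros)
  then have "combo_ok n (csize n \<pi> + Suc s) K"
    using combo_ok_ins[OF H(1), of "m - 1"] combo_ok_sum[OF H(1)] mn m
    by (simp add: K_def combo_ok_scale)
  moreover have "supported n (csize n \<pi> + Suc s) {partial_col m (Suc s) \<pi>} (bar_sum n K)"
    using knop_sahi_step[OF \<eta> mn m, of "bar_sum n H"] H(2) insE_partial_col[OF sm, of \<pi>] card
    by (simp add: size K c_def \<eta>0 \<eta>_def[symmetric])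
  moreover have "sig j (bar_sum n K) = bar_sum n K" if j: "m \<le> j" "Suc j < n" for j
  proof -
    have lin: "sig j (\<lambda>p. c * f p + g p) = (\<lambda>p. c * sig j f p + sig j g p)" for f g
      by (simp add: sig_def fun_eq_iff algebra_simps add_divide_distrib)
    have "sig j (\<lambda>p. \<Sum>i\<in>{m - 1..<n}. insert_op n i (bar_sum n H) p) = (\<lambda>p. \<Sum>i\<in>{m - 1..<n}. insert_op n i (bar_sum n H) p)"
      using H(3) j by (intro sig_sum_insert_op) auto
    moreover have "sig j (insert_op n (m - 1) (bar_sum n H)) = insert_op n (m - 1) (bar_sum n H)"
      using H(3) j mn by (subst sig_insert_op_greater) auto
    ultimately show ?thesis unfolding K lin by simp
  qed
  moreover have "coef_sum (col_cond n M (m - Suc s) T) K =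
      (\<Prod>i<Suc s. alpha * of_nat (Suc (\<pi> i)) + of_nat (M - i)) * coef_sum (col_cond n M m T) G"
    if M: "m \<le> M" "M \<le> n" for M T
  proof -
    have cc: "coef_sum (\<lambda>\<nu>. col_cond n M (m - Suc s) T (insE i \<nu>)) H =
        (if i < M then coef_sum (col_cond n M (m - s) T) H else 0)" if "m - 1 \<le> i" "i < n" for i
    proof -
      have "m - Suc s \<le> i" "Suc (m - Suc s) = m - s" using that sm by auto
      then show ?thesis using that by (simp add: col_cond_insE coef_sum_False)
    qed
    have "(\<Sum>i\<in>{m - 1..<n}. coef_sum (\<lambda>\<nu>. col_cond n M (m - Suc s) T (insE i \<nu>)) H)
      = (\<Sum>i\<in>{m - 1..<n}. if i < M then coef_sum (col_cond n M (m - s) T) H else 0)"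
      by (intro sum.cong) (auto simp: cc)
    also have "\<dots> = (\<Sum>i\<in>{m - 1..<M}. coef_sum (col_cond n M (m - s) T) H)"
      using M by (intro sum.mono_neutral_cong_right) auto
    finally have "coef_sum (col_cond n M (m - Suc s) T) K =
      (c + of_nat (M - (m - 1))) * coef_sum (col_cond n M (m - s) T) H"
      using cc[of "m - 1"] M mn
      by (simp add: K_def coef_sum_scale coef_sum_ins coef_sum_sum distrib_right)
    also have "c + of_nat (M - (m - 1)) = alpha * of_nat (Suc (\<pi> s)) + of_nat (M - s)"
    proof -
      have "m - 1 - s + (M - (m - 1)) = M - s" using M sm by simp
      then show ?thesis by (simp only: c_def add.assoc flip: of_nat_add)
    qed
    finally show ?thesis by (simp add: H(4)[OF M])
  qed
  ultimately show ?case by blast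
qed

text \<open>The induction strips off the first column, so the columns are added starting with the
  last one. The identity looks one column of length \<open>M\<close> ahead: only labels inside its
  positions matter later, and their total already accounts for the hook factors of that column.
  Stating it for \<rho> alone would not give an induction.\<close>

lemma knop_sahi:
  assumes "parts n m \<rho>"
  shows "\<exists>G. combo_ok n (csize n \<rho>) G \<and> supported n (csize n \<rho>) {\<rho>} (bar_sum n G) \<and>
    (\<forall>j. m \<le> j \<longrightarrow> Suc j < n \<longrightarrow> sig j (bar_sum n G) = bar_sum n G) \<and>
    (\<forall>M. m \<le> M \<longrightarrow> M \<le> n \<longrightarrow>
      coef_sum (col_cond n M 0 (ms n \<rho>)) G * of_nat (mults n (add_col M \<rho>)) = hooks n (add_col M \<rho>))"
  using assms
proof (induction "csize n \<rho>" arbitrary: \<rho> m rule: less_induct)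
  case less
  have mn: "m \<le> n" and pos: "\<And>i. i < m \<Longrightarrow> \<rho> i > 0" and zero: "\<And>i. i \<ge> m \<Longrightarrow> \<rho> i = 0"
    and dec: "\<And>i j. i \<le> j \<Longrightarrow> \<rho> j \<le> \<rho> i"
    using less.prems by (auto simp: parts_def)
  show ?case
  proof (cases "m = 0")
    case True
    then have \<rho>: "\<rho> = (\<lambda>_. 0)" using zero by auto
    have fact: "(\<Prod>i<M. of_nat (M - i)) = (of_nat (fact M) :: ratfun)" for M
    proof (induction M)
      case (Suc M)
      have "(\<Prod>i<Suc M. of_nat (Suc M - i)) = (of_nat (Suc M) :: ratfun) * (\<Prod>i<M. of_nat (M - i))"
        by (simp add: prod.lessThan_Suc_shift del: prod.lessThan_Suc of_nat_diff of_nat_Suc)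
      also have "\<dots> = of_nat (fact (Suc M))" unfolding Suc by (simp add: distrib_right)
      finally show ?case .
    qed simp
    have "coef_sum (col_cond n M 0 (ms n \<rho>)) [(1, \<rho>)] * of_nat (mults n (add_col M \<rho>)) = hooks n (add_col M \<rho>)"
      if "M \<le> n" for M
    proof -
      have "col_cond n M 0 (ms n \<rho>) \<rho>" by (simp add: col_cond_def add_col_def \<rho>)
      moreover have "mults n \<rho> = 1" "hooks n \<rho> = 1" by (simp_all add: \<rho> mults_def hooks_def)
      ultimately show ?thesis
        using hooks_add_col[OF less.prems, of M] mults_add_col[OF less.prems, of M] that True
        by (simp add: \<rho> fact del: of_nat_diff of_nat_fact)
    qed
    then show ?thesis
      using \<rho> by (intro exI[of _ "[(1, \<rho>)]"]) (auto simp: nat_polys_1 supported_def csize_eq_0)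
  next
    case False
    define \<pi> where "\<pi> = (\<lambda>j. \<rho> j - 1)"
    have \<pi>: "\<pi> \<in> comps n" "\<And>i j. i \<le> j \<Longrightarrow> \<pi> j \<le> \<pi> i" "\<And>i. i \<ge> m \<Longrightarrow> \<pi> i = 0"
      using dec zero mn by (auto simp: \<pi>_def comps_def intro: diff_le_mono)
    have \<rho>: "\<rho> = add_col m \<pi>"
    proof
      show "\<rho> i = add_col m \<pi> i" for i using pos[of i] zero[of i] by (cases "i < m") (auto simp: \<pi>_def add_col_def)
    qed
    have size: "csize n \<rho> = csize n \<pi> + m" unfolding \<rho> by (rule csize_add_col[OF mn])
    obtain m' where m': "parts n m' \<pi>" using parts_exists[OF \<pi>(1,2)] by blast
    have "m' \<le> m"
    proof (rule ccontr)
      assume "\<not> m' \<le> m"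
      then have "\<pi> m > 0" using m' by (simp add: parts_def)
      then show False using \<pi>(3)[of m] by simp
    qed
    from less.hyps[OF _ m'] size False obtain G where G: "combo_ok n (csize n \<pi>) G"
        "supported n (csize n \<pi>) {\<pi>} (bar_sum n G)"
        "\<And>j. m' \<le> j \<Longrightarrow> Suc j < n \<Longrightarrow> sig j (bar_sum n G) = bar_sum n G"
        "\<And>M. m' \<le> M \<Longrightarrow> M \<le> n \<Longrightarrow>
          coef_sum (col_cond n M 0 (ms n \<pi>)) G * of_nat (mults n (add_col M \<pi>)) = hooks n (add_col M \<pi>)"
      by auto
    have inv: "sig j (bar_sum n G) = bar_sum n G" if "m \<le> j" "Suc j < n" for j
      using G(3) that \<open>m' \<le> m\<close> by auto
    obtain H where H: "combo_ok n (csize n \<pi> + m) H"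
        "supported n (csize n \<pi> + m) {partial_col m m \<pi>} (bar_sum n H)"
        "\<And>j. m \<le> j \<Longrightarrow> Suc j < n \<Longrightarrow> sig j (bar_sum n H) = bar_sum n H"
        "\<And>M T. m \<le> M \<Longrightarrow> M \<le> n \<Longrightarrow> coef_sum (col_cond n M (m - m) T) H =
          (\<Prod>i<m. alpha * of_nat (Suc (\<pi> i)) + of_nat (M - i)) * coef_sum (col_cond n M m T) G"
      using column_step[OF \<pi>(2,3) mn G(1,2) inv order_refl] by auto
    have "coef_sum (col_cond n M 0 (ms n \<rho>)) H * of_nat (mults n (add_col M \<rho>)) = hooks n (add_col M \<rho>)"
      if M: "m \<le> M" "M \<le> n" for M
    proof -
      \<comment> \<open>Labels that reach the class of \<rho> vanish from \<open>m\<close> on, so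
        the bound \<open>M\<close> tightens to \<open>m\<close> and the induction hypothesis is used
        at the length of the column just added.\<close>
      have "coef_sum (col_cond n M m (ms n \<rho>)) G = coef_sum (col_cond n m 0 (ms n \<pi>)) G"
      proof (rule coef_sum_cong)
        fix c \<nu> assume "(c, \<nu>) \<in> set G"
        then have "\<nu> \<in> comps n" using G(1) by (auto simp: combo_ok_def)
        from ms_add_col_eq_iff[OF this \<pi>(3) mn]
        show "col_cond n M m (ms n \<rho>) \<nu> = col_cond n m 0 (ms n \<pi>) \<nu>"
          using M by (auto simp: col_cond_def \<rho> add_col_def)
      qed
      then have "coef_sum (col_cond n M 0 (ms n \<rho>)) H * of_nat (mults n (add_col M \<rho>)) =
        (\<Prod>i<m. alpha * of_nat (Suc (\<pi> i)) + of_nat (M - i)) * of_nat (fact (M - m))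
         * (coef_sum (col_cond n m 0 (ms n \<pi>)) G * of_nat (mults n (add_col m \<pi>)))"
        using H(4)[OF M, of "ms n \<rho>"] mults_add_col[OF less.prems M] by (simp add: \<rho>)
      also have "\<dots> = (\<Prod>i<m. alpha * of_nat (Suc (\<pi> i)) + of_nat (M - i)) * of_nat (fact (M - m)) * hooks n \<rho>"
        using G(4)[OF \<open>m' \<le> m\<close> mn] by (simp add: \<rho>)
      also have "(\<Prod>i<m. alpha * of_nat (Suc (\<pi> i)) + of_nat (M - i)) = (\<Prod>i<m. alpha * of_nat (\<rho> i) + of_nat (M - i))"
        by (intro prod.cong) (auto simp: \<rho> add_col_def)
      \<comment> \<open>Parts from \<open>m\<close> on are 0, so their hook factors are integers;
        the factorial from the multiplicities supplies them.\<close>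
      also have "of_nat (fact (M - m)) = (\<Prod>i\<in>{m..<M}. alpha * of_nat (\<rho> i) + of_nat (M - i))"
      proof -
        have "(\<Prod>i\<in>{M - k..<M}. alpha * of_nat (\<rho> i) + of_nat (M - i)) = (of_nat (fact k) :: ratfun)"
          if "k \<le> M - m" for k using that
        proof (induction k)
          case (Suc k)
          have "{M - Suc k..<M} = insert (M - Suc k) {M - k..<M}" using Suc.prems by auto
          moreover have "\<rho> (M - Suc k) = 0" using Suc.prems by (intro zero) auto
          moreover have "M - (M - Suc k) = Suc k" using Suc.prems by simp
          moreover have "(of_nat (fact (Suc k)) :: ratfun) = of_nat (Suc k) * of_nat (fact k)"
            by (simp only: fact_Suc of_nat_mult of_nat_id)
          ultimately show ?case using Suc by (simp del: of_nat_diff fact_Suc of_nat_fact of_nat_Suc)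
        qed simp
        from this[of "M - m"] show ?thesis using M by simp
      qed
      also have "(\<Prod>i<m. alpha * of_nat (\<rho> i) + of_nat (M - i)) * (\<Prod>i\<in>{m..<M}. alpha * of_nat (\<rho> i) + of_nat (M - i))
        = (\<Prod>i<M. alpha * of_nat (\<rho> i) + of_nat (M - i))"
      proof -
        have "{..<M} = {..<m} \<union> {m..<M}" using M by auto
        moreover have "{..<m} \<inter> {m..<M} = {}" by auto
        ultimately show ?thesis by (simp only: prod.union_disjoint finite_lessThan finite_atLeastLessThan)
      qed
      finally show ?thesis by (simp add: hooks_add_col[OF less.prems M])
    qed
    moreover have "partial_col m m \<pi> = \<rho>" using partial_col_m[of m \<pi>] \<pi>(3) \<rho> by simp
    ultimately show ?thesis using H(1-3) by (intro exI[of _ H]) (auto simp: size)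
  qed
qed

text \<open>The first column is added by plain sums over the insertion positions from
  \<open>k\<close> on, with \<open>k\<close> running down from \<open>m - 1\<close> to 0. Each sum
  gains invariance under one more \<open>sig\<close> and multiplies the total of the class by the
  number \<open>n - k\<close> of positions, which builds up the quotient of \<open>fact n\<close>
  and \<open>fact (n - m)\<close>.\<close>

lemma jack_combo:
  assumes "parts n m lam"
  shows "\<exists>G. combo_ok n (csize n lam) G \<and>
    supported n (csize n lam) {\<nu>. ms n \<nu> = ms n lam} (bar_sum n G) \<and>
    (\<forall>j. Suc j < n \<longrightarrow> sig j (bar_sum n G) = bar_sum n G) \<and>
    coef_sum (\<lambda>\<nu>. ms n \<nu> = ms n lam) G * of_nat (fact (n - m) * mults n lam) = of_nat (fact n) * hooks n lam"
proof -
  have mn: "m \<le> n" and pos: "\<And>i. i < m \<Longrightarrow> lam i > 0" and zero: "\<And>i. i \<ge> m \<Longrightarrow> lam i = 0"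
    and dec: "\<And>i j. i \<le> j \<Longrightarrow> lam j \<le> lam i"
    using assms by (auto simp: parts_def)
  define \<pi> where "\<pi> = (\<lambda>j. lam j - 1)"
  have \<pi>: "\<pi> \<in> comps n" "\<And>i j. i \<le> j \<Longrightarrow> \<pi> j \<le> \<pi> i" "\<And>i. i \<ge> m \<Longrightarrow> \<pi> i = 0"
    using dec zero mn by (auto simp: \<pi>_def comps_def intro: diff_le_mono)
  have lam: "lam = add_col m \<pi>"
  proof
    show "lam i = add_col m \<pi> i" for i using pos[of i] zero[of i] by (cases "i < m") (auto simp: \<pi>_def add_col_def)
  qed
  have size: "csize n lam = csize n \<pi> + m" unfolding lam by (rule csize_add_col[OF mn])
  obtain m' where m': "parts n m' \<pi>" using parts_exists[OF \<pi>(1,2)] by blast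
  have "m' \<le> m"
  proof (rule ccontr)
    assume "\<not> m' \<le> m"
    then have "\<pi> m > 0" using m' by (simp add: parts_def)
    then show False using \<pi>(3)[of m] by simp
  qed
  with knop_sahi[OF m'] obtain G where G: "combo_ok n (csize n \<pi>) G"
      "supported n (csize n \<pi>) {\<pi>} (bar_sum n G)"
      "\<And>j. m \<le> j \<Longrightarrow> Suc j < n \<Longrightarrow> sig j (bar_sum n G) = bar_sum n G"
      "coef_sum (col_cond n m 0 (ms n \<pi>)) G * of_nat (mults n lam) = hooks n lam"
    using mn lam by auto
  define S where "S k = {\<nu>. ms n (add_col k \<nu>) = ms n lam}" for k
  have "\<exists>H. combo_ok n (csize n \<pi> + s) H \<and> supported n (csize n \<pi> + s) (S (m - s)) (bar_sum n H) \<and>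
      (\<forall>j. m - s \<le> j \<longrightarrow> Suc j < n \<longrightarrow> sig j (bar_sum n H) = bar_sum n H) \<and>
      coef_sum (\<lambda>\<nu>. \<nu> \<in> S (m - s)) H * of_nat (fact (n - m)) =
        of_nat (fact (n - m + s)) * coef_sum (\<lambda>\<nu>. \<nu> \<in> S m) G" if "s \<le> m" for s
    using that
  proof (induction s)
    case 0
    have "\<pi> \<in> S m" by (simp add: S_def lam)
    then have "supported n (csize n \<pi>) (S m) (bar_sum n G)"
      using supported_mono[OF G(2), of "S m"] by simp
    then show ?case using G by (intro exI[of _ G]) (auto simp: mult.commute)
  next
    case (Suc s)
    define k where "k = m - Suc s"
    have k: "m - s = Suc k" "k < n" using Suc.prems mn by (auto simp: k_def)
    from Suc obtain H where H: "combo_ok n (csize n \<pi> + s) H"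
        "supported n (csize n \<pi> + s) (S (Suc k)) (bar_sum n H)"
        "\<And>j. k < j \<Longrightarrow> Suc j < n \<Longrightarrow> sig j (bar_sum n H) = bar_sum n H"
        "coef_sum (\<lambda>\<nu>. \<nu> \<in> S (Suc k)) H * of_nat (fact (n - m)) =
          of_nat (fact (n - m + s)) * coef_sum (\<lambda>\<nu>. \<nu> \<in> S m) G"
      by (auto simp: k Suc_le_eq)
    define K where "K = sum_combo k n H"
    have K: "bar_sum n K = (\<lambda>p. \<Sum>i\<in>{k..<n}. insert_op n i (bar_sum n H) p)"
      by (simp add: K_def bar_sum_sum[OF H(1)])
    \<comment> \<open>Raising the first \<open>k\<close> parts does not distinguish the positions
      from \<open>k\<close> on; so the chains in \<open>insert_op\<close> keep the support inside
      this class.\<close>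
    have closed: "swapE l \<nu> \<in> S k" if "k \<le> l" "Suc l < n" "\<nu> \<in> S k" for l \<nu>
    proof -
      have "add_col k (swapE l \<nu>) = swapE l (add_col k \<nu>)"
        using that by (auto simp: add_col_def swapE_def transpose_def fun_eq_iff)
      then show ?thesis using that by (simp add: S_def ms_swapE)
    qed
    have "insE (n - 1) ` S (Suc k) \<subseteq> S k"
      using k by (auto simp: S_def ms_add_col_insE)
    then have "supported n (Suc (csize n \<pi> + s)) (S k) (Phi n (bar_sum n H))"
      using supported_Phi[OF H(2)] k supported_mono by blast
    then have "supported n (Suc (csize n \<pi> + s)) (S k) (insert_op n i (bar_sum n H))" if "k \<le> i" for i
      unfolding insert_op_def using k that closed by (intro supported_chain) auto
    then have "supported n (Suc (csize n \<pi> + s)) (S k) (bar_sum n K)"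
      unfolding K by (auto simp: supported_def intro!: sum.neutral)
    moreover have "combo_ok n (Suc (csize n \<pi> + s)) K"
      unfolding K_def by (rule combo_ok_sum[OF H(1)])
    moreover have "sig j (bar_sum n K) = bar_sum n K" if "k \<le> j" "Suc j < n" for j
      unfolding K using H(3) that by (intro sig_sum_insert_op) auto
    moreover have "coef_sum (\<lambda>\<nu>. \<nu> \<in> S k) K * of_nat (fact (n - m)) =
        of_nat (fact (n - m + Suc s)) * coef_sum (\<lambda>\<nu>. \<nu> \<in> S m) G"
    proof -
      have "coef_sum (\<lambda>\<nu>. insE i \<nu> \<in> S k) H = coef_sum (\<lambda>\<nu>. \<nu> \<in> S (Suc k)) H" if "k \<le> i" "i < n" for i
        using that by (simp add: S_def ms_add_col_insE)
      then have "coef_sum (\<lambda>\<nu>. \<nu> \<in> S k) K = of_nat (n - k) * coef_sum (\<lambda>\<nu>. \<nu> \<in> S (Suc k)) H"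
        by (simp add: K_def coef_sum_sum del: of_nat_diff)
      moreover have "n - k = Suc (n - m + s)" using Suc.prems mn by (simp add: k_def)
      ultimately show ?thesis using H(4) by (simp add: mult.assoc distrib_right)
    qed
    ultimately show ?case by (intro exI[of _ K]) (auto simp: k_def)
  qed
  from this[of m] obtain H where H: "combo_ok n (csize n lam) H"
      "supported n (csize n lam) (S 0) (bar_sum n H)"
      "\<And>j. Suc j < n \<Longrightarrow> sig j (bar_sum n H) = bar_sum n H"
      "coef_sum (\<lambda>\<nu>. \<nu> \<in> S 0) H * of_nat (fact (n - m)) = of_nat (fact n) * coef_sum (\<lambda>\<nu>. \<nu> \<in> S m) G"
    using mn by (auto simp: size)
  have S0: "S 0 = {\<nu>. ms n \<nu> = ms n lam}" by (simp add: S_def add_col_def)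
  have "coef_sum (\<lambda>\<nu>. \<nu> \<in> S m) G = coef_sum (col_cond n m 0 (ms n \<pi>)) G"
  proof (rule coef_sum_cong)
    fix c \<nu> assume "(c, \<nu>) \<in> set G"
    then have "\<nu> \<in> comps n" using G(1) by (auto simp: combo_ok_def)
    from ms_add_col_eq_iff[OF this \<pi>(3) mn]
    show "(\<nu> \<in> S m) = col_cond n m 0 (ms n \<pi>) \<nu>"
      by (auto simp: col_cond_def S_def lam add_col_def)
  qed
  then have G4: "coef_sum (\<lambda>\<nu>. \<nu> \<in> S m) G * of_nat (mults n lam) = hooks n lam" using G(4) by simp
  have "coef_sum (\<lambda>\<nu>. \<nu> \<in> S 0) H * of_nat (fact (n - m) * mults n lam) =
      coef_sum (\<lambda>\<nu>. \<nu> \<in> S 0) H * of_nat (fact (n - m)) * of_nat (mults n lam)"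
    by (simp only: of_nat_mult mult.assoc)
  also have "\<dots> = of_nat (fact n) * hooks n lam" by (simp only: H(4) mult.assoc G4)
  finally have "coef_sum (\<lambda>\<nu>. ms n \<nu> = ms n lam) H * of_nat (fact (n - m) * mults n lam) = of_nat (fact n) * hooks n lam"
    by (simp add: S0)
  then show ?thesis using H S0 by auto
qed

section \<open>Polynomials determined by their values\<close>

lemma combo_poly:
  assumes "combo_ok n s G" "n > 0"
  shows "\<exists>J. (\<forall>\<gamma>. Poly_Mapping.lookup J \<gamma> \<in> nat_polys_in_alpha) \<and>
    (\<forall>\<gamma>\<in>Poly_Mapping.keys J. Poly_Mapping.keys \<gamma> \<subseteq> {..<n} \<and> weight \<gamma> \<le> s) \<and>
    (\<forall>p. ev (coord p) J = bar_sum n G p) \<and>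
    (\<forall>\<gamma>. Poly_Mapping.keys \<gamma> \<subseteq> {..<n} \<longrightarrow> weight \<gamma> = s \<longrightarrow>
      Poly_Mapping.lookup J \<gamma> = coef_sum (\<lambda>\<eta>. \<eta> = Poly_Mapping.lookup \<gamma>) G)"
  using assms(1)
proof (induction G)
  case Nil
  show ?case by (intro exI[of _ 0]) (auto simp: nat_polys_0)
next
  case (Cons x G)
  obtain c \<zeta> where x: "x = (c, \<zeta>)" by force
  from Cons.prems have ok: "c \<in> nat_polys_in_alpha" "\<zeta> \<in> comps n" "csize n \<zeta> = s" "combo_ok n s G"
    by (auto simp: x)
  from bar_poly_exists[OF ok(2) assms(2)] obtain B where B: "bar_poly n \<zeta> B" by blast
  from Cons.IH[OF ok(4)] obtain J where
    J: "\<And>\<gamma>. Poly_Mapping.lookup J \<gamma> \<in> nat_polys_in_alpha"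
      "\<And>\<gamma>. \<gamma> \<in> Poly_Mapping.keys J \<Longrightarrow> Poly_Mapping.keys \<gamma> \<subseteq> {..<n} \<and> weight \<gamma> \<le> s"
      "\<And>p. ev (coord p) J = bar_sum n G p"
      "\<And>\<gamma>. Poly_Mapping.keys \<gamma> \<subseteq> {..<n} \<Longrightarrow> weight \<gamma> = s \<Longrightarrow>
        Poly_Mapping.lookup J \<gamma> = coef_sum (\<lambda>\<eta>. \<eta> = Poly_Mapping.lookup \<gamma>) G" by blast
  have lk: "Poly_Mapping.lookup (const_mpol c * B + J) \<gamma> = c * Poly_Mapping.lookup B \<gamma> + Poly_Mapping.lookup J \<gamma>" for \<gamma>
    by (simp add: lookup_add lookup_const_mpol_mult)
  show ?case
  proof (intro exI[of _ "const_mpol c * B + J"] conjI allI ballI impI)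
    show "Poly_Mapping.lookup (const_mpol c * B + J) \<gamma> \<in> nat_polys_in_alpha" for \<gamma>
      unfolding lk using B ok J by (auto simp: bar_poly_def intro!: nat_polys_intros)
    show "ev (coord p) (const_mpol c * B + J) = bar_sum n (x # G) p" for p
      using B J(3) by (simp add: x ev_add ev_const_mult bar_poly_def)
  next
    fix \<gamma> assume "\<gamma> \<in> Poly_Mapping.keys (const_mpol c * B + J)"
    then have "\<gamma> \<in> Poly_Mapping.keys B \<or> \<gamma> \<in> Poly_Mapping.keys J"
      by (auto simp: in_keys_iff lk)
    then show "Poly_Mapping.keys \<gamma> \<subseteq> {..<n}" "weight \<gamma> \<le> s"
      using B J(2) ok(3) by (auto simp: bar_poly_def weight_csize)
  next
    fix \<gamma> :: expo assume \<gamma>: "Poly_Mapping.keys \<gamma> \<subseteq> {..<n}" "weight \<gamma> = s"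
    have "Poly_Mapping.lookup B \<gamma> = (if \<zeta> = Poly_Mapping.lookup \<gamma> then 1 else 0)"
    proof (cases "\<gamma> \<in> Poly_Mapping.keys B")
      case True
      then show ?thesis using B \<gamma> ok(3) by (auto simp: bar_poly_def)
    next
      case False
      then show ?thesis using B by (auto simp: bar_poly_def in_keys_iff)
    qed
    then show "Poly_Mapping.lookup (const_mpol c * B + J) \<gamma> = coef_sum (\<lambda>\<eta>. \<eta> = Poly_Mapping.lookup \<gamma>) (x # G)"
      using J(4)[OF \<gamma>] by (simp add: lk x)
  qed
qed

lemma mon_cong: "(\<And>i. i \<in> Poly_Mapping.keys \<eta> \<Longrightarrow> x i = y i) \<Longrightarrow> mon x \<eta> = mon y \<eta>"
  by (simp add: mon_def)

lemma ev_cong: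
  assumes "\<And>\<gamma>. \<gamma> \<in> Poly_Mapping.keys p \<Longrightarrow> Poly_Mapping.keys \<gamma> \<subseteq> V" "\<And>i. i \<in> V \<Longrightarrow> x i = y i"
  shows "ev x p = ev y p"
  unfolding ev_eq using assms by (intro sum.cong refl arg_cong2[of _ _ _ _ "(*)"] mon_cong) blast

definition bounded_poly :: "nat set \<Rightarrow> nat \<Rightarrow> 'a::zero mpol \<Rightarrow> bool" where
  "bounded_poly V d p \<longleftrightarrow> (\<forall>\<gamma>\<in>Poly_Mapping.keys p. Poly_Mapping.keys \<gamma> \<subseteq> V \<and> weight \<gamma> \<le> d)"

lemma bounded_poly_add:
  "bounded_poly V d p \<Longrightarrow> bounded_poly V d q \<Longrightarrow> bounded_poly V d (p + q)"
  using keys_add[of p q] by (auto simp: bounded_poly_def)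

lemma bounded_poly_const_mult:
  "bounded_poly V d p \<Longrightarrow> bounded_poly V d (const_mpol c * p)" for c :: "'a::comm_semiring_1"
  by (auto simp: bounded_poly_def in_keys_iff lookup_const_mpol_mult)

lemma bounded_poly_mono: "bounded_poly V d p \<Longrightarrow> V \<subseteq> W \<Longrightarrow> d \<le> e \<Longrightarrow> bounded_poly W e p"
  by (fastforce simp: bounded_poly_def)

text \<open>Division by \<open>x_i - e\<close> with remainder free of \<open>x_i\<close>, one
  monomial at a time: if \<open>h = p0 + (x_i - e) g\<close>, then
  \<open>x_i h = e p0 + (x_i - e) (h + e g)\<close>.\<close>

lemma divide_linear:
  fixes p :: "'a::comm_ring_1 mpol"
  assumes "bounded_poly V d p"
  shows "\<exists>p0 g. bounded_poly (V - {i}) d p0 \<and> p = p0 + (var i * g + const_mpol (- e) * g) \<and>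
    (if d = 0 then g = 0 else bounded_poly V (d - 1) g)"
  using assms
proof (induction d arbitrary: p)
  case 0
  have "bounded_poly (V - {i}) 0 p"
    using 0 by (auto simp: bounded_poly_def weight_def in_keys_iff) 
  then show ?case by (intro exI[of _ p] exI[of _ 0]) simp
next
  case (Suc d)
  show ?case using Suc.prems
  proof (induction p rule: mpol_induct)
    case (single \<eta> c)
    show ?case
    proof (cases "c = 0 \<or> i \<notin> Poly_Mapping.keys \<eta>")
      case True
      then show ?thesis using single
        by (intro exI[of _ "Poly_Mapping.single \<eta> c"] exI[of _ 0]) (auto simp: bounded_poly_def)
    next
      case False
      define \<theta> where "\<theta> = \<eta> - Poly_Mapping.single i 1"
      have \<eta>: "\<eta> = Poly_Mapping.single i 1 + \<theta>"
        using False by (intro poly_mapping_eqI) (auto simp: \<theta>_def lookup_add lookup_minus lookup_single when_def in_keys_iff)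
      define h :: "'a mpol" where "h = Poly_Mapping.single \<theta> c"
      have b: "Poly_Mapping.keys \<eta> \<subseteq> V" "weight \<eta> \<le> Suc d" "i \<in> V"
        using single False by (auto simp: bounded_poly_def)
      have "Poly_Mapping.keys \<theta> \<subseteq> Poly_Mapping.keys \<eta>"
        by (auto simp: \<eta> in_keys_iff lookup_add)
      then have h: "bounded_poly V d h"
        using b by (auto simp: h_def bounded_poly_def \<eta> weight_add split: if_splits)
      from Suc.IH[OF this] obtain p0 g where g: "bounded_poly (V - {i}) d p0"
          "h = p0 + (var i * g + const_mpol (- e) * g)" "if d = 0 then g = 0 else bounded_poly V (d - 1) g" by blast
      have "Poly_Mapping.single \<eta> c = var i * h"
        by (simp add: h_def var_def mult_single \<eta>)
      also have "\<dots> = const_mpol e * p0 + (var i * (h + const_mpol e * g) + const_mpol (- e) * (h + const_mpol e * g))"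
      proof -
        have ee: "const_mpol (- e) = - (const_mpol e :: 'a mpol)" by (simp add: const_mpol_def single_uminus)
        have "const_mpol e * h = const_mpol e * p0 + const_mpol e * (var i * g + const_mpol (- e) * g)"
          unfolding g(2)[symmetric] by (simp add: g(2) distrib_left)
        then show ?thesis by (simp add: ee algebra_simps)
      qed
      finally have eq: "Poly_Mapping.single \<eta> c = \<dots>" .
      have "bounded_poly V d (const_mpol e * g)"
        using g(3) by (auto intro: bounded_poly_const_mult bounded_poly_mono simp: bounded_poly_def[of _ _ 0] split: if_splits)
      then show ?thesis using eq h g(1)
        by (intro exI[of _ "const_mpol e * p0"] exI[of _ "h + const_mpol e * g"])
          (auto intro: bounded_poly_add bounded_poly_const_mult bounded_poly_mono)
    qed
  next
    case (add p q)
    then have "bounded_poly V (Suc d) p" "bounded_poly V (Suc d) q" by (auto simp: bounded_poly_def)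
    with add.IH obtain p0 g q0 h where
      "bounded_poly (V - {i}) (Suc d) p0" "p = p0 + (var i * g + const_mpol (- e) * g)" "bounded_poly V d g"
      "bounded_poly (V - {i}) (Suc d) q0" "q = q0 + (var i * h + const_mpol (- e) * h)" "bounded_poly V d h"
      by auto
    then show ?case
      by (intro exI[of _ "p0 + q0"] exI[of _ "g + h"]) (auto intro: bounded_poly_add simp: algebra_simps)
  qed
qed

text \<open>The coordinates of \<open>pt\<close> for the variables in \<open>V\<close>, with
  \<open>c\<close> standing for variables already eliminated, all of which rank below the remaining
  ones.\<close>

definition tip :: "nat set \<Rightarrow> nat \<Rightarrow> (nat \<Rightarrow> nat) \<Rightarrow> nat \<Rightarrow> ratfun" where
  "tip V c \<nu> i = - (alpha * of_nat (\<nu> i) + of_nat (card {j\<in>V. below \<nu> j i} + c))"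

text \<open>
  Let \<open>i\<close> be the position where \<open>base\<close> comes last in the order \<open>below\<close>, and divide \<open>p\<close> by
  \<open>x\<^sub>i - e\<close> with \<open>e\<close> the smallest possible \<open>i\<close>-th coordinate. The points with \<open>i\<close>-th coordinate \<open>e\<close>
  form the same configuration with one variable less, and the others the one for \<open>d - 1\<close>.
\<close>
lemma vanishing_zero:
  assumes "finite V" "bounded_poly V d p"
    and "\<And>\<nu>. (\<forall>i\<in>V. base i \<le> \<nu> i) \<Longrightarrow> (\<Sum>i\<in>V. \<nu> i - base i) \<le> d \<Longrightarrow> ev (tip V c \<nu>) p = 0"
  shows "p = 0"
  using assms
proof (induction "card V + d" arbitrary: V d c p base rule: less_induct)
  case less
  show ?case
  proof (cases "V = {}")
    case True
    have "ev (tip V c base) p = 0" using less.prems(3)[of base] True by simp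
    moreover have "Poly_Mapping.keys p \<subseteq> {0}"
      using less.prems(2) by (auto simp: bounded_poly_def True)
    ultimately have "Poly_Mapping.lookup p 0 = 0"
      by (simp add: ev_superset[of "{0}"] mon_def)
    with \<open>Poly_Mapping.keys p \<subseteq> {0}\<close> show ?thesis
      by (metis all_not_in_conv in_keys_iff keys_eq_empty singletonD subsetD)
  next
    case False
    define b where "b = Min (base ` V)"
    define i where "i = Max {i\<in>V. base i = b}"
    have "b \<in> base ` V" unfolding b_def using False less.prems(1) by (intro Min_in) auto
    then have "i \<in> {i\<in>V. base i = b}" unfolding i_def using less.prems(1) by (intro Max_in) auto
    then have i: "i \<in> V" "base i = b" by auto
    have bi: "b \<le> base j" if "j \<in> V" for j unfolding b_def using that less.prems(1) by simp
    have below_i: "below base i j" if "j \<in> V" "j \<noteq> i" for j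
    proof -
      have "j < i" if "base j = b"
      proof -
        have "j \<le> i" unfolding i_def using that \<open>j \<in> V\<close> less.prems(1) by (intro Max_ge) auto
        then show ?thesis using \<open>j \<noteq> i\<close> by simp
      qed
      then show ?thesis using bi[OF \<open>j \<in> V\<close>] i by (auto simp: below_def)
    qed
    define e where "e = - (alpha * of_nat b + of_nat c)"
    obtain p0 g where p0: "bounded_poly (V - {i}) d p0" and p: "p = p0 + (var i * g + const_mpol (- e) * g)"
      and g: "if d = 0 then g = 0 else bounded_poly V (d - 1) g"
      using divide_linear[OF less.prems(2)] by blast
    have evp: "ev x p = ev x p0 + (x i - e) * ev x g" for x
      unfolding p ev_add ev_var_mult ev_const_mult by (simp add: algebra_simps)
    have fin: "finite (V - {i})" using less.prems(1) by simp
    have cardV: "card V = Suc (card (V - {i}))" using i less.prems(1) by (metis card_Suc_Diff1)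
    have "p0 = 0"
    \<comment> \<open>With part \<open>b\<close>, position \<open>i\<close> ranks below all others,
      so removing it lowers every other rank by one; \<open>Suc c\<close> restores this.\<close>
    proof (rule less.hyps[OF _ fin p0, where c = "Suc c" and base = base])
      show "card (V - {i}) + d < card V + d" using cardV by simp
      fix \<nu> assume \<nu>: "\<forall>j\<in>V - {i}. base j \<le> \<nu> j" "(\<Sum>j\<in>V - {i}. \<nu> j - base j) \<le> d"
      define \<nu>' where "\<nu>' = \<nu>(i := b)"
      have below_i': "below \<nu>' i j" if "j \<in> V - {i}" for j
      proof -
        have "below base i j" "base j \<le> \<nu> j" "j \<noteq> i" using below_i \<nu>(1) that by auto
        then show ?thesis using i(2) unfolding below_def \<nu>'_def by simp linarith
      qed
      have "(\<Sum>j\<in>V. \<nu>' j - base j) = (\<Sum>j\<in>V - {i}. \<nu> j - base j)"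
        using i less.prems(1) by (simp add: sum.remove[of V i] \<nu>'_def)
      then have "ev (tip V c \<nu>') p = 0"
        using \<nu> i by (intro less.prems(3)) (auto simp: \<nu>'_def)
      moreover have "tip V c \<nu>' i = e"
      proof -
        have "{j\<in>V. below \<nu>' j i} = {}"
          using below_i' by (fastforce simp: below_def)
        then show ?thesis unfolding tip_def e_def by (simp only: card.empty) (simp add: \<nu>'_def)
      qed
      ultimately have "ev (tip V c \<nu>') p0 = 0" by (simp add: evp)
      moreover have "tip V c \<nu>' j = tip (V - {i}) (Suc c) \<nu> j" if "j \<in> V - {i}" for j
      proof -
        have "{k\<in>V. below \<nu>' k j} = insert i {k\<in>V - {i}. below \<nu> k j}"
          using below_i'[OF that] i(1) that by (auto simp: below_def \<nu>'_def)
        then have "card {k\<in>V. below \<nu>' k j} = Suc (card {k\<in>V - {i}. below \<nu> k j})"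
          using fin by simp
        then show ?thesis using that by (simp add: tip_def \<nu>'_def)
      qed
      ultimately show "ev (tip (V - {i}) (Suc c) \<nu>) p0 = 0"
        using p0 ev_cong[of p0 "V - {i}" "tip V c \<nu>'" "tip (V - {i}) (Suc c) \<nu>"] by (auto simp: bounded_poly_def)
    qed
    have "g = 0"
    proof (cases "d = 0")
      case False
      with g have gb: "bounded_poly V (d - 1) g" by simp
      show ?thesis
      \<comment> \<open>A part above \<open>b\<close> makes the \<open>i\<close>-th coordinate
        differ from \<open>e\<close>, so \<open>g\<close> vanishes as well; raising the base at
        \<open>i\<close> uses up one unit of the degree bound.\<close>
      proof (rule less.hyps[OF _ less.prems(1) gb, where c = c and base = "base(i := Suc b)"])
        show "card V + (d - 1) < card V + d" using False by simp
        fix \<nu> assume \<nu>: "\<forall>j\<in>V. (base(i := Suc b)) j \<le> \<nu> j" "(\<Sum>j\<in>V. \<nu> j - (base(i := Suc b)) j) \<le> d - 1"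
        have ib: "Suc b \<le> \<nu> i" using \<nu>(1) i(1) by force
        have ge: "base j \<le> \<nu> j" if "j \<in> V" for j using \<nu>(1) that ib i(2) by (cases "j = i") force+
        have "(\<Sum>j\<in>V. \<nu> j - base j) = Suc (\<Sum>j\<in>V. \<nu> j - (base(i := Suc b)) j)"
          using i ib less.prems(1) by (simp add: sum.remove[of V i])
        then have "ev (tip V c \<nu>) p = 0" using \<nu>(2) False ge by (intro less.prems(3)) auto
        moreover have "tip V c \<nu> i - e \<noteq> 0"
        proof
          assume "tip V c \<nu> i - e = 0"
          then have "alpha * of_nat (\<nu> i - b) + of_nat (card {j\<in>V. below \<nu> j i}) = 0"
            using ib by (simp add: tip_def e_def of_nat_diff algebra_simps)
          from alpha_generic_nat(1)[OF this] ib show False by simp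
        qed
        ultimately show "ev (tip V c \<nu>) g = 0" by (simp add: evp \<open>p0 = 0\<close>)
      qed
    qed (use g in simp)
    with \<open>p0 = 0\<close> p show ?thesis by simp
  qed
qed

lemma vanishing_on_comps:
  assumes "bounded_poly {..<n} d p" "\<And>\<nu>. \<nu> \<in> comps n \<Longrightarrow> csize n \<nu> \<le> d \<Longrightarrow> ev (coord (pt n \<nu>)) p = 0"
  shows "p = 0"
proof (rule vanishing_zero[OF _ assms(1), of "\<lambda>_. 0" 0])
  fix \<nu> :: "nat \<Rightarrow> nat"
  assume \<nu>: "(\<Sum>i\<in>{..<n}. \<nu> i - 0) \<le> d"
  define \<nu>' where "\<nu>' = (\<lambda>i. if i < n then \<nu> i else 0)"
  have "{j\<in>{..<n}. below \<nu> j i} = {j. j < n \<and> below \<nu>' j i}" if "i < n" for i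
    using that by (auto simp: below_def \<nu>'_def)
  then have "tip {..<n} 0 \<nu> i = coord (pt n \<nu>') i" if "i < n" for i
    using that by (simp add: tip_def coord_pt rank_def) (simp add: \<nu>'_def)
  then have "ev (tip {..<n} 0 \<nu>) p = ev (coord (pt n \<nu>')) p"
    using assms(1) by (intro ev_cong[of p "{..<n}"]) (auto simp: bounded_poly_def)
  moreover have "csize n \<nu>' \<le> d" using \<nu> by (simp add: csize_def \<nu>'_def)
  ultimately show "ev (tip {..<n} 0 \<nu>) p = 0"
    using assms(2)[of \<nu>'] by (simp add: comps_def \<nu>'_def)
qed auto

section \<open>Symmetry and leading coefficient\<close>

definition swap_expo :: "nat \<Rightarrow> expo \<Rightarrow> expo" where
  "swap_expo i = Poly_Mapping.map_key (transpose i (Suc i))"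

lemma lookup_swap_expo: "Poly_Mapping.lookup (swap_expo i \<eta>) j = Poly_Mapping.lookup \<eta> (transpose i (Suc i) j)"
  by (simp add: swap_expo_def map_key.rep_eq)

lemma swap_expo_swap_expo [simp]: "swap_expo i (swap_expo i \<eta>) = \<eta>"
  by (rule poly_mapping_eqI) (simp add: lookup_swap_expo)

lemma inj_swap_expo: "inj (swap_expo i)"
  by (metis injI swap_expo_swap_expo)

lemma mon_swap_expo: "mon x (swap_expo i \<eta>) = mon (\<lambda>j. x (transpose i (Suc i) j)) \<eta>"
  unfolding mon_def
  by (rule prod.reindex_bij_witness[of _ "transpose i (Suc i)" "transpose i (Suc i)"])
    (auto simp: in_keys_iff lookup_swap_expo)

lemma weight_swap_expo: "weight (swap_expo i \<eta>) = weight \<eta>"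
  unfolding weight_def
  by (rule sum.reindex_bij_witness[of _ "transpose i (Suc i)" "transpose i (Suc i)"])
    (auto simp: in_keys_iff lookup_swap_expo)

definition swap_mpol :: "nat \<Rightarrow> 'a::zero mpol \<Rightarrow> 'a mpol" where
  "swap_mpol i = Poly_Mapping.map_key (swap_expo i)"

lemma lookup_swap_mpol: "Poly_Mapping.lookup (swap_mpol i p) \<eta> = Poly_Mapping.lookup p (swap_expo i \<eta>)"
  by (simp add: swap_mpol_def map_key.rep_eq inj_swap_expo)

lemma ev_swap_mpol: "ev x (swap_mpol i p) = ev (\<lambda>j. x (transpose i (Suc i) j)) p"
  unfolding ev_eq
  by (rule sum.reindex_bij_witness[of _ "swap_expo i" "swap_expo i"])
    (auto simp: in_keys_iff lookup_swap_mpol mon_swap_expo)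

lemma bounded_poly_swap:
  assumes "bounded_poly {..<n} d p" "Suc i < n"
  shows "bounded_poly {..<n} d (swap_mpol i p)"
  unfolding bounded_poly_def
proof
  fix \<gamma> assume "\<gamma> \<in> Poly_Mapping.keys (swap_mpol i p)"
  then have "swap_expo i \<gamma> \<in> Poly_Mapping.keys p" by (simp add: in_keys_iff lookup_swap_mpol)
  then have b: "Poly_Mapping.keys (swap_expo i \<gamma>) \<subseteq> {..<n}" "weight (swap_expo i \<gamma>) \<le> d"
    using assms(1) by (auto simp: bounded_poly_def)
  have "j < n" if "j \<in> Poly_Mapping.keys \<gamma>" for j
  proof -
    have "transpose i (Suc i) j \<in> Poly_Mapping.keys (swap_expo i \<gamma>)"
      using that by (simp add: in_keys_iff lookup_swap_expo)
    then have "transpose i (Suc i) j < n" using b by auto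
    then show ?thesis using assms(2) by (auto simp: transpose_def split: if_splits)
  qed
  then show "Poly_Mapping.keys \<gamma> \<subseteq> {..<n} \<and> weight \<gamma> \<le> d"
    using b by (auto simp: weight_swap_expo)
qed

text \<open>Evaluation at the point and at its swap gives \<open>(1 + 1/d) (a - b) = 0\<close> and
  \<open>(1 - 1/d) (a - b) = 0\<close>. As \<open>d\<close> may be 1 or -1, neither alone suffices,
  but their sum is \<open>2 (a - b) = 0\<close>.\<close>

lemma sig_fixed_swap:
  assumes "sig i F = F"
  shows "F (swap_point i p) = F p"
proof -
  define d where "d = coord p i - coord p (Suc i)"
  define a b where "a = F (swap_point i p)" and "b = F p"
  have "coord (swap_point i p) i - coord (swap_point i p) (Suc i) = - d"
    by (simp add: coord_swap d_def)
  then have "sig i F (swap_point i p) = (1 - 1 / d) * b + a / d"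
    by (simp add: sig_def a_def b_def)
  moreover have "sig i F p = (1 + 1 / d) * a - b / d"
    by (simp add: sig_def a_def b_def flip: d_def)
  ultimately have "(1 + 1 / d) * a - b / d = b" "(1 - 1 / d) * b + a / d = a"
    using assms by (simp_all add: a_def b_def)
  then have "2 * (a - b) = 0" by (simp add: algebra_simps)
  then show ?thesis by (simp add: a_def b_def)
qed

text \<open>Adjacent transpositions generate: \<open>transpose a (Suc b)\<close> is the conjugate of
  \<open>transpose a b\<close> by \<open>transpose b (Suc b)\<close>.\<close>

lemma symmetric_mpolI:
  assumes "in_vars n p" "\<And>i \<eta>. Suc i < n \<Longrightarrow> Poly_Mapping.lookup p (swap_expo i \<eta>) = Poly_Mapping.lookup p \<eta>"
  shows "symmetric_mpol n p"
proof -
  define S where "S \<pi> \<longleftrightarrow> (\<forall>\<eta>. Poly_Mapping.lookup p (Poly_Mapping.map_key \<pi> \<eta>) = Poly_Mapping.lookup p \<eta>)" for \<pi>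
  have comp: "S (\<sigma> \<circ> \<tau>)" if "S \<sigma>" "S \<tau>" "inj \<sigma>" "inj \<tau>" for \<sigma> \<tau>
  proof -
    have "Poly_Mapping.map_key (\<sigma> \<circ> \<tau>) \<eta> = Poly_Mapping.map_key \<tau> (Poly_Mapping.map_key \<sigma> \<eta>)" for \<eta> :: expo
      using that by (intro poly_mapping_eqI) (simp add: map_key.rep_eq inj_compose)
    then show ?thesis using that by (simp add: S_def)
  qed
  have adj: "S (transpose i (Suc i))" if "Suc i < n" for i
    using assms(2)[OF that] by (simp add: S_def swap_expo_def)
  have step: "S (transpose a b)" if "a < b" "b < n" for a b
    using that
  proof (induction b)
    case (Suc b)
    show ?case
    proof (cases "a = b")
      case False
      then have "S (transpose b (Suc b) \<circ> (transpose a b \<circ> transpose b (Suc b)))"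
        using Suc by (intro comp adj) (auto intro: inj_compose)
      moreover have "transpose b (Suc b) \<circ> (transpose a b \<circ> transpose b (Suc b)) = transpose a (Suc b)"
        using False Suc.prems by (auto simp: fun_eq_iff transpose_def)
      ultimately show ?thesis by simp
    qed (use adj Suc.prems in simp)
  qed simp
  have "S \<pi>" if "\<pi> permutes {..<n}" for \<pi>
    using that finite_lessThan
  proof (induction rule: permutes_induct)
    case id
    have "Poly_Mapping.map_key id \<eta> = \<eta>" for \<eta> :: expo
      by (intro poly_mapping_eqI) (simp add: map_key.rep_eq)
    then show ?case by (simp only: S_def) simp
  next
    case (swap a b \<pi>)
    have "S (transpose a b)"
      using step[of a b] step[of b a] swap by (auto simp: transpose_commute elim: linorder_neqE_nat)
    then show ?case using swap permutes_inj by (intro comp) auto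
  qed
  then show ?thesis using assms(1) by (simp add: symmetric_mpol_def S_def)
qed

lemma coef_sum_sum_eq:
  assumes "finite A" "inj_on f A"
  shows "(\<Sum>\<gamma>\<in>A. coef_sum (\<lambda>\<eta>. \<eta> = f \<gamma>) G) = coef_sum (\<lambda>\<eta>. \<eta> \<in> f ` A) G"
proof (induction G)
  case (Cons x G)
  have "(\<Sum>\<gamma>\<in>A. if snd x = f \<gamma> then fst x else 0) = (if snd x \<in> f ` A then fst x else 0)"
  proof (cases "snd x \<in> f ` A")
    case True
    then obtain \<gamma> where \<gamma>: "\<gamma> \<in> A" "snd x = f \<gamma>" by auto
    then have "(\<Sum>\<theta>\<in>A. if snd x = f \<theta> then fst x else 0) = (\<Sum>\<theta>\<in>A. if \<gamma> = \<theta> then fst x else 0)"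
      using assms(2) by (intro sum.cong) (auto dest: inj_onD)
    then show ?thesis using \<gamma> assms(1) by simp
  next
    case False
    then show ?thesis by (auto intro!: sum.neutral)
  qed
  then show ?case using Cons by (simp add: sum.distrib)
qed simp

section \<open>Counting rearrangements and reading off the leading coefficient\<close>

lemma ms_eq_mset: "ms n \<theta> = mset (map \<theta> [0..<n])"
  by (simp add: ms_def lessThan_atLeast0)

lemma csize_ms: "csize n \<nu> = sum_mset (ms n \<nu>)"
  by (simp add: csize_def ms_def sum_unfold_sum_mset)

definition arrangements :: "nat \<Rightarrow> (nat \<Rightarrow> nat) \<Rightarrow> expo set" where
  "arrangements n \<theta> = {\<gamma>. Poly_Mapping.keys \<gamma> \<subseteq> {..<n} \<and> ms n (Poly_Mapping.lookup \<gamma>) = ms n \<theta>}"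

lemma expo_of_comp:
  assumes "\<theta> \<in> comps n"
  shows "\<exists>\<gamma>. Poly_Mapping.keys \<gamma> \<subseteq> {..<n} \<and> Poly_Mapping.lookup \<gamma> = \<theta>"
proof -
  have sub: "{i. \<theta> i \<noteq> 0} \<subseteq> {..<n}" using comps_pos[OF assms] by auto
  then have "finite {i. \<theta> i \<noteq> 0}" by (rule finite_subset) simp
  then have "Poly_Mapping.lookup (Abs_poly_mapping \<theta>) = \<theta>" by (simp add: Abs_poly_mapping_inverse)
  then show ?thesis using sub by (intro exI[of _ "Abs_poly_mapping \<theta>"]) (auto simp: in_keys_iff)
qed

lemma bij_arrangements:
  "bij_betw (\<lambda>\<gamma>. map (Poly_Mapping.lookup \<gamma>) [0..<n]) (arrangements n \<theta>) (permutations_of_multiset (ms n \<theta>))"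
proof (rule bij_betwI')
  fix \<gamma> \<gamma>' assume "\<gamma> \<in> arrangements n \<theta>" "\<gamma>' \<in> arrangements n \<theta>"
  then show "(map (Poly_Mapping.lookup \<gamma>) [0..<n] = map (Poly_Mapping.lookup \<gamma>') [0..<n]) = (\<gamma> = \<gamma>')"
    by (auto simp: arrangements_def intro: expo_eqI)
next
  fix \<gamma> assume "\<gamma> \<in> arrangements n \<theta>"
  then show "map (Poly_Mapping.lookup \<gamma>) [0..<n] \<in> permutations_of_multiset (ms n \<theta>)"
    unfolding arrangements_def permutations_of_multiset_def ms_eq_mset by simp
next
  fix xs assume "xs \<in> permutations_of_multiset (ms n \<theta>)"
  then have xs: "mset xs = ms n \<theta>" by (simp add: permutations_of_multiset_def)
  then have "size (mset xs) = size (ms n \<theta>)" by (simp only:)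
  then have len: "length xs = n" by (simp add: ms_def)
  define f where "f i = (if i < n then xs ! i else 0)" for i
  obtain \<gamma> where \<gamma>: "Poly_Mapping.keys \<gamma> \<subseteq> {..<n}" "Poly_Mapping.lookup \<gamma> = f"
    using expo_of_comp[of f n] by (auto simp: f_def comps_def)
  have "map f [0..<n] = xs" by (rule nth_equalityI) (auto simp: len f_def)
  moreover from this have "ms n f = ms n \<theta>" using xs by (simp only: ms_eq_mset)
  ultimately show "\<exists>\<gamma>\<in>arrangements n \<theta>. xs = map (Poly_Mapping.lookup \<gamma>) [0..<n]"
    using \<gamma> by (intro bexI[of _ \<gamma>]) (simp_all add: arrangements_def)
qed

lemma arrangement_map_key:
  assumes "\<gamma> \<in> arrangements n (Poly_Mapping.lookup lam)" "Poly_Mapping.keys lam \<subseteq> {..<n}"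
  shows "\<exists>\<pi>. \<pi> permutes {..<n} \<and> \<gamma> = Poly_Mapping.map_key \<pi> lam"
proof -
  define xs ys where "xs = map (Poly_Mapping.lookup \<gamma>) [0..<n]" and "ys = map (Poly_Mapping.lookup lam) [0..<n]"
  have "mset xs = mset ys"
    using assms(1) unfolding arrangements_def xs_def ys_def ms_eq_mset by simp
  then obtain \<pi> where \<pi>: "\<pi> permutes {..<length ys}" "permute_list \<pi> ys = xs"
    by (rule mset_eq_permutation)
  have p: "\<pi> permutes {..<n}" using \<pi>(1) by (simp add: ys_def)
  have "\<gamma> = Poly_Mapping.map_key \<pi> lam"
  proof (rule expo_eqI)
    show "Poly_Mapping.keys \<gamma> \<subseteq> {..<n}" using assms(1) by (simp add: arrangements_def)
    show "Poly_Mapping.keys (Poly_Mapping.map_key \<pi> lam) \<subseteq> {..<n}"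
      by (rule keys_map_key_permutes[OF p assms(2)])
    fix i assume i: "i < n"
    have "\<pi> i < n" using p i permutes_in_image[OF p, of i] by simp
    have "Poly_Mapping.lookup \<gamma> i = xs ! i" using i by (simp add: xs_def)
    also have "\<dots> = ys ! \<pi> i" using permute_list_nth[OF \<pi>(1), of i] \<pi>(2) i by (simp add: ys_def)
    also have "\<dots> = Poly_Mapping.lookup lam (\<pi> i)" using \<open>\<pi> i < n\<close> by (simp add: ys_def)
    finally show "Poly_Mapping.lookup \<gamma> i = Poly_Mapping.lookup (Poly_Mapping.map_key \<pi> lam) i"
      by (simp add: lookup_map_key_permutes[OF p])
  qed
  with p show ?thesis by blast
qed

text \<open>Symmetry makes the coefficients at all rearrangements of \<open>lam\<close> equal. Their
  sum comes from \<open>jack_combo\<close> and their number from \<open>card_rearrangements\<close>;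
  the factorials cancel and the hook product remains.\<close>

lemma jack_poly:
  assumes "parts n m (Poly_Mapping.lookup lam)" "Poly_Mapping.keys lam \<subseteq> {..<n}" "n > 0"
  shows "\<exists>J. (\<forall>\<gamma>. Poly_Mapping.lookup J \<gamma> \<in> nat_polys_in_alpha) \<and> bounded_poly {..<n} (weight lam) J \<and>
    symmetric_mpol n J \<and> Poly_Mapping.lookup J lam = hooks n (Poly_Mapping.lookup lam) \<and>
    (\<forall>\<nu>\<in>comps n. csize n \<nu> \<le> weight lam \<longrightarrow> ms n \<nu> \<noteq> ms n (Poly_Mapping.lookup lam) \<longrightarrow> ev (coord (pt n \<nu>)) J = 0)"
proof -
  define \<rho> where "\<rho> = Poly_Mapping.lookup lam"
  define d where "d = weight lam"
  have d: "csize n \<rho> = d" by (simp add: d_def \<rho>_def weight_csize[OF assms(2)])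
  obtain G where G: "combo_ok n d G" "supported n d {\<nu>. ms n \<nu> = ms n \<rho>} (bar_sum n G)"
      "\<And>j. Suc j < n \<Longrightarrow> sig j (bar_sum n G) = bar_sum n G"
      "coef_sum (\<lambda>\<nu>. ms n \<nu> = ms n \<rho>) G * of_nat (fact (n - m) * mults n \<rho>) = of_nat (fact n) * hooks n \<rho>"
    using jack_combo[OF assms(1)] unfolding \<rho>_def[symmetric] d by blast
  obtain J where
    J: "\<And>\<gamma>. Poly_Mapping.lookup J \<gamma> \<in> nat_polys_in_alpha"
      "\<And>\<gamma>. \<gamma> \<in> Poly_Mapping.keys J \<Longrightarrow> Poly_Mapping.keys \<gamma> \<subseteq> {..<n} \<and> weight \<gamma> \<le> d"
      "\<And>p. ev (coord p) J = bar_sum n G p"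
      "\<And>\<gamma>. Poly_Mapping.keys \<gamma> \<subseteq> {..<n} \<Longrightarrow> weight \<gamma> = d \<Longrightarrow>
        Poly_Mapping.lookup J \<gamma> = coef_sum (\<lambda>\<eta>. \<eta> = Poly_Mapping.lookup \<gamma>) G"
    using combo_poly[OF G(1) assms(3)] by blast
  have bJ: "bounded_poly {..<n} d J" using J(2) by (auto simp: bounded_poly_def)
  have swap: "swap_mpol i J = J" if i: "Suc i < n" for i
  proof -
    \<comment> \<open>Invariance is known for values at generic points only; the vanishing theorem
      lifts it to the polynomial.\<close>
    have "swap_mpol i J + const_mpol (- 1) * J = 0"
    proof (rule vanishing_on_comps)
      show "bounded_poly {..<n} d (swap_mpol i J + const_mpol (- 1) * J)"
        by (intro bounded_poly_add bounded_poly_const_mult bounded_poly_swap bJ i)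
      fix \<nu>
      have "ev (coord (pt n \<nu>)) (swap_mpol i J) = ev (coord (swap_point i (pt n \<nu>))) J"
        by (simp add: ev_swap_mpol coord_swap[abs_def])
      also have "\<dots> = ev (coord (pt n \<nu>)) J" by (simp add: J(3) sig_fixed_swap[OF G(3)[OF i]])
      finally show "ev (coord (pt n \<nu>)) (swap_mpol i J + const_mpol (- 1) * J) = 0"
        by (simp add: ev_add ev_const_mult)
    qed
    then have "Poly_Mapping.lookup (swap_mpol i J + const_mpol (- 1) * J) \<gamma> = 0" for \<gamma> by simp
    then show ?thesis
      by (intro poly_mapping_eqI) (simp add: lookup_add lookup_const_mpol_mult)
  qed
  have sym: "symmetric_mpol n J"
  proof (rule symmetric_mpolI)
    show "in_vars n J" using J(2) by (auto simp: in_vars_def)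
    show "Poly_Mapping.lookup J (swap_expo i \<eta>) = Poly_Mapping.lookup J \<eta>" if "Suc i < n" for i \<eta>
      using lookup_swap_mpol[of i J \<eta>] swap[OF that] by simp
  qed
  define A where "A = arrangements n \<rho>"
  have cardA: "card A = card (permutations_of_multiset (ms n \<rho>))" and finA: "finite A"
    using bij_betw_same_card[OF bij_arrangements[of n \<rho>]] bij_betw_finite[OF bij_arrangements[of n \<rho>]]
    by (auto simp: A_def)
  have wA: "Poly_Mapping.keys \<gamma> \<subseteq> {..<n}" "weight \<gamma> = d" if "\<gamma> \<in> A" for \<gamma>
    using that d by (auto simp: A_def arrangements_def weight_csize csize_ms)
  have "Poly_Mapping.lookup J \<gamma> = Poly_Mapping.lookup J lam" if "\<gamma> \<in> A" for \<gamma>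
    using arrangement_map_key[of \<gamma> n lam] that assms(2) sym by (auto simp: A_def \<rho>_def symmetric_mpol_def)
  then have "of_nat (card A) * Poly_Mapping.lookup J lam = (\<Sum>\<gamma>\<in>A. Poly_Mapping.lookup J \<gamma>)" by simp
  also have "\<dots> = (\<Sum>\<gamma>\<in>A. coef_sum (\<lambda>\<eta>. \<eta> = Poly_Mapping.lookup \<gamma>) G)"
    using wA by (intro sum.cong) (auto simp: J(4))
  also have "\<dots> = coef_sum (\<lambda>\<eta>. \<eta> \<in> Poly_Mapping.lookup ` A) G"
    by (rule coef_sum_sum_eq[OF finA]) (auto simp: inj_on_def intro: poly_mapping_eqI)
  also have "\<dots> = coef_sum (\<lambda>\<nu>. ms n \<nu> = ms n \<rho>) G"
  proof (rule coef_sum_cong)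
    fix c \<eta> assume "(c, \<eta>) \<in> set G"
    then have "\<eta> \<in> comps n" using G(1) by (auto simp: combo_ok_def)
    from expo_of_comp[OF this] obtain \<gamma> where "Poly_Mapping.keys \<gamma> \<subseteq> {..<n}" "Poly_Mapping.lookup \<gamma> = \<eta>" by blast
    then show "(\<eta> \<in> Poly_Mapping.lookup ` A) = (ms n \<eta> = ms n \<rho>)"
      by (auto simp: A_def arrangements_def image_iff)
  qed
  finally have "of_nat (card A) * Poly_Mapping.lookup J lam * of_nat (fact (n - m) * mults n \<rho>) = of_nat (fact n) * hooks n \<rho>"
    by (simp only: G(4))
  moreover have "of_nat (card A) * of_nat (fact (n - m) * mults n \<rho>) = (of_nat (fact n) :: ratfun)"
    unfolding of_nat_mult[symmetric] cardA \<rho>_def card_rearrangements[OF assms(1)] ..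
  ultimately have "of_nat (fact n) * Poly_Mapping.lookup J lam = of_nat (fact n) * hooks n \<rho>"
    by (metis mult.assoc mult.commute)
  then have "Poly_Mapping.lookup J lam = hooks n \<rho>" by simp
  moreover have "ev (coord (pt n \<nu>)) J = 0"
    if "\<nu> \<in> comps n" "csize n \<nu> \<le> d" "ms n \<nu> \<noteq> ms n \<rho>" for \<nu>
    using G(2) that by (simp add: J(3) supported_def)
  ultimately show ?thesis
    using J(1) bJ sym unfolding d_def \<rho>_def by (intro exI[of _ J]) auto
qed

section \<open>Comparison with the interpolation polynomial\<close>

lemma lookup_Abs_expo_scale:
  fixes p :: "'a::comm_ring_1 mpol"
  shows "Poly_Mapping.lookup (Abs_poly_mapping (\<lambda>\<gamma>. f \<gamma> * Poly_Mapping.lookup p \<gamma>)) \<gamma> = f \<gamma> * Poly_Mapping.lookup p \<gamma>"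
proof -
  have "finite {\<gamma>. f \<gamma> * Poly_Mapping.lookup p \<gamma> \<noteq> 0}"
    by (rule finite_subset[OF _ finite_keys[of p]]) (auto simp: in_keys_iff)
  then show ?thesis by (simp add: Abs_poly_mapping_inverse)
qed

definition scale_mpol :: "'a::comm_ring_1 \<Rightarrow> 'a mpol \<Rightarrow> 'a mpol" where
  "scale_mpol s p = Abs_poly_mapping (\<lambda>\<gamma>. s ^ weight \<gamma> * Poly_Mapping.lookup p \<gamma>)"

lemma lookup_scale_mpol: "Poly_Mapping.lookup (scale_mpol s p) \<gamma> = s ^ weight \<gamma> * Poly_Mapping.lookup p \<gamma>"
  by (simp add: scale_mpol_def lookup_Abs_expo_scale)

lemma bounded_poly_scale: "bounded_poly V d p \<Longrightarrow> bounded_poly V d (scale_mpol s p)"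
  by (fastforce simp: bounded_poly_def in_keys_iff lookup_scale_mpol)

lemma ev_scale_mpol: "ev x (scale_mpol s p) = ev (\<lambda>i. s * x i) p"
proof -
  have "mon (\<lambda>i. s * x i) \<gamma> = s ^ weight \<gamma> * mon x \<gamma>" for \<gamma>
    by (simp add: mon_def weight_def power_mult_distrib prod.distrib power_sum)
  moreover have "Poly_Mapping.keys (scale_mpol s p) \<subseteq> Poly_Mapping.keys p"
    by (auto simp: in_keys_iff lookup_scale_mpol)
  ultimately show ?thesis
    by (simp add: ev_superset[of "Poly_Mapping.keys p"] lookup_scale_mpol mult_ac)
qed

lemma weight_map_key:
  assumes "\<pi> permutes {..<n}"
  shows "weight (Poly_Mapping.map_key \<pi> \<gamma>) = weight \<gamma>"
  unfolding weight_def
  by (rule sum.reindex_bij_witness[of _ "inv \<pi>" \<pi>])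
    (auto simp: in_keys_iff lookup_map_key_permutes[OF assms] permutes_inverses[OF assms])

lemma symmetric_scale_mpol: "symmetric_mpol n p \<Longrightarrow> symmetric_mpol n (scale_mpol s p)"
  by (auto simp: symmetric_mpol_def in_vars_def in_keys_iff lookup_scale_mpol weight_map_key)

lemma symmetric_const_mult: "symmetric_mpol n p \<Longrightarrow> symmetric_mpol n (const_mpol c * p)" for c :: "'a::comm_ring_1"
  by (auto simp: symmetric_mpol_def in_vars_def in_keys_iff lookup_const_mpol_mult)

lemma symmetric_swap:
  assumes "symmetric_mpol n p" "Suc i < n"
  shows "swap_mpol i p = p"
proof (rule poly_mapping_eqI)
  have "transpose i (Suc i) permutes {..<n}" using assms(2) by (intro permutes_swap_id) auto
  then show "Poly_Mapping.lookup (swap_mpol i p) \<gamma> = Poly_Mapping.lookup p \<gamma>" for \<gamma>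
    using assms(1) by (simp add: lookup_swap_mpol swap_expo_def symmetric_mpol_def)
qed

lemma ev_swap_point:
  assumes "symmetric_mpol n p" "Suc i < n"
  shows "ev (coord (swap_point i x)) p = ev (coord x) p"
  using ev_swap_mpol[of "coord x" i p] by (simp add: symmetric_swap[OF assms] coord_swap[abs_def])

lemma lookup_monomial_coeffs:
  assumes "symmetric_mpol n p" "is_partition n \<mu>"
  shows "Poly_Mapping.lookup (monomial_coeffs n p) \<mu> = Poly_Mapping.lookup p \<mu>"
proof -
  define c where "c = monomial_coeffs n p"
  have c: "(\<forall>\<mu>\<in>Poly_Mapping.keys c. is_partition n \<mu>) \<and>
     p = (\<Sum>\<mu>\<in>Poly_Mapping.keys c. const_mpol (Poly_Mapping.lookup c \<mu>) * monomial_sym n \<mu>)"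
    unfolding c_def monomial_coeffs_def by (rule theI'[OF monomial_expansion_unique[OF assms(1)]])
  have id: "Poly_Mapping.map_key id \<mu> = \<mu>"
    by (intro poly_mapping_eqI) (simp add: map_key.rep_eq)
  show ?thesis
    using lookup_monomial_sum[OF conjunct1[OF c] assms(2) permutes_id]
    unfolding id conjunct2[OF c, symmetric] by (simp only: c_def)
qed

lemma hook_factor_hooks: "hook_factor n lam = hooks n (Poly_Mapping.lookup lam)"
  by (simp add: hook_factor_def hooks_def boxes_def prod.Sigma arm_def leg_def split_def del: of_nat_diff)

lemma hooks_nonzero: "hooks n \<rho> \<noteq> 0"
proof -
  have "alpha * of_nat a + of_nat l + 1 \<noteq> 0" for a l
    using alpha_generic_nat(2)[of a "Suc l"] by (auto simp: add_ac)
  then show ?thesis by (simp add: hooks_def del: of_nat_diff)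
qed

lemma partition_decreasing:
  assumes "is_partition n \<mu>" "i \<le> j"
  shows "Poly_Mapping.lookup \<mu> j \<le> Poly_Mapping.lookup \<mu> i"
proof (cases "j < n")
  case False
  then have "j \<notin> Poly_Mapping.keys \<mu>" using assms(1) by (auto simp: is_partition_def)
  then show ?thesis by (simp add: in_keys_iff)
qed (use assms in \<open>auto simp: is_partition_def\<close>)

lemma partition_comps: "is_partition n \<mu> \<Longrightarrow> Poly_Mapping.lookup \<mu> \<in> comps n"
  by (auto simp: is_partition_def comps_def) (meson in_keys_iff lessThan_iff not_less subsetD)

text \<open>The ranks of a partition are the entries of \<delta>, so scaling by
  \<open>- indet\<close> turns the vanishing points into the points \<mu> + r\<delta> of the
  definition.\<close>

lemma coord_pt_partition:
  assumes "is_partition n \<mu>" "i < n"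
  shows "coord (pt n (Poly_Mapping.lookup \<mu>)) i = - alpha * shifted_point n \<mu> i"
    and "shifted_point n \<mu> i = - indet * coord (pt n (Poly_Mapping.lookup \<mu>)) i"
proof -
  have "{j. j < n \<and> below (Poly_Mapping.lookup \<mu>) j i} = {Suc i..<n}"
  proof (rule set_eqI)
    fix j
    show "j \<in> {j. j < n \<and> below (Poly_Mapping.lookup \<mu>) j i} \<longleftrightarrow> j \<in> {Suc i..<n}"
      using partition_decreasing[OF assms(1), of i j] partition_decreasing[OF assms(1), of j i]
      by (cases "i < j") (auto simp: below_def)
  qed
  then have rank: "rank n (Poly_Mapping.lookup \<mu>) i = n - 1 - i" by (simp add: rank_def)
  have "alpha * (indet * of_nat (n - 1 - i)) = of_nat (n - 1 - i)"
    unfolding mult.assoc[symmetric] indet_times_alpha by simp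
  then show 1: "coord (pt n (Poly_Mapping.lookup \<mu>)) i = - alpha * shifted_point n \<mu> i"
    using assms(2) unfolding coord_pt[OF assms(2)] rank shifted_point_def
    by (simp add: distrib_left del: of_nat_diff)
  show "shifted_point n \<mu> i = - indet * coord (pt n (Poly_Mapping.lookup \<mu>)) i"
    unfolding 1 minus_mult_minus mult.assoc[symmetric] indet_times_alpha by simp
qed

lemma ms_partition_inj:
  assumes "is_partition n \<mu>" "is_partition n lam" "ms n (Poly_Mapping.lookup \<mu>) = ms n (Poly_Mapping.lookup lam)"
  shows "\<mu> = lam"
proof -
  have "\<mu> \<in> arrangements n (Poly_Mapping.lookup lam)" "Poly_Mapping.keys lam \<subseteq> {..<n}"
    using assms by (auto simp: arrangements_def is_partition_def)
  from arrangement_map_key[OF this] obtain \<pi> where "\<pi> permutes {..<n}" "\<mu> = Poly_Mapping.map_key \<pi> lam" by blast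
  then show ?thesis using partition_rearrangement_unique[of n lam \<pi>] assms by simp
qed

text \<open>Swapping a strict ascent moves between points \<open>pt\<close> without changing
  symmetric polynomials, and lowers the sum of all \<open>i * \<nu> i\<close>; a label without
  ascents is a partition.\<close>

lemma sort_comp:
  assumes "\<nu> \<in> comps n"
  shows "\<exists>\<mu>. is_partition n \<mu> \<and> ms n (Poly_Mapping.lookup \<mu>) = ms n \<nu> \<and>
    (\<forall>p. symmetric_mpol n p \<longrightarrow> ev (coord (pt n \<nu>)) p = ev (coord (pt n (Poly_Mapping.lookup \<mu>))) p)"
  using assms
proof (induction "\<Sum>i<n. i * \<nu> i" arbitrary: \<nu> rule: less_induct)
  case less
  show ?case
  proof (cases "\<exists>i. Suc i < n \<and> \<nu> i < \<nu> (Suc i)")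
    case True
    then obtain i where i: "Suc i < n" "\<nu> i < \<nu> (Suc i)" by blast
    define S where "S \<theta> = (\<Sum>j\<in>{..<n} - {i} - {Suc i}. j * \<theta> j)" for \<theta> :: "nat \<Rightarrow> nat"
    have split: "(\<Sum>j<n. j * \<theta> j) = i * \<theta> i + (Suc i * \<theta> (Suc i) + S \<theta>)" for \<theta> :: "nat \<Rightarrow> nat"
      using i by (simp add: S_def sum.remove[of "{..<n}" i] sum.remove[of "{..<n} - {i}" "Suc i"])
    have "S (swapE i \<nu>) = S \<nu>" by (auto simp: S_def swapE_def transpose_def intro!: sum.cong)
    moreover have "i * \<nu> (Suc i) + Suc i * \<nu> i < i * \<nu> i + Suc i * \<nu> (Suc i)" using i by simp
    moreover have "swapE i \<nu> i = \<nu> (Suc i)" "swapE i \<nu> (Suc i) = \<nu> i" by (simp_all add: swapE_def)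
    ultimately have "(\<Sum>j<n. j * swapE i \<nu> j) < (\<Sum>j<n. j * \<nu> j)"
      unfolding split by simp
    from less.hyps[OF this] i less.prems obtain \<mu> where \<mu>: "is_partition n \<mu>"
        "ms n (Poly_Mapping.lookup \<mu>) = ms n (swapE i \<nu>)"
        "\<And>p. symmetric_mpol n p \<Longrightarrow> ev (coord (pt n (swapE i \<nu>))) p = ev (coord (pt n (Poly_Mapping.lookup \<mu>))) p"
      by auto
    have "ev (coord (pt n (swapE i \<nu>))) p = ev (coord (pt n \<nu>)) p" if "symmetric_mpol n p" for p
      using ev_swap_point[OF that i(1)] swap_pt[OF i(1), of \<nu>] i(2) by (metis less_irrefl)
    then show ?thesis using \<mu> i by (intro exI[of _ \<mu>]) (auto simp: ms_swapE)
  next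
    case False
    have dec: "\<nu> j \<le> \<nu> i" if "i \<le> j" "j < n" for i j
      using that
    proof (induction j)
      case (Suc j)
      have "\<nu> (Suc j) \<le> \<nu> j" using False Suc.prems by (meson not_less)
      then show ?case using Suc by (cases "i = Suc j") auto
    qed simp
    from expo_of_comp[OF less.prems] obtain \<gamma> where \<gamma>: "Poly_Mapping.keys \<gamma> \<subseteq> {..<n}" "Poly_Mapping.lookup \<gamma> = \<nu>" by blast
    then have "is_partition n \<gamma>" using dec by (auto simp: is_partition_def)
    then show ?thesis using \<gamma> by (intro exI[of _ \<gamma>]) simp
  qed
qed

lemma partition_weight: "is_partition n \<mu> \<Longrightarrow> weight \<mu> = csize n (Poly_Mapping.lookup \<mu>)"
  by (simp add: weight_csize is_partition_def)

lemma symmetric_vanishing: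
  assumes "symmetric_mpol n p" "bounded_poly {..<n} d p"
    and "\<And>\<mu>. is_partition n \<mu> \<Longrightarrow> weight \<mu> \<le> d \<Longrightarrow> ev (coord (pt n (Poly_Mapping.lookup \<mu>))) p = 0"
  shows "p = 0"
proof (rule vanishing_on_comps[OF assms(2)])
  fix \<nu> assume \<nu>: "\<nu> \<in> comps n" "csize n \<nu> \<le> d"
  from sort_comp[OF \<nu>(1)] obtain \<mu> where \<mu>: "is_partition n \<mu>" "ms n (Poly_Mapping.lookup \<mu>) = ms n \<nu>"
    "ev (coord (pt n \<nu>)) p = ev (coord (pt n (Poly_Mapping.lookup \<mu>))) p" using assms(1) by blast
  then show "ev (coord (pt n \<nu>)) p = 0"
    using assms(3)[of \<mu>] \<nu>(2) by (simp add: partition_weight csize_ms)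
qed

lemma power_neg_var: "(- var i :: ratfun mpol) ^ k = Poly_Mapping.single (Poly_Mapping.single i k) ((- 1) ^ k)"
proof (induction k)
  case (Suc k)
  have "- var i = (Poly_Mapping.single (Poly_Mapping.single i 1) (- 1) :: ratfun mpol)"
    by (simp add: var_def single_uminus)
  then show ?case using Suc by (simp add: mult_single single_add[symmetric])
qed simp

lemma prod_neg_var:
  "(\<Prod>i\<in>A. (- var i :: ratfun mpol) ^ f i) =
     Poly_Mapping.single (\<Sum>i\<in>A. Poly_Mapping.single i (f i)) ((- 1) ^ (\<Sum>i\<in>A. f i))" if "finite A"
  using that by (induction A rule: finite_induct) (simp_all add: power_neg_var mult_single power_add)

lemma subst_neg_var: "subst_mpol const_mpol (\<lambda>i. - var i) p = scale_mpol (- 1) p" for p :: "ratfun mpol"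
proof (rule poly_mapping_eqI)
  fix \<gamma>
  have "(\<Sum>i\<in>Poly_Mapping.keys \<eta>. Poly_Mapping.single i (Poly_Mapping.lookup \<eta> i)) = \<eta>" for \<eta> :: expo
    by (rule poly_mapping_eqI)
      (auto simp: Poly_Mapping.lookup_sum lookup_single when_def in_keys_iff)
  then have "subst_mpol const_mpol (\<lambda>i. - var i) p =
      (\<Sum>\<eta>\<in>Poly_Mapping.keys p. Poly_Mapping.single \<eta> (Poly_Mapping.lookup p \<eta> * (- 1) ^ weight \<eta>))"
    by (simp add: subst_mpol_def prod_neg_var const_mpol_def mult_single flip: weight_def)
  then show "Poly_Mapping.lookup (subst_mpol const_mpol (\<lambda>i. - var i) p) \<gamma> = Poly_Mapping.lookup (scale_mpol (- 1) p) \<gamma>"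
    by (auto simp: Poly_Mapping.lookup_sum lookup_single when_def lookup_scale_mpol in_keys_iff mult.commute)
qed

lemma bounded_poly_total_degree:
  "bounded_poly {..<n} d p \<longleftrightarrow> in_vars n p \<and> total_degree p \<le> d"
  by (auto simp: bounded_poly_def in_vars_def total_degree_def)

text \<open>The rescaled \<open>J\<close> satisfies the defining conditions. Any other solution,
  scaled back, vanishes wherever \<open>J\<close> is required to, hence is a multiple of
  \<open>J\<close> by \<open>symmetric_vanishing\<close>; the coefficient at \<open>lam\<close>
  fixes the multiple. So the definite description is proper.\<close>

lemma interpolation_poly_eq:
  assumes lam: "is_partition n lam" and J: "bounded_poly {..<n} (weight lam) J" "symmetric_mpol n J"
      "Poly_Mapping.lookup J lam = hook_factor n lam"
      "\<And>\<mu>. is_partition n \<mu> \<Longrightarrow> \<mu> \<noteq> lam \<Longrightarrow> weight \<mu> \<le> weight lam \<Longrightarrow> ev (coord (pt n (Poly_Mapping.lookup \<mu>))) J = 0"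
  shows "interpolation_poly n lam = const_mpol ((- indet) ^ weight lam / hook_factor n lam) * scale_mpol (- alpha) J"
proof -
  define h where "h = hook_factor n lam"
  define d where "d = weight lam"
  \<comment> \<open>Undoes the factor that the rescaling by \<open>- alpha\<close> puts on
    top-degree coefficients and divides by the hook product, so that the coefficient at
    \<open>lam\<close> is 1.\<close>
  define c where "c = (- indet) ^ d / h"
  define P where "P = const_mpol c * scale_mpol (- alpha) J"
  have h: "h \<noteq> 0" by (simp add: h_def hook_factor_hooks hooks_nonzero)
  have ra: "(- indet) ^ k * (- alpha) ^ k = 1" for k
    by (simp add: indet_times_alpha flip: power_mult_distrib)
  have lP: "Poly_Mapping.lookup P \<gamma> = c * ((- alpha) ^ weight \<gamma> * Poly_Mapping.lookup J \<gamma>)" for \<gamma>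
    by (simp add: P_def lookup_const_mpol_mult lookup_scale_mpol)
  have "Poly_Mapping.lookup P lam = ((- indet) ^ d * (- alpha) ^ d) * (h / h)"
    unfolding lP J(3) by (simp add: c_def h_def d_def)
  then have Plam: "Poly_Mapping.lookup P lam = 1" using h by (simp only: ra) simp
  have symP: "symmetric_mpol n P" unfolding P_def by (intro symmetric_const_mult symmetric_scale_mpol J)
  have at: "ev (shifted_point n \<mu>) p = ev (\<lambda>i. - indet * coord (pt n (Poly_Mapping.lookup \<mu>)) i) p"
    "ev (\<lambda>i. - alpha * shifted_point n \<mu> i) p = ev (coord (pt n (Poly_Mapping.lookup \<mu>))) p"
    if "is_partition n \<mu>" "in_vars n p" for \<mu> p
    by (rule ev_cong[of p "{..<n}"]; use that coord_pt_partition[OF that(1)] in \<open>auto simp: in_vars_def\<close>)+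
  have P: "is_interpolation_poly n lam P"
    unfolding is_interpolation_poly_def
  proof (intro conjI allI impI)
    have "bounded_poly {..<n} d P"
      unfolding P_def d_def by (intro bounded_poly_const_mult bounded_poly_scale J)
    then have "total_degree P \<le> weight lam" by (simp add: bounded_poly_total_degree d_def)
    moreover have "weight lam \<le> total_degree P"
      using Plam by (auto simp: total_degree_def in_keys_iff intro!: Max_ge)
    ultimately show "total_degree P = weight lam" by simp
  next
    fix \<mu> assume \<mu>: "is_partition n \<mu>" "\<mu> \<noteq> lam" "weight \<mu> \<le> weight lam"
    have "in_vars n J" using J(2) by (simp add: symmetric_mpol_def)
    then have "ev (shifted_point n \<mu>) P = c * ev (coord (pt n (Poly_Mapping.lookup \<mu>))) J"
      unfolding P_def ev_const_mult ev_scale_mpol by (simp only: at(2)[OF \<mu>(1)])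
    then show "subst_mpol id (shifted_point n \<mu>) P = 0" using J(4)[OF \<mu>] by (simp add: ev_def)
  next
    show "Poly_Mapping.lookup (monomial_coeffs n P) lam = 1"
      by (simp add: lookup_monomial_coeffs[OF symP lam] Plam)
  qed (rule symP)
  moreover have "Q = P" if Q: "is_interpolation_poly n lam Q" for Q
  proof -
    have symQ: "symmetric_mpol n Q" and inQ: "in_vars n Q" and degQ: "total_degree Q = d"
      and vanQ: "\<And>\<mu>. is_partition n \<mu> \<Longrightarrow> \<mu> \<noteq> lam \<Longrightarrow> weight \<mu> \<le> d \<Longrightarrow> ev (shifted_point n \<mu>) Q = 0"
      and lamQ: "Poly_Mapping.lookup Q lam = 1"
      using Q lookup_monomial_coeffs[OF _ lam, of Q]
      by (auto simp: is_interpolation_poly_def d_def ev_def symmetric_mpol_def)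
    define R where "R = scale_mpol (- indet) Q"
    have symR: "symmetric_mpol n R" unfolding R_def by (rule symmetric_scale_mpol[OF symQ])
    have bR: "bounded_poly {..<n} d R" unfolding R_def
      by (rule bounded_poly_scale) (simp add: bounded_poly_total_degree inQ degQ)
    have evR: "ev (coord (pt n (Poly_Mapping.lookup \<mu>))) R = ev (shifted_point n \<mu>) Q" if "is_partition n \<mu>" for \<mu>
      by (simp only: R_def ev_scale_mpol at(1)[OF that inQ])
    define j where "j = ev (coord (pt n (Poly_Mapping.lookup lam))) J"
    \<comment> \<open>Otherwise \<open>J\<close> would vanish at every point of size at most
      \<open>d\<close> and be 0, against its nonzero coefficient at \<open>lam\<close>.\<close>
    have "j \<noteq> 0"
    proof
      assume "j = 0"
      then have "J = 0"
        using J(4) by (intro symmetric_vanishing[OF J(2,1)]) (auto simp: j_def)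
      then show False using J(3) h by (simp add: h_def)
    qed
    define k where "k = ev (coord (pt n (Poly_Mapping.lookup lam))) R / j"
    have "R + const_mpol (- k) * J = 0"
    proof (rule symmetric_vanishing)
      show "symmetric_mpol n (R + const_mpol (- k) * J)"
        using symR symmetric_const_mult[OF J(2), of "- k"] subsetD[OF keys_add[of R "const_mpol (- k) * J"]]
        by (fastforce simp: symmetric_mpol_def in_vars_def lookup_add)
      show "bounded_poly {..<n} d (R + const_mpol (- k) * J)"
        using bR J(1) by (intro bounded_poly_add bounded_poly_const_mult) (simp_all add: d_def)
      fix \<mu> assume \<mu>: "is_partition n \<mu>" "weight \<mu> \<le> d"
      show "ev (coord (pt n (Poly_Mapping.lookup \<mu>))) (R + const_mpol (- k) * J) = 0"
      proof (cases "\<mu> = lam")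
        case True
        then show ?thesis using \<open>j \<noteq> 0\<close> by (simp add: ev_add ev_const_mult k_def j_def)
      next
        case False
        then show ?thesis using \<mu> J(4) vanQ by (simp add: ev_add ev_const_mult evR d_def)
      qed
    qed
    then have "Poly_Mapping.lookup (R + const_mpol (- k) * J) \<gamma> = 0" for \<gamma> by simp
    then have RJ: "(- indet) ^ weight \<gamma> * Poly_Mapping.lookup Q \<gamma> = k * Poly_Mapping.lookup J \<gamma>" for \<gamma>
      by (simp add: lookup_add lookup_const_mpol_mult R_def lookup_scale_mpol)
    have "c = k" using RJ[of lam] h by (simp add: lamQ J(3) c_def d_def h_def)
    show "Q = P"
    proof (rule poly_mapping_eqI)
      fix \<gamma>
      have "Poly_Mapping.lookup Q \<gamma> = (- indet) ^ weight \<gamma> * (- alpha) ^ weight \<gamma> * Poly_Mapping.lookup Q \<gamma>"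
        by (simp only: ra mult_1)
      also have "\<dots> = (- alpha) ^ weight \<gamma> * (k * Poly_Mapping.lookup J \<gamma>)"
        unfolding RJ[symmetric] by (simp only: mult_ac)
      finally show "Poly_Mapping.lookup Q \<gamma> = Poly_Mapping.lookup P \<gamma>"
        by (simp add: lP \<open>c = k\<close> mult_ac)
    qed
  qed
  ultimately have "interpolation_poly n lam = P"
    unfolding interpolation_poly_def by (rule the_equality)
  then show ?thesis by (simp add: P_def c_def d_def h_def)
qed

theorem theoremA:
  fixes n :: nat and lam \<mu> :: "nat \<Rightarrow>\<^sub>0 nat"
  assumes "n \<ge> 1" and "is_partition n lam" and "is_partition n \<mu>"
  shows "normalized_coeff n lam \<mu> \<in> nat_polys_in_alpha"
proof -
  obtain m where m: "parts n m (Poly_Mapping.lookup lam)"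
    using parts_exists[OF partition_comps[OF assms(2)]] partition_decreasing[OF assms(2)] by blast
  have keys: "Poly_Mapping.keys lam \<subseteq> {..<n}" using assms(2) by (simp add: is_partition_def)
  obtain J where J: "\<And>\<gamma>. Poly_Mapping.lookup J \<gamma> \<in> nat_polys_in_alpha"
      "bounded_poly {..<n} (weight lam) J" "symmetric_mpol n J" "Poly_Mapping.lookup J lam = hooks n (Poly_Mapping.lookup lam)"
      "\<And>\<nu>. \<nu> \<in> comps n \<Longrightarrow> csize n \<nu> \<le> weight lam \<Longrightarrow> ms n \<nu> \<noteq> ms n (Poly_Mapping.lookup lam) \<Longrightarrow>
        ev (coord (pt n \<nu>)) J = 0"
    using jack_poly[OF m keys] assms(1) by auto
  have P: "interpolation_poly n lam = const_mpol ((- indet) ^ weight lam / hook_factor n lam) * scale_mpol (- alpha) J"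
  proof (rule interpolation_poly_eq[OF assms(2) J(2,3)])
    fix \<nu> assume "is_partition n \<nu>" "\<nu> \<noteq> lam" "weight \<nu> \<le> weight lam"
    then show "ev (coord (pt n (Poly_Mapping.lookup \<nu>))) J = 0"
      using ms_partition_inj[of n \<nu> lam] assms(2)
      by (intro J(5)) (auto simp: partition_comps simp flip: partition_weight)
  qed (simp add: J(4) hook_factor_hooks)
  define h where "h = hook_factor n lam"
  define d w where "d = weight lam" and "w = weight \<mu>"
  define a where "a = Poly_Mapping.lookup J \<mu>"
  have h: "h \<noteq> 0" by (simp add: h_def hook_factor_hooks hooks_nonzero)
  define I where "I = integral_interpolation_poly n lam"
  have I: "I = const_mpol ((- 1) ^ d * h) * scale_mpol (- 1) (const_mpol ((- indet) ^ d / h) * scale_mpol (- alpha) J)"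
    by (simp only: I_def integral_interpolation_poly_def subst_neg_var P d_def h_def)
  have "symmetric_mpol n I"
    unfolding I by (intro symmetric_const_mult symmetric_scale_mpol J)
  then have "Poly_Mapping.lookup (monomial_coeffs n I) \<mu> = Poly_Mapping.lookup I \<mu>"
    using assms(3) by (rule lookup_monomial_coeffs)
  also have "\<dots> = (- 1) ^ d * h * ((- 1) ^ w * ((- indet) ^ d / h * ((- alpha) ^ w * a)))"
    by (simp only: I lookup_const_mpol_mult lookup_scale_mpol w_def a_def)
  \<comment> \<open>The signs cancel in pairs, and the remaining power of \<open>alpha\<close> is
    the one divided out in \<open>normalized_coeff\<close>, leaving the coefficient of
    \<open>J\<close> itself.\<close>
  also have "\<dots> = ((- 1) ^ d * (- indet) ^ d) * ((- 1) ^ w * (- alpha) ^ w) * a" using h by (simp add: mult_ac)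
  also have "\<dots> = indet ^ d * alpha ^ w * a" by (simp flip: power_mult_distrib)
  finally have "normalized_coeff n lam \<mu> = indet ^ d * alpha ^ w * a / alpha powi (int w - int d)"
    by (simp only: normalized_coeff_def I_def w_def d_def)
  also have "alpha powi (int w - int d) = alpha ^ w / alpha ^ d"
    using indet_times_alpha by (simp add: power_int_diff)
  also have "indet ^ d * alpha ^ w * a / (alpha ^ w / alpha ^ d) = (indet ^ d * alpha ^ d) * a"
    using indet_times_alpha by (simp add: field_simps)
  also have "\<dots> = a" by (simp add: indet_times_alpha flip: power_mult_distrib)
  finally show ?thesis using J(1) by (simp add: a_def)
qed

end
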